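(* $JC(\infty)$ holds if and only if for every $n$ and every $k\in\{3,\ldots,n\}$ there do not exist a Druzkowski $n\times n$ matrix $A$ and a vector $y\in\mathbb{C}^n$ such that $$Z_k+A.(Z_k^3+Z_k*(A.y)^2)=0,$$ where $Z_k=(1,\ldots,1,0,\ldots,0)^t\in\mathbb{C}^n$ is the vector whose first $k$ coordinates are $1$ and whose last $n-k$ coordinates are $0$.
   Context: $JC(n)$ is the statement: every polynomial map $F:\mathbb{C}^n\to\mathbb{C}^n$ whose Jacobian matrix is invertible at every point has a polynomial inverse. $JC(\infty)$ is the statement that $JC(n)$ holds for every $n$. For $u,v\in\mathbb{C}^n$, $u*v=(u_1v_1,\ldots,u_nv_n)$ is the coordinatewise product and $u^k$ is the coordinatewise $k$-th power. A complex $n\times n$ matrix $A$ is called Druzkowski if the map $F_A(x)=x+(A.x)^3:\mathbb{C}^n\to\mathbb{C}^n$ has Jacobian determinant identically equal to $1$. *)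

theory Defs
  imports "HOL-Analysis.Derivative" "Jordan_Normal_Form.Determinant"
begin

text \<open>
  Vectors of \<open>\<complex>\<^sup>n\<close> are the elements of \<open>carrier_vec n\<close>, with coordinates numbered from \<open>0\<close>; maps
  \<open>\<complex>\<^sup>n \<rightarrow> \<complex>\<^sup>n\<close> are HOL functions on \<open>complex vec\<close> that only matter on \<open>carrier_vec n\<close>.
\<close>

no_notation vec_nth (infixl \<open>$\<close> 90)

definition polynomial_fun :: "nat \<Rightarrow> (complex vec \<Rightarrow> complex) \<Rightarrow> bool" where
  "polynomial_fun n f \<longleftrightarrow>
     (\<exists>(M :: (nat \<Rightarrow> nat) set) (c :: (nat \<Rightarrow> nat) \<Rightarrow> complex). finite M \<and>
        (\<forall>x \<in> carrier_vec n. f x = (\<Sum>m\<in>M. c m * (\<Prod>i<n. (x $ i) ^ m i))))"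

definition polynomial_map :: "nat \<Rightarrow> (complex vec \<Rightarrow> complex vec) \<Rightarrow> bool" where
  "polynomial_map n F \<longleftrightarrow>
     F \<in> carrier_vec n \<rightarrow> carrier_vec n \<and> (\<forall>i<n. polynomial_fun n (\<lambda>x. F x $ i))"

text \<open>
  Entry \<open>(i, j)\<close> is the complex partial derivative of the \<open>i\<close>-th component in the \<open>j\<close>-th variable.
  It is meaningful for maps with partial derivatives at \<open>x\<close>, such as polynomial maps.
\<close>

definition jacobian :: "nat \<Rightarrow> (complex vec \<Rightarrow> complex vec) \<Rightarrow> complex vec \<Rightarrow> complex mat" where
  "jacobian n F x =
     Matrix.mat n n (\<lambda>(i, j).
       deriv (\<lambda>t. F (Matrix.vec n (\<lambda>l. if l = j then t else x $ l)) $ i) (x $ j))"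

definition JC :: "nat \<Rightarrow> bool" where
  "JC n \<longleftrightarrow>
     (\<forall>F. polynomial_map n F \<and> (\<forall>x \<in> carrier_vec n. invertible_mat (jacobian n F x)) \<longrightarrow>
       (\<exists>G. polynomial_map n G \<and> (\<forall>x \<in> carrier_vec n. G (F x) = x \<and> F (G x) = x)))"

definition JC_infinity :: bool where
  "JC_infinity \<longleftrightarrow> (\<forall>n. JC n)"

definition cw_mult :: "complex vec \<Rightarrow> complex vec \<Rightarrow> complex vec" (infixl \<open>\<circledast>\<close> 70) where
  "u \<circledast> v = Matrix.vec (dim_vec u) (\<lambda>i. u $ i * v $ i)"

definition cw_power :: "complex vec \<Rightarrow> nat \<Rightarrow> complex vec" (infixr \<open>^\<^sub>v\<close> 80) where
  "u ^\<^sub>v k = map_vec (\<lambda>a. a ^ k) u"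

definition druzkowski_map :: "complex mat \<Rightarrow> complex vec \<Rightarrow> complex vec" where
  "druzkowski_map A x = x + (A *\<^sub>v x) ^\<^sub>v 3"

definition druzkowski :: "nat \<Rightarrow> complex mat \<Rightarrow> bool" where
  "druzkowski n A \<longleftrightarrow>
     A \<in> carrier_mat n n \<and>
     (\<forall>x \<in> carrier_vec n. Determinant.det (jacobian n (druzkowski_map A) x) = 1)"

definition Z_vec :: "nat \<Rightarrow> nat \<Rightarrow> complex vec" where
  "Z_vec n k = Matrix.vec n (\<lambda>i. if i < k then 1 else 0)"

end

theory Submission
  imports Defs "HOL-Complex_Analysis.Conformal_Mappings"
    "HOL-Computational_Algebra.Polynomial_Factorial" "HOL-Computational_Algebra.Field_as_Ring"
    "HOL-Computational_Algebra.Fundamental_Theorem_Algebra"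
begin

text \<open>An injective Keller map \<open>F\<close> has a polynomial inverse. By counting coefficients the coordinates of \<open>x\<close>
  are algebraic over those of \<open>F(x)\<close>, so along a polynomial surface \<open>Y(s, t)\<close> the inverse is rational with a
  reduced denominator \<open>a(s, t)\<close>, and \<open>a\<close> vanishes exactly where \<open>Y\<close> leaves the image of \<open>F\<close>. If some \<open>y\<close>
  is not in the image, choose \<open>F(x\<^sub>1)\<close> far out on the line through \<open>F(0)\<close> and \<open>y\<close> and let
  \<open>Y(s, t) = F(0) + t (F(s x\<^sub>1) - F(0))\<close>. On the lines \<open>s = 0\<close>, \<open>t = 0\<close> and \<open>t = 1\<close> the polynomial \<open>a\<close> has no
  zeros, hence is constant, so \<open>a(1, 0) = a(1, 1)\<close>; but \<open>a(1, \<cdot>)\<close> is not constant and all its roots are close to \<open>0\<close>,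
  so \<open>a(1, 0)\<close> is smaller in modulus than \<open>a(1, 1)\<close>. Thus \<open>F\<close> is bijective, its denominators are constant,
  and the inverse is a polynomial.

  A failure of JC is therefore a noninjective Keller map. It is reduced to degree three, then to
  the form \<open>x + H(x)\<close> with \<open>H\<close> cubic homogeneous, and by Gorni--Zampieri pairing to a noninjective Druzkowski map.
  Two points \<open>u + w\<close> and \<open>u - w\<close> with the same image give \<open>d + A (d\<^sup>3 + 3 d * (A u)\<^sup>2) = 0\<close> with \<open>d = A w\<close>,
  and conjugation with a permutation and a diagonal matrix turns \<open>d\<close> into \<open>Z\<^sub>k\<close>.\<close>

text \<open>Two parameters s and t are few enough for elementary algebra: polynomials in s and t
  factor uniquely, and up to factors free of t they admit division with remainder. One parameter
  would be too few, since zeros of the denominator along a single line contradict nothing; the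
  second parameter ties the line to points whose preimages are known. The degree in t of the
  algebraic relation is bounded by the degree of the surface alone. Hence the inverse has uniformly
  bounded degree on all lines parallel to the axes, and interpolation turns it into one polynomial.
  The Keller condition is kept as triviality of the kernel of the derivative: in the reductions the
  added components then simply determine the added coordinates of a kernel vector. The determinant 1
  of a Druzkowski map is recovered at the end, from the absence of zeros along rays. In the pairing
  the matrix C needs a section, because the midpoint u of two points with the same image has to be
  of the form C X.\<close>

section \<open>Polynomial functions and Keller maps\<close>

text \<open>\<open>pd n d f\<close>: \<open>f\<close> is a polynomial of degree at most \<open>d\<close> in the first \<open>n\<close> coordinates. Points are sequences,
  of which only the first \<open>n\<close> terms matter, so that the dimension can change without changing the type.\<close>

inductive pd :: "nat \<Rightarrow> nat \<Rightarrow> ((nat \<Rightarrow> complex) \<Rightarrow> complex) \<Rightarrow> bool" for n where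
  pd_const: "pd n d (\<lambda>_. c)"
| pd_var: "i < n \<Longrightarrow> pd n (Suc d) (\<lambda>x. x i)"
| pd_add: "pd n d f \<Longrightarrow> pd n d g \<Longrightarrow> pd n d (\<lambda>x. f x + g x)"
| pd_mult: "pd n a f \<Longrightarrow> pd n b g \<Longrightarrow> pd n (a + b) (\<lambda>x. f x * g x)"
| pd_mono: "pd n a f \<Longrightarrow> a \<le> b \<Longrightarrow> pd n b f"

lemma pd_mult': "pd n a f \<Longrightarrow> pd n b g \<Longrightarrow> a + b \<le> d \<Longrightarrow> pd n d (\<lambda>x. f x * g x)"
  using pd_mult pd_mono by blast

lemma pd_cmult: "pd n d f \<Longrightarrow> pd n d (\<lambda>x. c * f x)"
  by (rule pd_mult'[OF pd_const[of n 0]]) auto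

lemma pd_diff: "pd n d f \<Longrightarrow> pd n d g \<Longrightarrow> pd n d (\<lambda>x. f x - g x)"
  using pd_add[of n d f "\<lambda>x. (-1) * g x"] pd_cmult[of n d g "-1"] by simp

lemma pd_sum: "(\<And>k. k \<in> S \<Longrightarrow> pd n d (f k)) \<Longrightarrow> pd n d (\<lambda>x. \<Sum>k\<in>S. f k x)"
proof (induction S rule: infinite_finite_induct)
  case (insert k S) then show ?case by (simp add: pd_add)
qed (auto intro: pd_const)

lemma pd_prod: "finite S \<Longrightarrow> (\<And>k. k \<in> S \<Longrightarrow> pd n d (f k)) \<Longrightarrow> pd n (card S * d) (\<lambda>x. \<Prod>k\<in>S. f k x)"
proof (induction S rule: finite_induct)
  case (insert k S) then show ?case by (simp add: pd_mult)
qed (auto intro: pd_const)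

lemma pd_power: "pd n d f \<Longrightarrow> pd n (k * d) (\<lambda>x. f x ^ k)"
  by (induction k) (auto intro: pd_const pd_mult)

lemma pd_prod_list: "set m \<subseteq> {..<n} \<Longrightarrow> pd n (length m) (\<lambda>x. prod_list (map x m))"
proof (induction m)
  case (Cons i m)
  then show ?case using pd_mult[OF pd_var[of i n 0], of "length m" "\<lambda>x. prod_list (map x m)"] by simp
qed (auto intro: pd_const)

lemma pd_dim_mono: "pd n d f \<Longrightarrow> n \<le> n' \<Longrightarrow> pd n' d f"
  by (induction rule: pd.induct) (auto intro: pd.intros)

lemma pd_cong: "pd n d f \<Longrightarrow> (\<And>i. i < n \<Longrightarrow> x i = y i) \<Longrightarrow> f x = f y"
  by (induction rule: pd.induct) auto

lemma pd_subst:
  assumes "pd n d f" "\<And>i. i < n \<Longrightarrow> pd m e (g i)"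
  shows "pd m (d * e) (\<lambda>x. f (\<lambda>i. g i x))"
  using assms
proof (induction rule: pd.induct)
  case (pd_var i d)
  then show ?case using pd_mono[of m e "g i" "Suc d * e"] by simp
next
  case (pd_mono a f b) then show ?case using pd.pd_mono[of m "a*e" _ "b*e"] by simp
qed (auto intro: pd.intros simp: add_mult_distrib)

lemma pd_curve:
  assumes "pd n d f" "\<And>i. i < n \<Longrightarrow> degree (q i) \<le> e"
  shows "\<exists>p. degree p \<le> d * e \<and> (\<forall>t. f (\<lambda>i. poly (q i) t) = poly p t)"
  using assms
proof (induction rule: pd.induct)
  case (pd_const d c) show ?case by (rule exI[of _ "[:c:]"]) auto
next
  case (pd_var i d) then show ?case by (intro exI[of _ "q i"]) (simp add: trans_le_add1)
next
  case (pd_add d f g)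
  then obtain p p' where "degree p \<le> d * e \<and> (\<forall>t. f (\<lambda>i. poly (q i) t) = poly p t)"
    "degree p' \<le> d * e \<and> (\<forall>t. g (\<lambda>i. poly (q i) t) = poly p' t)" by auto
  then show ?case by (intro exI[of _ "p + p'"]) (auto intro: degree_add_le)
next
  case (pd_mult a f b g)
  then obtain p p' where "degree p \<le> a * e \<and> (\<forall>t. f (\<lambda>i. poly (q i) t) = poly p t)"
    "degree p' \<le> b * e \<and> (\<forall>t. g (\<lambda>i. poly (q i) t) = poly p' t)" by auto
  then show ?case
    by (intro exI[of _ "p * p'"]) (auto intro!: order_trans[OF degree_mult_le] simp: add_mult_distrib)
next
  case (pd_mono a f b) then show ?case by (meson mult_le_mono1 order_trans)
qed

lemma pd_upd:
  assumes "pd n d f"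
  shows "\<exists>p. degree p \<le> d \<and> (\<forall>t. f (x(j := t)) = poly p t)"
proof -
  have "\<exists>p. degree p \<le> d * 1 \<and> (\<forall>t. f (\<lambda>i. poly (if i = j then [:0, 1:] else [:x i:]) t) = poly p t)"
    by (rule pd_curve[OF assms]) auto
  moreover have "(\<lambda>i. poly (if i = j then [:0, 1:] else [:x i:]) t) = x(j := t)" for t
    by auto
  ultimately show ?thesis by simp
qed

text \<open>Hadamard division: the quotients are kept as continuous functions of both points, which makes
  strict differentiability a statement about continuity at the diagonal.\<close>

lemma pd_hadamard:
  assumes "pd n d f"
  shows "\<exists>h. (\<forall>j. continuous_on UNIV (\<lambda>z. h j (fst z) (snd z))) \<and>
    (\<forall>u w. f u - f w = (\<Sum>j<n. h j u w * (u j - w j)))"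
  using assms
proof (induction rule: pd.induct)
  case (pd_const d c) show ?case by (rule exI[of _ "\<lambda>_ _ _. 0"]) auto
next
  case (pd_var i d)
  then show ?case
    by (intro exI[of _ "\<lambda>j _ _. if j = i then 1 else 0"]) (auto simp: if_distrib[of "\<lambda>x. x * _"] cong: if_cong)
next
  case (pd_add d f g)
  then obtain h h' where
    "(\<forall>j. continuous_on UNIV (\<lambda>z. h j (fst z) (snd z))) \<and> (\<forall>u w. f u - f w = (\<Sum>j<n. h j u w * (u j - w j)))"
    "(\<forall>j. continuous_on UNIV (\<lambda>z. h' j (fst z) (snd z))) \<and> (\<forall>u w. g u - g w = (\<Sum>j<n. h' j u w * (u j - w j)))"
    by auto
  then show ?case
    by (intro exI[of _ "\<lambda>j u w. h j u w + h' j u w"])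
       (auto intro!: continuous_intros simp: add_diff_add sum.distrib distrib_right)
next
  case (pd_mult a f b g)
  have c: "continuous_on UNIV F" if "pd n d F" for d F
    using that by (induction rule: pd.induct) (auto intro!: continuous_intros)
  obtain h h' where h:
    "\<forall>j. continuous_on UNIV (\<lambda>z. h j (fst z) (snd z))" "\<forall>u w. f u - f w = (\<Sum>j<n. h j u w * (u j - w j))"
    "\<forall>j. continuous_on UNIV (\<lambda>z. h' j (fst z) (snd z))" "\<forall>u w. g u - g w = (\<Sum>j<n. h' j u w * (u j - w j))"
    using pd_mult.IH by auto
  have cf: "continuous_on UNIV (\<lambda>z. f (fst z))" and cg: "continuous_on UNIV (\<lambda>z. g (snd z))"
    by (intro continuous_on_compose2[OF c[OF pd_mult.hyps(1)]] continuous_on_compose2[OF c[OF pd_mult.hyps(2)]]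
      continuous_intros; simp)+
  have "f u * g u - f w * g w = (\<Sum>j<n. (f u * h' j u w + h j u w * g w) * (u j - w j))" for u w
  proof -
    have "f u * g u - f w * g w = f u * (g u - g w) + (f u - f w) * g w" by (simp add: algebra_simps)
    also have "\<dots> = (\<Sum>j<n. (f u * h' j u w + h j u w * g w) * (u j - w j))"
      unfolding h(2)[rule_format] h(4)[rule_format]
      unfolding sum_distrib_left sum_distrib_right sum.distrib[symmetric]
      by (intro sum.cong refl) (simp add: algebra_simps)
    finally show ?thesis .
  qed
  then show ?case
    by (intro exI[of _ "\<lambda>j u w. f u * h' j u w + h j u w * g w"])
       (auto intro!: continuous_intros cf cg h(1,3)[rule_format])
qed auto

section \<open>Limits of points, directional derivatives and the Keller condition\<close>

lemma tendsto_vec: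
  fixes X :: "'a \<Rightarrow> nat \<Rightarrow> complex"
  assumes "\<And>i. ((\<lambda>k. X k i) \<longlongrightarrow> x i) F"
  shows "(X \<longlongrightarrow> x) F"
  using assms limitin_componentwise[of "\<lambda>_. euclidean" UNIV X x F]
  by (simp add: euclidean_product_topology flip: limitin_canonical_iff)

lemma pd_tendsto:
  assumes "pd n d f" "\<And>i. i < n \<Longrightarrow> ((\<lambda>k. X k i) \<longlongrightarrow> x i) F"
  shows "((\<lambda>k. f (X k)) \<longlongrightarrow> f x) F"
  using assms by (induction rule: pd.induct) (auto intro!: tendsto_intros)

text \<open>A relation between a point, a direction and the value of the derivative: existence and
  value are derived together, and \<open>dd_unique\<close> extracts equations between
  values.\<close>

definition dd :: "((nat \<Rightarrow> complex) \<Rightarrow> complex) \<Rightarrow> (nat \<Rightarrow> complex) \<Rightarrow> (nat \<Rightarrow> complex) \<Rightarrow> complex \<Rightarrow> bool" where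
  "dd f x v l \<longleftrightarrow> ((\<lambda>t. f (\<lambda>i. x i + t * v i)) has_field_derivative l) (at 0)"

lemma dd_const: "dd (\<lambda>_. c) x v 0"
  unfolding dd_def by simp

lemma dd_var: "dd (\<lambda>x. x i) x v (v i)"
  unfolding dd_def by (auto intro!: derivative_eq_intros)

lemma dd_add: "dd f x v l \<Longrightarrow> dd g x v m \<Longrightarrow> dd (\<lambda>x. f x + g x) x v (l + m)"
  unfolding dd_def by (auto intro!: derivative_eq_intros)

lemma dd_diff: "dd f x v l \<Longrightarrow> dd g x v m \<Longrightarrow> dd (\<lambda>x. f x - g x) x v (l - m)"
  unfolding dd_def by (auto intro!: derivative_eq_intros)

lemma dd_mult: "dd f x v l \<Longrightarrow> dd g x v m \<Longrightarrow> dd (\<lambda>x. f x * g x) x v (l * g x + f x * m)"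
  unfolding dd_def by (auto intro!: derivative_eq_intros)

lemma dd_cmult: "dd f x v l \<Longrightarrow> dd (\<lambda>x. c * f x) x v (c * l)"
  using dd_mult[OF dd_const] by fastforce

lemma dd_sum: "(\<And>k. k \<in> S \<Longrightarrow> dd (f k) x v (l k)) \<Longrightarrow> dd (\<lambda>x. \<Sum>k\<in>S. f k x) x v (\<Sum>k\<in>S. l k)"
proof (induction S rule: infinite_finite_induct)
  case (insert k S) then show ?case by (simp add: dd_add)
qed (auto intro: dd_const)

lemma dd_unique: "dd f x v l \<Longrightarrow> dd f x v m \<Longrightarrow> l = m"
  unfolding dd_def by (rule DERIV_unique)

lemma pd_grad:
  assumes "pd n d f"
  shows "\<exists>g. \<forall>v. dd f x v (\<Sum>j<n. g j * v j)"
  using assms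
proof (induction rule: pd.induct)
  case (pd_const d c) show ?case by (rule exI[of _ "\<lambda>_. 0"]) (auto intro: dd_const)
next
  case (pd_var i d)
  then show ?case
    by (intro exI[of _ "\<lambda>j. if j = i then 1 else 0"])
       (auto simp: if_distrib[of "\<lambda>x. x * _"] cong: if_cong intro: dd_var)
next
  case (pd_add d f g)
  then obtain h h' where "\<forall>v. dd f x v (\<Sum>j<n. h j * v j)" "\<forall>v. dd g x v (\<Sum>j<n. h' j * v j)" by auto
  then have "dd (\<lambda>x. f x + g x) x v (\<Sum>j<n. (h j + h' j) * v j)" for v
    using dd_add[of f x v _ g] by (simp add: distrib_right sum.distrib)
  then show ?case by (intro exI[of _ "\<lambda>j. h j + h' j"]) auto
next
  case (pd_mult a f b g)
  then obtain h h' where "\<forall>v. dd f x v (\<Sum>j<n. h j * v j)" "\<forall>v. dd g x v (\<Sum>j<n. h' j * v j)" by auto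
  then have "dd (\<lambda>x. f x * g x) x v ((\<Sum>j<n. h j * v j) * g x + f x * (\<Sum>j<n. h' j * v j))" for v
    using dd_mult[of f x v _ g] by blast
  moreover have "(\<Sum>j<n. h j * v j) * g x + f x * (\<Sum>j<n. h' j * v j)
      = (\<Sum>j<n. (h j * g x + f x * h' j) * v j)" for v :: "nat \<Rightarrow> complex"
    by (simp add: sum_distrib_left sum_distrib_right sum.distrib[symmetric] algebra_simps)
  ultimately show ?case by (intro exI[of _ "\<lambda>j. h j * g x + f x * h' j"]) auto
qed

text \<open>A square matrix is invertible exactly when its kernel is trivial, and the premise says
  that \<open>v\<close> lies in the kernel of the Jacobian at \<open>x\<close>.\<close>

definition keller :: "nat \<Rightarrow> (nat \<Rightarrow> (nat \<Rightarrow> complex) \<Rightarrow> complex) \<Rightarrow> bool" where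
  "keller n F \<longleftrightarrow> (\<forall>x v. (\<forall>i<n. dd (F i) x v 0) \<longrightarrow> (\<forall>i<n. v i = 0))"

definition noninj :: "nat \<Rightarrow> (nat \<Rightarrow> (nat \<Rightarrow> complex) \<Rightarrow> complex) \<Rightarrow> bool" where
  "noninj n F \<longleftrightarrow> (\<exists>a b. (\<forall>i<n. F i a = F i b) \<and> (\<exists>i<n. a i \<noteq> b i))"

text \<open>Local inversion uses the two products separately: \<open>K M = 1\<close> makes the
  iteration contract, \<open>M K = 1\<close> shows that its fixed point solves the equation.\<close>

lemma left_right_inverse:
  fixes M :: "nat \<Rightarrow> nat \<Rightarrow> complex"
  assumes "\<And>v. (\<And>i. i < n \<Longrightarrow> (\<Sum>j<n. M i j * v j) = 0) \<Longrightarrow> (\<And>i. i < n \<Longrightarrow> v i = 0)"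
  shows "\<exists>K. (\<forall>i<n. \<forall>j<n. (\<Sum>k<n. K i k * M k j) = (if i = j then 1 else 0)) \<and>
             (\<forall>i<n. \<forall>j<n. (\<Sum>k<n. M i k * K k j) = (if i = j then 1 else 0))"
proof -
  define A where "A = Matrix.mat n n (\<lambda>(i,j). M i j)"
  have A: "A \<in> carrier_mat n n" by (simp add: A_def)
  have "Determinant.det A \<noteq> 0"
  proof
    assume "Determinant.det A = 0"
    then obtain v where v: "v \<in> carrier_vec n" "v \<noteq> 0\<^sub>v n" "A *\<^sub>v v = 0\<^sub>v n"
      using det_0_iff_vec_prod_zero[OF A] by auto
    have "(\<Sum>j<n. M i j * v $ j) = 0" if "i < n" for i
    proof -
      have "(A *\<^sub>v v) $ i = 0" using v that by simp
      then show ?thesis using that v(1) by (simp add: A_def scalar_prod_def atLeast0LessThan)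
    qed
    then have "v $ i = 0" if "i < n" for i using assms[of "\<lambda>i. v $ i"] that by blast
    then have "v = 0\<^sub>v n" using v(1) by (intro eq_vecI) auto
    then show False using v by simp
  qed
  then obtain B where B: "B \<in> carrier_mat n n" "B * A = 1\<^sub>m n" "A * B = 1\<^sub>m n"
    using det_non_zero_imp_unit[OF A] unfolding Units_def ring_mat_def by auto
  have 1: "(\<Sum>k<n. B $$ (i,k) * M k j) = (if i = j then 1 else 0)" if "i < n" "j < n" for i j
  proof -
    have "(B * A) $$ (i,j) = (if i = j then 1 else 0)" using B that by simp
    then show ?thesis using that B(1) by (simp add: A_def scalar_prod_def atLeast0LessThan)
  qed
  have 2: "(\<Sum>k<n. M i k * B $$ (k,j)) = (if i = j then 1 else 0)" if "i < n" "j < n" for i j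
  proof -
    have "(A * B) $$ (i,j) = (if i = j then 1 else 0)" using B that by simp
    then show ?thesis using that B(1) by (simp add: A_def scalar_prod_def atLeast0LessThan)
  qed
  show ?thesis using 1 2 by (intro exI[of _ "\<lambda>i k. B $$ (i,k)"]) auto
qed

section \<open>Local inversion\<close>

text \<open>With \<open>w = x\<close> in the division, the difference quotient in direction
  \<open>v\<close> is a sum of values of \<open>h\<close> and converges by continuity; the diagonal
  values of \<open>h\<close> are the partial derivatives.\<close>

lemma hadamard_dd:
  assumes h: "\<And>j. continuous_on UNIV (\<lambda>z. h j (fst z) (snd z))"
    and eq: "\<And>u w. f u - f w = (\<Sum>j<n. h j u w * (u j - w j))"
  shows "dd f x v (\<Sum>j<n. h j x x * v j)"
proof -
  have "continuous_on UNIV (\<lambda>t. h j (\<lambda>i. x i + t * v i) x)" for j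
    using continuous_on_compose2[OF h, of UNIV "\<lambda>t. (\<lambda>i. x i + t * v i, x)"]
    by (simp add: continuous_on_Pair continuous_on_coordinatewise_then_product continuous_intros)
  then have "isCont (\<lambda>t. h j (\<lambda>i. x i + t * v i) x) 0" for j
    by (simp add: continuous_on_eq_continuous_at)
  then have "((\<lambda>t. h j (\<lambda>i. x i + t * v i) x) \<longlongrightarrow> h j x x) (at 0)" for j
    unfolding isCont_def by simp
  then have "((\<lambda>t. \<Sum>j<n. h j (\<lambda>i. x i + t * v i) x * v j) \<longlongrightarrow> (\<Sum>j<n. h j x x * v j)) (at 0)"
    by (intro tendsto_intros)
  moreover have "eventually (\<lambda>t. (\<Sum>j<n. h j (\<lambda>i. x i + t * v i) x * v j)
      = (f (\<lambda>i. x i + (0 + t) * v i) - f (\<lambda>i. x i + 0 * v i)) / t) (at 0)"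
    by (rule eventually_mono[OF eventually_neq_at_within[of 0]])
       (simp add: eq[of _ x] sum_divide_distrib)
  ultimately show ?thesis
    unfolding dd_def DERIV_def by (rule Lim_transform_eventually)
qed

text \<open>A ball for the supremum distance is not open in the product topology. But points that
  approach \<open>x\<close> in all coordinates at once converge to \<open>x\<close>, so a failure
  for every \<rho> contradicts the continuity of \<open>C\<close>.\<close>

lemma sequential_uniform:
  fixes C :: "(nat \<Rightarrow> complex) \<times> (nat \<Rightarrow> complex) \<Rightarrow> real"
  assumes "continuous_on UNIV C" "C (x, x) < e"
  shows "\<exists>\<rho>>0. \<forall>u w. (\<forall>i. cmod (u i - x i) < \<rho> \<and> cmod (w i - x i) < \<rho>) \<longrightarrow> C (u, w) < e"
proof (rule ccontr)
  assume "\<not> ?thesis"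
  then have "\<forall>k::nat. \<exists>u w. (\<forall>i. cmod (u i - x i) < 1 / Suc k \<and> cmod (w i - x i) < 1 / Suc k) \<and> \<not> C (u, w) < e"
    by (metis of_nat_0_less_iff zero_less_Suc zero_less_divide_1_iff)
  then obtain u w where uw: "\<And>k i. cmod (u k i - x i) < 1 / Suc k" "\<And>k i. cmod (w k i - x i) < 1 / Suc k"
      "\<And>k. \<not> C (u k, w k) < e"
    by metis
  have lim: "(\<lambda>k. X k i) \<longlonglongrightarrow> x i" if "\<And>k i. cmod (X k i - x i) < 1 / Suc k" for X :: "nat \<Rightarrow> nat \<Rightarrow> complex" and i
  proof -
    have "(\<lambda>k. X k i - x i) \<longlonglongrightarrow> 0"
      by (rule tendsto_0_le[OF lim_inverse_n'[THEN LIMSEQ_Suc], of _ 1]) (use that in \<open>auto intro!: always_eventually less_imp_le\<close>)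
    then show ?thesis by (rule LIM_zero_cancel)
  qed
  have "(\<lambda>k. (u k, w k)) \<longlonglongrightarrow> (x, x)"
    by (intro tendsto_Pair tendsto_vec lim uw)
  then have "(\<lambda>k. C (u k, w k)) \<longlonglongrightarrow> C (x, x)"
    by (rule continuous_on_tendsto_compose[OF assms(1)]) auto
  then have "\<forall>\<^sub>F k in sequentially. C (u k, w k) < e"
    using assms(2) by (rule order_tendstoD)
  then show False using uw(3) by (auto simp: eventually_sequentially)
qed

locale keller_map =
  fixes n d :: nat and F :: "nat \<Rightarrow> (nat \<Rightarrow> complex) \<Rightarrow> complex"
  assumes pdF: "i < n \<Longrightarrow> pd n d (F i)"
    and kellerF: "keller n F"
begin

lemma linearisation:
  "\<exists>h K. (\<forall>i<n. (\<forall>j. continuous_on UNIV (\<lambda>z. h i j (fst z) (snd z))) \<and>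
      (\<forall>u w. F i u - F i w = (\<Sum>j<n. h i j u w * (u j - w j)))) \<and>
    (\<forall>i<n. \<forall>j<n. (\<Sum>k<n. K i k * h k j x x) = (if i = j then 1 else 0)) \<and>
    (\<forall>i<n. \<forall>j<n. (\<Sum>k<n. h i k x x * K k j) = (if i = j then 1 else 0))"
proof -
  have "\<forall>i\<in>{..<n}. \<exists>h. (\<forall>j. continuous_on UNIV (\<lambda>z. h j (fst z) (snd z))) \<and>
      (\<forall>u w. F i u - F i w = (\<Sum>j<n. h j u w * (u j - w j)))"
    using pd_hadamard[OF pdF] by auto
  then obtain h where h0: "\<forall>i\<in>{..<n}. (\<forall>j. continuous_on UNIV (\<lambda>z. h i j (fst z) (snd z))) \<and>
      (\<forall>u w. F i u - F i w = (\<Sum>j<n. h i j u w * (u j - w j)))"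
    by (rule bchoice[THEN exE])
  then have h: "\<And>i j. i < n \<Longrightarrow> continuous_on UNIV (\<lambda>z. h i j (fst z) (snd z))"
    and heq: "\<And>i u w. i < n \<Longrightarrow> F i u - F i w = (\<Sum>j<n. h i j u w * (u j - w j))"
    by blast+
  have ker: "v i = 0" if "\<And>i. i < n \<Longrightarrow> (\<Sum>j<n. h i j x x * v j) = 0" "i < n" for v i
  proof -
    have "dd (F i) x v 0" if "i < n" for i
      using hadamard_dd[of "h i" "F i" n x v, OF h[OF that] heq[OF that]]
      by (simp only: \<open>\<And>i. i < n \<Longrightarrow> (\<Sum>j<n. h i j x x * v j) = 0\<close>[OF that])
    then show ?thesis using kellerF that(2) unfolding keller_def by blast
  qed
  have "\<exists>K. (\<forall>i<n. \<forall>j<n. (\<Sum>k<n. K i k * h k j x x) = (if i = j then 1 else 0)) \<and>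
             (\<forall>i<n. \<forall>j<n. (\<Sum>k<n. h i k x x * K k j) = (if i = j then 1 else 0))"
    by (rule left_right_inverse) (rule ker)
  then obtain K where K: "(\<forall>i<n. \<forall>j<n. (\<Sum>k<n. K i k * h k j x x) = (if i = j then 1 else 0)) \<and>
             (\<forall>i<n. \<forall>j<n. (\<Sum>k<n. h i k x x * K k j) = (if i = j then 1 else 0))" by (rule exE)
  have "\<forall>i<n. (\<forall>j. continuous_on UNIV (\<lambda>z. h i j (fst z) (snd z))) \<and>
      (\<forall>u w. F i u - F i w = (\<Sum>j<n. h i j u w * (u j - w j)))" using h0 by (simp only: Ball_def lessThan_iff)
  from conjI[OF this K] show ?thesis by (rule exI[of _ K, THEN exI[of _ h]])
qed

text \<open>Newton iteration with a fixed matrix \<open>K\<close>, the inverse of the Jacobian at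
  \<open>x\<close>: the map \<open>u - K (F u - y)\<close> contracts near \<open>x\<close>, because
  the deviation \<open>c\<close> of \<open>K h\<close> from the identity is continuous and vanishes
  at (x, x).\<close>

lemma local_surjective:
  assumes "e > 0"
  shows "\<exists>\<delta>>0. \<forall>y. (\<forall>i<n. cmod (y i - F i x) < \<delta>) \<longrightarrow> (\<exists>u. \<forall>i<n. F i u = y i \<and> cmod (u i - x i) < e)"
proof -
  obtain h K where hK: "(\<forall>i<n. (\<forall>j. continuous_on UNIV (\<lambda>z. h i j (fst z) (snd z))) \<and>
      (\<forall>u w. F i u - F i w = (\<Sum>j<n. h i j u w * (u j - w j)))) \<and>
    (\<forall>i<n. \<forall>j<n. (\<Sum>k<n. K i k * h k j x x) = (if i = j then 1 else 0)) \<and>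
    (\<forall>i<n. \<forall>j<n. (\<Sum>k<n. h i k x x * K k j) = (if i = j then 1 else 0))"
    using linearisation[of x] by (elim exE) (rule that)
  then have h: "\<And>i j. i < n \<Longrightarrow> continuous_on UNIV (\<lambda>z. h i j (fst z) (snd z))"
    and heq: "\<And>i u w. i < n \<Longrightarrow> F i u - F i w = (\<Sum>j<n. h i j u w * (u j - w j))"
    and K1: "\<And>i j. i < n \<Longrightarrow> j < n \<Longrightarrow> (\<Sum>k<n. K i k * h k j x x) = (if i = j then 1 else 0)"
    and K2: "\<And>i j. i < n \<Longrightarrow> j < n \<Longrightarrow> (\<Sum>k<n. h i k x x * K k j) = (if i = j then 1 else 0)"
    by blast+
  define c where "c i j u w = (if i = j then 1 else 0) - (\<Sum>k<n. K i k * h k j u w)" for i j u w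
  \<comment> \<open>Summing n entries of size \<epsilon> gives a contraction factor of at most
    1/2.\<close>
  define \<epsilon> :: real where "\<epsilon> = 1 / (2 * (real n + 1))"
  have eps: "\<epsilon> > 0" "real n * \<epsilon> \<le> 1/2" by (auto simp: \<epsilon>_def field_simps)
  have "\<exists>\<rho>>0. \<forall>u w. (\<forall>i. cmod (u i - x i) < \<rho> \<and> cmod (w i - x i) < \<rho>) \<longrightarrow>
     (\<lambda>z. \<Sum>i<n. \<Sum>j<n. cmod (c i j (fst z) (snd z))) (u, w) < \<epsilon>"
  proof (rule sequential_uniform)
    show "continuous_on UNIV (\<lambda>z. \<Sum>i<n. \<Sum>j<n. cmod (c i j (fst z) (snd z)))"
      unfolding c_def by (intro continuous_intros h) auto
    show "(\<Sum>i<n. \<Sum>j<n. cmod (c i j (fst (x, x)) (snd (x, x)))) < \<epsilon>"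
      using eps by (simp add: c_def K1)
  qed
  then obtain \<rho> where rho: "\<rho> > 0" and small:
    "\<And>u w. (\<And>i. cmod (u i - x i) < \<rho>) \<Longrightarrow> (\<And>i. cmod (w i - x i) < \<rho>) \<Longrightarrow>
      (\<Sum>i<n. \<Sum>j<n. cmod (c i j u w)) < \<epsilon>"
    by fastforce
  have small': "cmod (c i j u w) \<le> \<epsilon>" if "\<And>i. cmod (u i - x i) < \<rho>" "\<And>i. cmod (w i - x i) < \<rho>" "i < n" "j < n" for i j u w
  proof -
    have "cmod (c i j u w) \<le> (\<Sum>j<n. cmod (c i j u w))"
      using that by (intro member_le_sum) auto
    also have "\<dots> \<le> (\<Sum>i<n. \<Sum>j<n. cmod (c i j u w))"
      using that by (intro member_le_sum[of i _ "\<lambda>i. \<Sum>j<n. cmod (c i j u w)"]) (auto intro: sum_nonneg)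
    finally show ?thesis using small[OF that(1,2)] by simp
  qed
  define r where "r = min \<rho> e"
  have r: "r > 0" "r \<le> \<rho>" "r \<le> e" using rho assms by (auto simp: r_def)
  define S where "S = 1 + (\<Sum>i<n. \<Sum>k<n. cmod (K i k))"
  have S: "S > 0" unfolding S_def by (intro add_pos_nonneg sum_nonneg) auto
  define nrm where "nrm u w = (\<Sum>i<n. cmod (u i - w i))" for u w :: "nat \<Rightarrow> complex"
  have nrm_ge: "cmod (u i - w i) \<le> nrm u w" if "i < n" for u w i
    unfolding nrm_def using that by (intro member_le_sum) auto
  have nrm_tri: "nrm u w \<le> nrm u v + nrm v w" for u v w
    unfolding nrm_def sum.distrib[symmetric]
    by (rule sum_mono) (metis diff_add_cancel add_diff_eq norm_triangle_ineq)
  show ?thesis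
  \<comment> \<open>The first step of the iteration then has size at most r/4; as the steps halve,
    the iterates stay within r/2 of \<open>x\<close>.\<close>
  proof (intro exI[of _ "r / (4 * S)"] conjI allI impI)
    show "r / (4 * S) > 0" using r S by simp
    fix y assume y: "\<forall>i<n. cmod (y i - F i x) < r / (4 * S)"
    \<comment> \<open>Beyond coordinate n the iterates keep the coordinates of \<open>x\<close>,
      since \<open>small\<close> asks for closeness in every coordinate.\<close>
    define \<phi> where "\<phi> u = (\<lambda>i. if i < n then u i - (\<Sum>k<n. K i k * (F k u - y k)) else x i)" for u
    have contr: "nrm (\<phi> u) (\<phi> w) \<le> nrm u w / 2"
      if "\<And>i. cmod (u i - x i) < \<rho>" "\<And>i. cmod (w i - x i) < \<rho>" for u w
    proof -
      have eq: "\<phi> u i - \<phi> w i = (\<Sum>j<n. c i j u w * (u j - w j))" if "i < n" for i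
      proof -
        have "\<phi> u i - \<phi> w i = (u i - w i) - (\<Sum>k<n. K i k * (F k u - F k w))"
          using that by (simp add: \<phi>_def right_diff_distrib sum_subtractf)
        also have "(\<Sum>k<n. K i k * (F k u - F k w)) = (\<Sum>k<n. \<Sum>j<n. K i k * h k j u w * (u j - w j))"
          by (intro sum.cong refl) (simp add: heq sum_distrib_left mult.assoc)
        also have "\<dots> = (\<Sum>j<n. (\<Sum>k<n. K i k * h k j u w) * (u j - w j))"
          by (subst sum.swap) (simp add: sum_distrib_right)
        also have "u i - w i = (\<Sum>j<n. (if i = j then 1 else 0) * (u j - w j))"
          using that by (simp add: if_distrib[of "\<lambda>x. x * _"] cong: if_cong)
        finally show ?thesis by (simp add: c_def left_diff_distrib sum_subtractf)
      qed
      have "nrm (\<phi> u) (\<phi> w) \<le> (\<Sum>i<n. \<Sum>j<n. \<epsilon> * cmod (u j - w j))"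
        unfolding nrm_def
      proof (rule sum_mono)
        fix i assume "i \<in> {..<n}"
        then have "cmod (\<phi> u i - \<phi> w i) \<le> (\<Sum>j<n. cmod (c i j u w * (u j - w j)))"
          using eq norm_sum by simp
        also have "\<dots> \<le> (\<Sum>j<n. \<epsilon> * cmod (u j - w j))"
          using \<open>i \<in> _\<close> by (intro sum_mono) (auto simp: norm_mult intro!: mult_right_mono small' that)
        finally show "cmod (\<phi> u i - \<phi> w i) \<le> (\<Sum>j<n. \<epsilon> * cmod (u j - w j))" .
      qed
      also have "\<dots> = (real n * \<epsilon>) * nrm u w"
        by (simp add: nrm_def sum_distrib_left mult.assoc)
      also have "\<dots> \<le> (1/2) * nrm u w"
        by (rule mult_right_mono[OF eps(2)]) (auto simp: nrm_def intro: sum_nonneg)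
      finally show ?thesis by simp
    qed
    define X where "X k = (\<phi> ^^ k) x" for k
    have X0: "X 0 = x" and XS: "X (Suc k) = \<phi> (X k)" for k by (auto simp: X_def)
    have Xout: "X k i = x i" if "\<not> i < n" for k i using that by (cases k) (auto simp: X0 XS \<phi>_def)
    have X1: "X 1 = \<phi> x" by (simp add: X_def)
    have y': "cmod (F k x - y k) \<le> r / (4 * S)" if "k < n" for k
      using y that by (simp add: norm_minus_commute less_imp_le)
    have first: "nrm (X 1) x \<le> r / 4"
    proof -
      have "nrm (X 1) x = (\<Sum>i<n. cmod (\<Sum>k<n. K i k * (F k x - y k)))"
        unfolding nrm_def by (intro sum.cong refl) (simp add: X1[simplified] \<phi>_def)
      also have "\<dots> \<le> (\<Sum>i<n. \<Sum>k<n. cmod (K i k) * (r / (4 * S)))"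
        by (intro sum_mono order_trans[OF norm_sum])
          (auto simp: norm_mult simp del: times_divide_eq_right intro!: mult_left_mono y')
      also have "\<dots> = (\<Sum>i<n. \<Sum>k<n. cmod (K i k)) * (r / (4 * S))" by (simp only: sum_distrib_right)
      also have "\<dots> \<le> S * (r / (4 * S))" using r S by (intro mult_right_mono) (auto simp: S_def)
      also have "\<dots> = r / 4" using S by simp
      finally show ?thesis .
    qed
    have inv: "nrm (X k) x \<le> r/2 * (1 - (1/2)^k) \<and> nrm (X (Suc k)) (X k) \<le> r/4 * (1/2)^k" for k
    proof (induction k)
      case 0 then show ?case using first by (simp add: X0 nrm_def[of x x])
    next
      case (Suc k)
      have a: "nrm (X (Suc k)) x \<le> r/2 * (1 - (1/2)^Suc k)"
        using nrm_tri[of "X (Suc k)" x "X k"] Suc by (simp add: algebra_simps)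
      have lt: "cmod (X m i - x i) < \<rho>" if "nrm (X m) x \<le> r/2 * (1 - (1/2)^m)" for m i
      proof (cases "i < n")
        case True
        have "r/2 * (1 - (1/2)^m) \<le> r/2 * 1" using r by (intro mult_left_mono) auto
        then show ?thesis using nrm_ge[OF True, of "X m" x] that r by linarith
      qed (use Xout rho in auto)
      have "nrm (X (Suc (Suc k))) (X (Suc k)) \<le> nrm (X (Suc k)) (X k) / 2"
        using contr[OF lt[OF a] lt[OF conjunct1[OF Suc]]] unfolding XS[symmetric] .
      then show ?case using a Suc by simp
    qed
    have "\<exists>l. (\<lambda>k. X k i) \<longlonglongrightarrow> l" for i
    proof (cases "i < n")
      case True
      have "summable (\<lambda>k. X (Suc k) i - X k i)"
      proof (rule summable_comparison_test')
        show "summable (\<lambda>k. r/4 * (1/2::real)^k)" by (intro summable_mult summable_geometric) auto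
        show "norm (X (Suc k) i - X k i) \<le> r/4 * (1/2)^k" if "k \<ge> 0" for k
          using nrm_ge[OF True, of "X (Suc k)" "X k"] inv[of k] by linarith
      qed
      then have "(\<lambda>m. \<Sum>k<m. X (Suc k) i - X k i) \<longlonglongrightarrow> (\<Sum>k. X (Suc k) i - X k i)"
        by (rule summable_LIMSEQ)
      then have "(\<lambda>m. X m i - X 0 i) \<longlonglongrightarrow> (\<Sum>k. X (Suc k) i - X k i)"
        by (simp add: sum_lessThan_telescope[of "\<lambda>k. X k i"])
      then have "(\<lambda>m. X m i - X 0 i + X 0 i) \<longlonglongrightarrow> (\<Sum>k. X (Suc k) i - X k i) + X 0 i"
        by (intro tendsto_intros)
      then show ?thesis by auto
    qed (auto simp: Xout)
    then have "\<forall>i. \<exists>l. (\<lambda>k. X k i) \<longlonglongrightarrow> l" by blast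
    then obtain u where "\<forall>i. (\<lambda>k. X k i) \<longlonglongrightarrow> u i" by (rule choice[THEN exE])
    then have u: "\<And>i. (\<lambda>k. X k i) \<longlonglongrightarrow> u i" by blast
    have Fl: "(\<lambda>m. F k (X m)) \<longlonglongrightarrow> F k u" if "k < n" for k
      by (rule pd_tendsto[OF pdF[OF that]]) (rule u)
    have 0: "(\<Sum>k<n. K i k * (F k u - y k)) = 0" if "i < n" for i
    proof -
      have "(\<lambda>m. X m i - (\<Sum>k<n. K i k * (F k (X m) - y k))) \<longlonglongrightarrow> u i - (\<Sum>k<n. K i k * (F k u - y k))"
        by (intro tendsto_diff tendsto_sum tendsto_mult tendsto_const u Fl) auto
      moreover have "(\<lambda>m. X m i - (\<Sum>k<n. K i k * (F k (X m) - y k))) = (\<lambda>m. X (Suc m) i)"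
        using that by (auto simp: XS \<phi>_def)
      ultimately have "(\<lambda>m. X (Suc m) i) \<longlonglongrightarrow> u i - (\<Sum>k<n. K i k * (F k u - y k))" by simp
      from LIMSEQ_unique[OF LIMSEQ_Suc[OF u] this] show ?thesis by (simp add: eq_diff_eq)
    qed
    have "F i u = y i" if "i < n" for i
    proof -
      have "(\<Sum>j<n. h i j x x * (\<Sum>k<n. K j k * (F k u - y k)))
          = (\<Sum>j<n. \<Sum>k<n. h i j x x * K j k * (F k u - y k))"
        by (simp only: sum_distrib_left mult.assoc)
      also have "\<dots> = (\<Sum>k<n. (\<Sum>j<n. h i j x x * K j k) * (F k u - y k))"
        by (subst sum.swap) (simp only: sum_distrib_right)
      also have "\<dots> = (\<Sum>k<n. if k = i then F k u - y k else 0)"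
        by (intro sum.cong refl) (use that in \<open>auto simp: K2\<close>)
      also have "\<dots> = F i u - y i" using that by simp
      finally have e: "(\<Sum>j<n. h i j x x * (\<Sum>k<n. K j k * (F k u - y k))) = F i u - y i" .
      have "(\<Sum>j<n. h i j x x * (\<Sum>k<n. K j k * (F k u - y k))) = 0"
        by (rule sum.neutral) (use 0 in auto)
      from trans[OF e[symmetric] this] show ?thesis unfolding right_minus_eq .
    qed
    moreover have "cmod (u i - x i) < e" if "i < n" for i
    proof -
      have "cmod (u i - x i) \<le> r/2"
      proof (rule LIMSEQ_le_const2)
        show "(\<lambda>k. cmod (X k i - x i)) \<longlonglongrightarrow> cmod (u i - x i)" by (intro tendsto_intros u)
        have "r/2 * (1 - (1/2)^m) \<le> r/2 * 1" for m using r by (intro mult_left_mono) auto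
        from order_trans[OF order_trans[OF nrm_ge[OF that] conjunct1[OF inv]] this]
        have "cmod (X m i - x i) \<le> r/2" for m by simp
        then show "\<exists>N. \<forall>k\<ge>N. cmod (X k i - x i) \<le> r/2" by blast
      qed
      then show ?thesis using r by linarith
    qed
    ultimately show "\<exists>u. \<forall>i<n. F i u = y i \<and> cmod (u i - x i) < e" by blast
  qed
qed

end

section \<open>The inverse \<open>G\<close> on the image of an injective Keller map\<close>

lemma bounded_convergent_subsequence:
  fixes X :: "nat \<Rightarrow> nat \<Rightarrow> complex"
  assumes "\<And>i. i < n \<Longrightarrow> bounded (range (\<lambda>k. X k i))"
  shows "\<exists>r z. strict_mono r \<and> (\<forall>i<n. (\<lambda>k. X (r k) i) \<longlonglongrightarrow> z i)"
  using assms
proof (induction n)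
  case 0 then show ?case by (intro exI[of _ id]) (auto simp: strict_mono_def)
next
  case (Suc n)
  then obtain r z where r: "strict_mono r" "\<forall>i<n. (\<lambda>k. X (r k) i) \<longlonglongrightarrow> z i" by auto
  have "bounded (range (\<lambda>k. X (r k) n))"
    by (rule bounded_subset[OF Suc.prems[of n]]) auto
  then obtain l s where s: "strict_mono s" "((\<lambda>k. X (r k) n) \<circ> s) \<longlonglongrightarrow> l"
    using bounded_imp_convergent_subsequence by blast
  have "(\<lambda>k. X ((r \<circ> s) k) i) \<longlonglongrightarrow> (z(n := l)) i" if "i < Suc n" for i
  proof (cases "i = n")
    case True then show ?thesis using s(2) by (simp add: o_def)
  next
    case False
    then have "(\<lambda>k. X (r k) i) \<longlonglongrightarrow> z i" using r(2) that by simp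
    from LIMSEQ_subseq_LIMSEQ[OF this s(1)] show ?thesis using False by (simp add: o_def)
  qed
  then show ?case using strict_mono_o[OF r(1) s(1)] by blast
qed

locale inj_keller_map = keller_map +
  assumes injF: "(\<And>i. i < n \<Longrightarrow> F i a = F i b) \<Longrightarrow> i < n \<Longrightarrow> a i = b i"
begin

definition img :: "(nat \<Rightarrow> complex) \<Rightarrow> bool" where
  "img y \<longleftrightarrow> (\<exists>u. \<forall>i<n. F i u = y i)"

text \<open>The value 0 beyond coordinate n makes \<open>G\<close> converge in every coordinate, as
  continuity of the Hadamard quotients in the product topology requires.\<close>

definition G :: "(nat \<Rightarrow> complex) \<Rightarrow> nat \<Rightarrow> complex" where
  "G y = (\<lambda>i. if i < n then (SOME u. \<forall>i<n. F i u = y i) i else 0)"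

lemma F_G:
  assumes "img y" "i < n"
  shows "F i (G y) = y i"
proof -
  let ?u = "SOME u. \<forall>i<n. F i u = y i"
  have "\<forall>i<n. F i ?u = y i" using assms(1) unfolding img_def by (rule someI_ex)
  moreover have "F i (G y) = F i ?u"
    by (rule pd_cong[OF pdF[OF assms(2)]]) (simp add: G_def)
  ultimately show ?thesis using assms(2) by simp
qed

lemma imgI: "(\<And>i. i < n \<Longrightarrow> F i u = y i) \<Longrightarrow> img y"
  unfolding img_def by blast

lemma G_eq:
  assumes "\<And>i. i < n \<Longrightarrow> F i u = y i" "i < n"
  shows "G y i = u i"
  by (rule injF[OF _ assms(2)]) (simp add: F_G assms(1) imgI[of u])

lemma img_cong: "(\<And>i. i < n \<Longrightarrow> y i = y' i) \<Longrightarrow> img y \<longleftrightarrow> img y'"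
  unfolding img_def by simp

lemma G_cong:
  assumes "\<And>i. i < n \<Longrightarrow> y i = y' i"
  shows "G y = G y'"
proof -
  have "(\<lambda>u. \<forall>i<n. F i u = y i) = (\<lambda>u. \<forall>i<n. F i u = y' i)" using assms by simp
  then show ?thesis unfolding G_def by (simp only:)
qed

text \<open>By injectivity the nearby solution found by \<open>local_surjective\<close> must agree
  with \<open>G y\<close>; openness of the image and continuity of \<open>G\<close> come out
  together.\<close>

lemma G_near:
  assumes "img y0" "e > 0"
  shows "\<exists>\<delta>>0. \<forall>y. (\<forall>i<n. cmod (y i - y0 i) < \<delta>) \<longrightarrow> img y \<and> (\<forall>i<n. cmod (G y i - G y0 i) < e)"
proof -
  from local_surjective[OF assms(2), of "G y0"] obtain \<delta> where \<delta>: "\<delta> > 0"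
    "\<forall>y. (\<forall>i<n. cmod (y i - F i (G y0)) < \<delta>) \<longrightarrow> (\<exists>u. \<forall>i<n. F i u = y i \<and> cmod (u i - G y0 i) < e)" by auto
  show ?thesis
  proof (intro exI[of _ \<delta>] conjI allI impI \<delta>(1))
    fix y assume "\<forall>i<n. cmod (y i - y0 i) < \<delta>"
    then have "\<forall>i<n. cmod (y i - F i (G y0)) < \<delta>" by (simp add: F_G assms(1))
    from \<delta>(2)[rule_format, OF this[rule_format]] obtain u where u: "\<And>i. i < n \<Longrightarrow> F i u = y i" "\<And>i. i < n \<Longrightarrow> cmod (u i - G y0 i) < e"
      by blast
    show "img y" by (rule imgI) (rule u(1))
    fix i assume "i < n"
    then show "cmod (G y i - G y0 i) < e" using G_eq[of u y i] u by simp
  qed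
qed

lemma img_eventually:
  assumes "img y0" "\<And>i. i < n \<Longrightarrow> ((\<lambda>a. y a i) \<longlongrightarrow> y0 i) A"
  shows "\<forall>\<^sub>F a in A. img (y a)"
proof -
  from G_near[OF assms(1), of 1] obtain \<delta> where \<delta>: "\<delta> > 0"
    "\<forall>y. (\<forall>i<n. cmod (y i - y0 i) < \<delta>) \<longrightarrow> img y \<and> (\<forall>i<n. cmod (G y i - G y0 i) < 1)" by auto
  have "\<forall>\<^sub>F a in A. \<forall>i\<in>{..<n}. cmod (y a i - y0 i) < \<delta>"
    by (rule eventually_ball_finite) (use assms(2) \<delta>(1) in \<open>auto simp: tendsto_iff dist_norm\<close>)
  then show ?thesis by (rule eventually_mono) (simp add: \<delta>(2))
qed

lemma G_tendsto:
  assumes "img y0" "\<And>i. i < n \<Longrightarrow> ((\<lambda>a. y a i) \<longlongrightarrow> y0 i) A" "j < n"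
  shows "((\<lambda>a. G (y a) j) \<longlongrightarrow> G y0 j) A"
proof (rule tendstoI)
  fix e :: real assume "e > 0"
  from G_near[OF assms(1) this] obtain \<delta> where \<delta>: "\<delta> > 0"
    "\<forall>y. (\<forall>i<n. cmod (y i - y0 i) < \<delta>) \<longrightarrow> img y \<and> (\<forall>i<n. cmod (G y i - G y0 i) < e)" by auto
  have "\<forall>\<^sub>F a in A. \<forall>i\<in>{..<n}. cmod (y a i - y0 i) < \<delta>"
    by (rule eventually_ball_finite) (use assms(2) \<delta>(1) in \<open>auto simp: tendsto_iff dist_norm\<close>)
  then show "\<forall>\<^sub>F a in A. dist (G (y a) j) (G y0 j) < e"
    by (rule eventually_mono) (use \<delta>(2) assms(3) in \<open>auto simp: dist_norm\<close>)
qed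

text \<open>A limit of image points can be lost only if the preimages escape to infinity: bounded
  preimages have a convergent subsequence, whose limit is a preimage of \<open>y0\<close>.\<close>

lemma img_closed:
  assumes "\<And>k. img (y k)" "\<And>i. i < n \<Longrightarrow> (\<lambda>k. y k i) \<longlonglongrightarrow> y0 i"
    "\<And>i. i < n \<Longrightarrow> bounded (range (\<lambda>k. G (y k) i))"
  shows "img y0"
proof -
  from bounded_convergent_subsequence[of n "\<lambda>k. G (y k)", OF assms(3)] obtain r z where
    r: "strict_mono r" "\<forall>i<n. (\<lambda>k. G (y (r k)) i) \<longlonglongrightarrow> z i" by auto
  have "F i z = y0 i" if "i < n" for i
  proof -
    have "(\<lambda>k. F i (G (y (r k)))) \<longlonglongrightarrow> F i z" by (rule pd_tendsto[OF pdF[OF that]]) (use r(2) in auto)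
    moreover have "(\<lambda>k. F i (G (y (r k)))) = (\<lambda>k. y k i) \<circ> r" by (auto simp: F_G assms(1) that)
    ultimately show ?thesis
      using LIMSEQ_unique[OF _ LIMSEQ_subseq_LIMSEQ[OF assms(2)[OF that] r(1)]] by simp
  qed
  then show ?thesis by (rule imgI)
qed

text \<open>The Hadamard quotients make the difference quotients \<open>q\<close> of the inverse
  solve \<open>q + c q = b\<close> with \<open>c\<close> tending to 0 and \<open>b\<close>
  convergent. Absorbing \<open>c q\<close> first bounds \<open>q\<close>; then \<open>c q\<close>
  tends to 0 and \<open>q\<close> has the limit of \<open>b\<close>.\<close>

lemma G_differentiable:
  assumes y: "\<And>i. i < n \<Longrightarrow> (\<lambda>t. y t i) field_differentiable at t0" and im: "img (y t0)" and "j < n"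
  shows "(\<lambda>t. G (y t) j) field_differentiable at t0"
proof -
  define x where "x = G (y t0)"
  obtain h K where hK: "(\<forall>i<n. (\<forall>j. continuous_on UNIV (\<lambda>z. h i j (fst z) (snd z))) \<and>
      (\<forall>u w. F i u - F i w = (\<Sum>j<n. h i j u w * (u j - w j)))) \<and>
    (\<forall>i<n. \<forall>j<n. (\<Sum>k<n. K i k * h k j x x) = (if i = j then 1 else 0)) \<and>
    (\<forall>i<n. \<forall>j<n. (\<Sum>k<n. h i k x x * K k j) = (if i = j then 1 else 0))"
    using linearisation[of x] by (elim exE) (rule that)
  then have h: "\<And>i j. i < n \<Longrightarrow> continuous_on UNIV (\<lambda>z. h i j (fst z) (snd z))"
    and heq: "\<And>i u w. i < n \<Longrightarrow> F i u - F i w = (\<Sum>j<n. h i j u w * (u j - w j))"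
    and K1: "\<And>i j. i < n \<Longrightarrow> j < n \<Longrightarrow> (\<Sum>k<n. K i k * h k j x x) = (if i = j then 1 else 0)"
    by blast+
  define c where "c i j t = (\<Sum>k<n. K i k * h k j (G (y t)) x) - (if i = j then 1 else 0)" for i j t
  define q where "q t i = (G (y t) i - x i) / (t - t0)" for t i
  define b where "b t i = (\<Sum>k<n. K i k * ((y t k - y t0 k) / (t - t0)))" for t i
  from y have "\<exists>D. ((\<lambda>t. y t i) has_field_derivative D) (at t0)" if "i < n" for i
    using that unfolding field_differentiable_def by blast
  then obtain D where D: "\<And>i. i < n \<Longrightarrow> ((\<lambda>t. y t i) has_field_derivative D i) (at t0)"
    by (metis (mono_tags))
  have yl: "((\<lambda>t. y t i) \<longlongrightarrow> y t0 i) (at t0)" if "i < n" for i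
    using DERIV_isCont[OF D[OF that]] by (simp add: isCont_def)
  have Gx: "((\<lambda>t. G (y t) i) \<longlongrightarrow> x i) (at t0)" for i
  proof (cases "i < n")
    case True
    then show ?thesis unfolding x_def by (intro G_tendsto[OF im yl]) 
  qed (simp add: x_def G_def)
  have c0: "((\<lambda>t. c i j t) \<longlongrightarrow> 0) (at t0)" if "i < n" "j < n" for i j
  proof -
    have 1: "((\<lambda>t. G (y t)) \<longlongrightarrow> x) (at t0)"
      by (rule tendsto_vec) (rule Gx)
    have 2: "((\<lambda>t. h k j (G (y t)) x) \<longlongrightarrow> h k j x x) (at t0)" if "k < n" for k
      using continuous_on_tendsto_compose[OF h[OF that] tendsto_Pair[OF 1 tendsto_const[of x]]] by simp
    have "((\<lambda>t. (\<Sum>k<n. K i k * h k j (G (y t)) x) - (if i = j then 1 else 0)) \<longlongrightarrow>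
        (\<Sum>k<n. K i k * h k j x x) - (if i = j then 1 else 0)) (at t0)"
      by (intro tendsto_diff tendsto_sum tendsto_mult tendsto_const 2) auto
    then show ?thesis by (simp add: c_def K1 that)
  qed
  have ev: "\<forall>\<^sub>F t in at t0. img (y t) \<and> t \<noteq> t0"
    by (intro eventually_conj img_eventually[OF im yl] eventually_neq_at_within)
  have qb: "q t i + (\<Sum>j<n. c i j t * q t j) = b t i" if im': "img (y t)" and "i < n" for t i
  proof -
    have "F k (G (y t)) - F k x = y t k - y t0 k" if "k < n" for k
      using that im' im by (simp add: F_G x_def)
    then have "(\<Sum>k<n. K i k * (y t k - y t0 k)) = (\<Sum>k<n. K i k * (\<Sum>j<n. h k j (G (y t)) x * (G (y t) j - x j)))"
      by (intro sum.cong refl) (simp flip: heq)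
    also have "\<dots> = (\<Sum>j<n. (\<Sum>k<n. K i k * h k j (G (y t)) x) * (G (y t) j - x j))"
      unfolding sum_distrib_left sum_distrib_right by (subst sum.swap) (simp only: mult.assoc)
    also have "\<dots> = (\<Sum>j<n. c i j t * (G (y t) j - x j)) + (\<Sum>j<n. if j = i then G (y t) j - x j else 0)"
      unfolding sum.distrib[symmetric]
      by (intro sum.cong refl) (auto simp: c_def algebra_simps)
    also have "(\<Sum>j<n. if j = i then G (y t) j - x j else 0) = G (y t) i - x i"
      using that(2) by simp
    finally have "(\<Sum>k<n. K i k * (y t k - y t0 k)) / (t - t0)
        = ((\<Sum>j<n. c i j t * (G (y t) j - x j)) + (G (y t) i - x i)) / (t - t0)" by simp
    then show ?thesis
      by (simp add: b_def q_def sum_divide_distrib add_divide_distrib)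
  qed
  define B where "B i = (\<Sum>k<n. K i k * D k)" for i
  have bl: "((\<lambda>t. b t i) \<longlongrightarrow> B i) (at t0)" for i
    unfolding b_def B_def
  proof (intro tendsto_sum tendsto_mult tendsto_const)
    fix k assume "k \<in> {..<n}"
    then show "((\<lambda>t. (y t k - y t0 k) / (t - t0)) \<longlongrightarrow> D k) (at t0)"
      using D[of k] by (simp add: has_field_derivative_iff)
  qed
  define \<beta> where "\<beta> t = (\<Sum>i<n. cmod (b t i))" for t
  define \<gamma> where "\<gamma> t = (\<Sum>i<n. \<Sum>j<n. cmod (c i j t))" for t
  have \<beta>: "(\<beta> \<longlongrightarrow> (\<Sum>i<n. cmod (B i))) (at t0)"
    unfolding \<beta>_def by (intro tendsto_sum tendsto_norm bl)
  have "(\<gamma> \<longlongrightarrow> (\<Sum>i<n. \<Sum>j<n. cmod 0)) (at t0)"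
    unfolding \<gamma>_def by (intro tendsto_sum tendsto_norm c0) auto
  then have \<gamma>: "(\<gamma> \<longlongrightarrow> 0) (at t0)" by simp
  have g1: "cmod (c i j t) \<le> \<gamma> t" if "i < n" "j < n" for i j t
  proof -
    have "cmod (c i j t) \<le> (\<Sum>j<n. cmod (c i j t))" using that by (intro member_le_sum) auto
    also have "\<dots> \<le> \<gamma> t" unfolding \<gamma>_def
      using that by (intro member_le_sum[of i _ "\<lambda>i. \<Sum>j<n. cmod (c i j t)"]) (auto intro: sum_nonneg)
    finally show ?thesis .
  qed
  have cq: "cmod (\<Sum>j<n. c i j t * q t j) \<le> \<gamma> t * (\<Sum>j<n. cmod (q t j))" if "i < n" for i t
    unfolding sum_distrib_left
    by (rule order_trans[OF norm_sum sum_mono]) (auto simp: norm_mult intro!: mult_right_mono g1 that)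
  have ev2: "\<forall>\<^sub>F t in at t0. (\<Sum>j<n. cmod (q t j)) \<le> 2 * \<beta> t"
  proof -
    have "\<forall>\<^sub>F t in at t0. \<gamma> t < 1 / (2 * (real n + 1))"
      by (rule order_tendstoD(2)[OF \<gamma>]) auto
    with ev show ?thesis
    proof eventually_elim
      case (elim t)
      let ?Q = "\<Sum>j<n. cmod (q t j)"
      have Q0: "?Q \<ge> 0" by (intro sum_nonneg) auto
      have "?Q \<le> (\<Sum>i<n. cmod (b t i) + \<gamma> t * ?Q)"
      proof (rule sum_mono)
        fix i assume "i \<in> {..<n}"
        then have "q t i = b t i - (\<Sum>j<n. c i j t * q t j)" using qb[of t i] elim by (simp add: eq_diff_eq)
        then have "cmod (q t i) \<le> cmod (b t i) + cmod (\<Sum>j<n. c i j t * q t j)"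
          by (simp only: norm_triangle_ineq4)
        then show "cmod (q t i) \<le> cmod (b t i) + \<gamma> t * ?Q" using cq[of i t] \<open>i \<in> _\<close> by simp
      qed
      also have "\<dots> = \<beta> t + real n * \<gamma> t * ?Q" by (simp add: sum.distrib \<beta>_def)
      also have "real n * \<gamma> t * ?Q \<le> (1/2) * ?Q"
      proof (rule mult_right_mono[OF _ Q0])
        have "real n * \<gamma> t \<le> real n * (1 / (2 * (real n + 1)))" using elim by (intro mult_left_mono) auto
        also have "\<dots> \<le> 1/2" by (simp add: field_simps)
        finally show "real n * \<gamma> t \<le> 1/2" .
      qed
      finally show ?case by simp
    qed
  qed
  have "((\<lambda>t. \<Sum>k<n. c j k t * q t k) \<longlongrightarrow> 0) (at t0)"
  proof (rule Lim_null_comparison)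
    show "\<forall>\<^sub>F t in at t0. norm (\<Sum>k<n. c j k t * q t k) \<le> \<gamma> t * (2 * \<beta> t)"
      using ev2
    proof eventually_elim
      case (elim t)
      have "\<gamma> t \<ge> 0" unfolding \<gamma>_def by (intro sum_nonneg) auto
      then show ?case using cq[OF \<open>j < n\<close>, of t] mult_left_mono[OF elim, of "\<gamma> t"] by linarith
    qed
    have "((\<lambda>t. \<gamma> t * (2 * \<beta> t)) \<longlongrightarrow> 0 * (2 * (\<Sum>i<n. cmod (B i)))) (at t0)"
      by (intro tendsto_intros \<beta> \<gamma>)
    then show "((\<lambda>t. \<gamma> t * (2 * \<beta> t)) \<longlongrightarrow> 0) (at t0)" by simp
  qed
  from tendsto_diff[OF bl[of j] this]
  have "((\<lambda>t. b t j - (\<Sum>k<n. c j k t * q t k)) \<longlongrightarrow> B j) (at t0)" by simp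
  moreover have "\<forall>\<^sub>F t in at t0. b t j - (\<Sum>k<n. c j k t * q t k) = (G (y t) j - G (y t0) j) / (t - t0)"
    using ev
  proof eventually_elim
    case (elim t)
    then show ?case using qb[of t j] \<open>j < n\<close> by (simp add: q_def[of t j] x_def diff_eq_eq)
  qed
  ultimately have "((\<lambda>t. (G (y t) j - G (y t0) j) / (t - t0)) \<longlongrightarrow> B j) (at t0)"
    by (rule Lim_transform_eventually)
  then show ?thesis
    unfolding field_differentiable_def has_field_derivative_iff by blast
qed

end

section \<open>Algebraicity of the inverse\<close>

lemma underdetermined:
  fixes M :: "'a \<Rightarrow> 'b \<Rightarrow> complex"
  assumes "finite B" "finite A" "card B < card A"
  shows "\<exists>c. (\<exists>a\<in>A. c a \<noteq> 0) \<and> (\<forall>b\<in>B. (\<Sum>a\<in>A. c a * M a b) = 0)"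
  using assms
proof (induction B arbitrary: A M rule: finite_induct)
  case empty
  then have "A \<noteq> {}" by auto
  then show ?case by (intro exI[of _ "\<lambda>_. 1"]) auto
next
  case (insert b B)
  show ?case
  proof (cases "\<forall>a\<in>A. M a b = 0")
    case True
    then show ?thesis using insert.IH[of A M] insert.prems insert.hyps by auto
  next
    case False
    then obtain a0 where a0: "a0 \<in> A" "M a0 b \<noteq> 0" by auto
    define A' where "A' = A - {a0}"
    have A': "finite A'" "card B < card A'" "A = insert a0 A'" "a0 \<notin> A'"
      using insert a0 by (auto simp: A'_def)
    obtain c where c: "\<exists>a\<in>A'. c a \<noteq> 0"
      "\<forall>b'\<in>B. (\<Sum>a\<in>A'. c a * (M a b' - M a b / M a0 b * M a0 b')) = 0"
      using insert.IH[OF A'(1,2), of "\<lambda>a b'. M a b' - M a b / M a0 b * M a0 b'"] by auto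
    define c' where "c' = c(a0 := - (\<Sum>a\<in>A'. c a * (M a b / M a0 b)))"
    have s: "(\<Sum>a\<in>A. c' a * M a b') = (\<Sum>a\<in>A'. c a * (M a b' - M a b / M a0 b * M a0 b'))" for b'
    proof -
      have "(\<Sum>a\<in>A'. c' a * M a b') = (\<Sum>a\<in>A'. c a * M a b')"
        using A'(4) by (intro sum.cong) (auto simp: c'_def)
      then show ?thesis
        using A' by (simp add: c'_def right_diff_distrib sum_subtractf sum_distrib_right mult.assoc)
    qed
    have "\<exists>a\<in>A. c' a \<noteq> 0" using c(1) A'(3,4) by (auto simp: c'_def)
    moreover have "(\<Sum>a\<in>A. c' a * M a b') = 0" if "b' \<in> insert b B" for b'
      using that c(2) a0(2) by (auto simp: s)
    ultimately show ?thesis by blast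
  qed
qed

definition lagrange_poly :: "complex set \<Rightarrow> complex \<Rightarrow> complex poly" where
  "lagrange_poly T b = (\<Prod>a\<in>T - {b}. smult (1 / (b - a)) [:- a, 1:])"

lemma poly_lagrange_poly:
  assumes "finite T" "a \<in> T" "b \<in> T"
  shows "poly (lagrange_poly T b) a = (if a = b then 1 else 0)"
proof (cases "a = b")
  case True
  have "poly (lagrange_poly T b) b = (\<Prod>k\<in>T - {b}. 1)"
    unfolding lagrange_poly_def poly_prod
    by (intro prod.cong refl) (auto simp flip: diff_divide_distrib)
  then show ?thesis using True by simp
next
  case False
  then have "poly (lagrange_poly T b) a = 0"
    unfolding lagrange_poly_def poly_prod
    by (intro prod_zero bexI[of _ a]) (use assms in auto)
  then show ?thesis using False by simp
qed

lemma degree_lagrange_poly: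
  assumes "finite T" "b \<in> T"
  shows "degree (lagrange_poly T b) < card T"
proof -
  have "degree (lagrange_poly T b) \<le> (\<Sum>a\<in>T - {b}. (degree \<circ> (\<lambda>a. smult (1 / (b - a)) [:- a, 1:])) a)"
    unfolding lagrange_poly_def by (rule degree_prod_sum_le) (use assms in auto)
  also have "\<dots> \<le> (\<Sum>a\<in>T - {b}. 1)"
    by (intro sum_mono) auto
  also have "\<dots> < card T" using assms card_gt_0_iff[of T] by (auto simp: card_Diff_singleton)
  finally show ?thesis .
qed

lemma lagrange_interpolation:
  assumes "finite T" "degree p < card T"
  shows "poly p z = (\<Sum>b\<in>T. poly p b * poly (lagrange_poly T b) z)"
proof -
  define q where "q = (\<Sum>b\<in>T. smult (poly p b) (lagrange_poly T b))"
  have "p = q"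
  proof (rule poly_eqI_degree[of T])
    show "poly p x = poly q x" if "x \<in> T" for x
    proof -
      have "poly q x = (\<Sum>b\<in>T. if b = x then poly p b else 0)"
        unfolding q_def poly_sum
        by (intro sum.cong refl) (use that assms(1) in \<open>auto simp: poly_lagrange_poly\<close>)
      then show ?thesis using that assms(1) by simp
    qed
    have T: "T \<noteq> {}" using assms by auto
    show "degree q < card T" unfolding q_def
      by (rule degree_sum_less) (use assms T degree_lagrange_poly in \<open>auto simp: card_gt_0_iff\<close>)
  qed (use assms in auto)
  from arg_cong[OF this, of "\<lambda>p. poly p z"] show ?thesis by (simp add: q_def poly_sum)
qed

lemma pd_poly: "j < n \<Longrightarrow> degree p \<le> d \<Longrightarrow> pd n d (\<lambda>x. poly p (x j))"
proof -
  assume j: "j < n" "degree p \<le> d"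
  have "pd n d (\<lambda>x. \<Sum>i\<le>degree p. coeff p i * x j ^ i)"
  proof (intro pd_sum pd_cmult)
    fix i assume "i \<in> {..degree p}"
    have "pd n (i * 1) (\<lambda>x. x j ^ i)" using pd_var[OF j(1), of 0] by (intro pd_power) simp
    then show "pd n d (\<lambda>x. x j ^ i)" by (rule pd_mono) (use \<open>i \<in> _\<close> j(2) in auto)
  qed
  then show ?thesis by (simp add: poly_altdef)
qed

text \<open>The total degree bounds the degree in each variable, so a variable confined to
  \<open>T\<close> can be released, one variable after the other.\<close>

lemma pd_zero_on_grid:
  assumes "pd n d f" "finite T" "d < card T"
    and z: "\<And>x. (\<And>i. i < n \<Longrightarrow> x i \<in> T) \<Longrightarrow> f x = 0"
  shows "f x = 0"
proof -
  have "\<forall>x. (\<forall>i<n. k \<le> i \<longrightarrow> x i \<in> T) \<longrightarrow> f x = 0" for k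
  proof (induction k)
    case 0 then show ?case using z by auto
  next
    case (Suc k)
    show ?case
    proof (intro allI impI)
      fix x assume x: "\<forall>i<n. Suc k \<le> i \<longrightarrow> x i \<in> T"
      obtain p where p: "degree p \<le> d" "\<And>t. f (x(k := t)) = poly p t"
        using pd_upd[OF assms(1), of x k] by auto
      have "poly p t = 0" if "t \<in> T" for t
      proof -
        have "f (x(k := t)) = 0" using x that by (intro Suc.IH[rule_format]) auto
        then show ?thesis by (simp add: p)
      qed
      then have "p = 0" using p(1) assms(2,3) by (intro poly_eqI_degree[of T]) auto
      then show "f x = 0" using p(2)[of "x k"] by simp
    qed
  qed
  from this[of n] show ?thesis by simp
qed

text \<open>The bound \<open>D\<close> is the same for all slices, so one set of D + 1 nodes
  interpolates all of them, and the variables can be freed one at a time.\<close>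

lemma separately_polynomial:
  assumes cong: "\<And>x y. (\<And>i. i < n \<Longrightarrow> x i = y i) \<Longrightarrow> H x = H y"
    and sep: "\<And>x j. j < n \<Longrightarrow> \<exists>p. degree p \<le> D \<and> (\<forall>t. H (x(j := t)) = poly p t)"
  shows "\<exists>d. pd n d H"
proof -
  define T where "T = (of_nat :: nat \<Rightarrow> complex) ` {..D}"
  have T: "finite T" "card T = Suc D"
    by (auto simp: T_def card_image inj_on_def)
  \<comment> \<open>The degree is chosen before the values \<open>c\<close> of the variables not yet
    freed, because the induction step inserts nodes into \<open>c\<close>.\<close>
  have main: "\<exists>d. \<forall>c. pd n d (\<lambda>x. H (\<lambda>i. if i < k then x i else c i))" if "k \<le> n" for k
    using that
  proof (induction k)
    case 0 then show ?case by (auto intro: pd_const)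
  next
    case (Suc k)
    then obtain d where d: "\<And>c. pd n d (\<lambda>x. H (\<lambda>i. if i < k then x i else c i))" by auto
    have "pd n (d + D) (\<lambda>x. H (\<lambda>i. if i < Suc k then x i else c i))" for c
    proof -
      have eq: "H (\<lambda>i. if i < Suc k then x i else c i) =
        (\<Sum>b\<in>T. H (\<lambda>i. if i < k then x i else (c(k := b)) i) * poly (lagrange_poly T b) (x k))" for x
      proof -
        obtain p where p: "degree p \<le> D" "\<And>t. H ((\<lambda>i. if i < k then x i else c i)(k := t)) = poly p t"
          using sep[of k "\<lambda>i. if i < k then x i else c i"] Suc.prems by auto
        have u: "(\<lambda>i. if i < k then x i else c i)(k := t) = (\<lambda>i. if i < k then x i else (c(k := t)) i)" for t
          by auto
        have "(\<lambda>i. if i < Suc k then x i else c i) = (\<lambda>i. if i < k then x i else c i)(k := x k)"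
          by (auto simp: less_Suc_eq)
        then have e1: "H (\<lambda>i. if i < Suc k then x i else c i) = poly p (x k)" using p(2) by simp
        have e2: "poly p b = H (\<lambda>i. if i < k then x i else (c(k := b)) i)" for b
          using p(2)[of b] unfolding u by (rule sym)
        have e3: "poly p (x k) = (\<Sum>b\<in>T. poly p b * poly (lagrange_poly T b) (x k))"
          by (rule lagrange_interpolation) (use T p(1) in auto)
        show ?thesis unfolding e1 e3 by (intro sum.cong refl) (simp only: e2)
      qed
      show ?thesis unfolding eq
      proof (intro pd_sum pd_mult d pd_poly)
        show "degree (lagrange_poly T b) \<le> D" if bT: "b \<in> T" for b
          using degree_lagrange_poly[OF T(1) bT] T by simp
      qed (use Suc.prems in auto)
    qed
    then show ?case by blast
  qed
  from main[OF order_refl] obtain d where d: "\<forall>c. pd n d (\<lambda>x. H (\<lambda>i. if i < n then x i else c i))" ..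
  have eq: "(\<lambda>x. H (\<lambda>i. if i < n then x i else 0)) = H" by (intro ext cong) auto
  from d[rule_format, of "\<lambda>_. 0"] show ?thesis unfolding eq by (rule exI)
qed

context keller_map
begin

text \<open>The unknown coefficients, in the Lagrange basis of a grid \<open>T\<close> and powers of \<open>x i\<close>, outnumber the linear
  conditions that the relation vanishes on a grid \<open>T'\<close> large enough to force it to vanish identically.\<close>

lemma coordinate_algebraic:
  assumes "i < n"
  shows "\<exists>K d' c. (\<forall>k<K. pd n d' (c k)) \<and> (\<exists>k<K. \<exists>y. c k y \<noteq> 0) \<and>
    (\<forall>x. (\<Sum>k<K. c k (\<lambda>j. F j x) * x i ^ k) = 0)"
proof -
  \<comment> \<open>There are K^n grid points times K powers as unknowns and (D + 1)^n equations. As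
    D + 1 <= K (n d + 2), the equations number at most K^n (n d + 2)^n, which is less than K^n
    K.\<close>
  define K where "K = (n * d + 2) ^ n + 1"
  define T where "T = (of_nat :: nat \<Rightarrow> complex) ` {..<K}"
  have T: "finite T" "card T = K" by (auto simp: T_def card_image inj_on_def)
  \<comment> \<open>The coefficients have degree at most n K in \<open>y\<close>, hence n K d after
    inserting \<open>F\<close>, and the power of \<open>x i\<close> adds less than K.\<close>
  define D where "D = n * K * d + K"
  define T' where "T' = (of_nat :: nat \<Rightarrow> complex) ` {..D}"
  have T': "finite T'" "card T' = Suc D" by (auto simp: T'_def card_image inj_on_def)
  define P where "P = PiE {..<n} (\<lambda>_. T)"
  define A where "A = P \<times> {..<K}"
  define B where "B = PiE {..<n} (\<lambda>_. T')"
  have P: "finite P" "card P = K ^ n" by (auto simp: P_def T card_PiE intro!: finite_PiE)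
  have "K \<ge> 1" by (simp add: K_def)
  have "Suc D \<le> K * (n * d + 2)" using \<open>K \<ge> 1\<close> by (simp add: D_def algebra_simps)
  then have "Suc D ^ n \<le> K ^ n * (n * d + 2) ^ n" by (metis power_mono power_mult_distrib zero_le)
  also have "\<dots> < K ^ n * K" using \<open>K \<ge> 1\<close> by (simp add: K_def)
  finally have card: "card B < card A"
    using P by (simp add: A_def B_def card_PiE T' card_cartesian_product)
  define L where "L \<beta> y = (\<Prod>j<n. poly (lagrange_poly T (\<beta> j)) (y j))" for \<beta> y :: "nat \<Rightarrow> complex"
  have L: "pd n (n * K) (L \<beta>)" if "\<beta> \<in> P" for \<beta>
  proof -
    have "pd n (card {..<n} * K) (\<lambda>y. \<Prod>j<n. poly (lagrange_poly T (\<beta> j)) (y j))"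
    proof (intro pd_prod pd_poly)
      fix j assume "j \<in> {..<n}"
      then have "\<beta> j \<in> T" using PiE_mem[OF that[unfolded P_def]] by simp
      from degree_lagrange_poly[OF T(1) this] show "degree (lagrange_poly T (\<beta> j)) \<le> K" by (simp add: T(2))
    qed auto
    then show ?thesis by (simp add: L_def[abs_def])
  qed
  have inT: "\<beta> j \<in> T" if "\<beta> \<in> P" "j < n" for \<beta> j
    using PiE_mem[OF that(1)[unfolded P_def]] that(2) by simp
  \<comment> \<open>\<open>L\<close> is dual to the grid points, so a nonzero unknown is a value of
    its coefficient polynomial, which is therefore not zero.\<close>
  have LL: "L \<beta> \<beta>' = (if \<beta> = \<beta>' then 1 else 0)" if "\<beta> \<in> P" "\<beta>' \<in> P" for \<beta> \<beta>'
  proof (cases "\<beta> = \<beta>'")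
    case True
    then show ?thesis by (simp add: L_def poly_lagrange_poly T(1) inT[OF that(2)])
  next
    case False
    have "\<exists>j<n. \<beta> j \<noteq> \<beta>' j"
    proof (rule ccontr)
      assume "\<not> ?thesis"
      then have "\<beta> = \<beta>'"
        by (intro PiE_ext[OF that(1)[unfolded P_def] that(2)[unfolded P_def]]) auto
      with False show False by simp
    qed
    then obtain j where j: "j < n" "\<beta> j \<noteq> \<beta>' j" by blast
    then have "L \<beta> \<beta>' = 0" unfolding L_def
      using j by (intro prod_zero bexI[of _ j]) (simp_all add: poly_lagrange_poly T(1) inT[OF that(1)] inT[OF that(2)])
    then show ?thesis using False by simp
  qed
  obtain \<gamma> where \<gamma>: "\<exists>a\<in>A. \<gamma> a \<noteq> 0"
    "\<forall>x\<in>B. (\<Sum>a\<in>A. \<gamma> a * (L (fst a) (\<lambda>j. F j x) * x i ^ snd a)) = 0"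
    using underdetermined[OF _ _ card, of "\<lambda>a x. L (fst a) (\<lambda>j. F j x) * x i ^ snd a"] P(1) T'(1)
    by (auto simp: A_def B_def finite_PiE)
  define c where "c k y = (\<Sum>\<beta>\<in>P. \<gamma> (\<beta>, k) * L \<beta> y)" for k y
  have pc: "pd n (n * K) (c k)" for k
    unfolding c_def by (intro pd_sum pd_cmult L)
  have sumeq: "(\<Sum>k<K. c k (\<lambda>j. F j x) * x i ^ k) = (\<Sum>a\<in>A. \<gamma> a * (L (fst a) (\<lambda>j. F j x) * x i ^ snd a))" for x
  proof -
    have "(\<Sum>k<K. c k (\<lambda>j. F j x) * x i ^ k) = (\<Sum>k<K. \<Sum>\<beta>\<in>P. \<gamma> (\<beta>, k) * (L \<beta> (\<lambda>j. F j x) * x i ^ k))"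
      by (simp add: c_def sum_distrib_right mult.assoc)
    also have "\<dots> = (\<Sum>\<beta>\<in>P. \<Sum>k<K. \<gamma> (\<beta>, k) * (L \<beta> (\<lambda>j. F j x) * x i ^ k))" by (rule sum.swap)
    also have "\<dots> = (\<Sum>(\<beta>, k)\<in>A. \<gamma> (\<beta>, k) * (L \<beta> (\<lambda>j. F j x) * x i ^ k))"
      unfolding A_def by (rule sum.cartesian_product)
    finally show ?thesis by (simp add: case_prod_unfold)
  qed
  have "(\<Sum>k<K. c k (\<lambda>j. F j x) * x i ^ k) = 0" for x
  proof (rule pd_zero_on_grid[of n D "\<lambda>x. \<Sum>k<K. c k (\<lambda>j. F j x) * x i ^ k" T' x])
    show "pd n D (\<lambda>x. \<Sum>k<K. c k (\<lambda>j. F j x) * x i ^ k)"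
    proof (rule pd_sum)
      fix k assume "k \<in> {..<K}"
      have 1: "pd n (n * K * d) (\<lambda>x. c k (\<lambda>j. F j x))" by (rule pd_subst[OF pc pdF])
      have 2: "pd n (k * 1) (\<lambda>x. x i ^ k)" using pd_var[OF assms, of 0] by (intro pd_power) simp
      show "pd n D (\<lambda>x. c k (\<lambda>j. F j x) * x i ^ k)"
        by (rule pd_mult'[OF 1 2]) (use \<open>k \<in> _\<close> in \<open>simp add: D_def\<close>)
    qed
    show "finite T'" "D < card T'" using T' by auto
    fix x :: "nat \<Rightarrow> complex" assume x: "\<And>i. i < n \<Longrightarrow> x i \<in> T'"
    define x' where "x' = restrict x {..<n}"
    have "x' \<in> B" using x by (auto simp: x'_def B_def)
    have "c k (\<lambda>j. F j x) = c k (\<lambda>j. F j x')" for k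
    proof (rule pd_cong[OF pc])
      fix j assume "j < n"
      then show "F j x = F j x'" by (intro pd_cong[OF pdF]) (auto simp: x'_def)
    qed
    then have "(\<Sum>k<K. c k (\<lambda>j. F j x) * x i ^ k) = (\<Sum>k<K. c k (\<lambda>j. F j x') * x' i ^ k)"
      using assms by (simp add: x'_def)
    also have "\<dots> = 0" using \<gamma>(2) \<open>x' \<in> B\<close> by (simp add: sumeq)
    finally show "(\<Sum>k<K. c k (\<lambda>j. F j x) * x i ^ k) = 0" .
  qed
  moreover have "\<exists>k<K. \<exists>y. c k y \<noteq> 0"
  proof -
    obtain \<beta> k where bk: "\<beta> \<in> P" "k < K" "\<gamma> (\<beta>, k) \<noteq> 0" using \<gamma>(1) by (auto simp: A_def)
    have "c k \<beta> = (\<Sum>\<beta>'\<in>P. if \<beta>' = \<beta> then \<gamma> (\<beta>', k) else 0)"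
      unfolding c_def by (intro sum.cong refl) (simp add: LL bk(1))
    also have "\<dots> = \<gamma> (\<beta>, k)" using bk(1) P(1) by simp
    finally have "c k \<beta> \<noteq> 0" using bk by simp
    with bk(2) show ?thesis by (intro exI[of _ k] conjI exI[of _ \<beta>])
  qed
  ultimately have "(\<forall>k<K. pd n (n * K) (c k)) \<and> (\<exists>k<K. \<exists>y. c k y \<noteq> 0) \<and>
    (\<forall>x. (\<Sum>k<K. c k (\<lambda>j. F j x) * x i ^ k) = 0)"
    using pc by simp
  then show ?thesis by (intro exI[of _ K] exI[of _ "n * K"] exI[of _ c])
qed

end

section \<open>Root bounds and the inverse along a curve\<close>

lemma leading_coefficient_bound:
  fixes r :: "nat \<Rightarrow> complex"
  assumes "(\<Sum>k\<le>K. r k * g ^ k) = 0"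
  shows "cmod (r K * g) \<le> 1 + (\<Sum>k<K. cmod (r k * r K ^ (K - 1 - k)))"
proof (cases K)
  case 0
  then show ?thesis using assms by simp
next
  case (Suc m)
  define h where "h = r K * g"
  define S where "S = (\<Sum>k<K. cmod (r k * r K ^ (K - 1 - k)))"
  have S: "S \<ge> 0" unfolding S_def by (intro sum_nonneg) auto
  \<comment> \<open>Multiplied by a power of \<open>r K\<close>, the relation becomes monic in
    \<open>h = r K * g\<close>, and a root of a monic polynomial has modulus at most 1 or at most
    the sum of the moduli of the lower coefficients. Nothing is divided by \<open>r K\<close>, so
    the bound stays finite at its zeros.\<close>
  have "r K ^ m * (\<Sum>k\<le>K. r k * g ^ k) = h ^ K + (\<Sum>k<K. r k * r K ^ (K - 1 - k) * h ^ k)"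
  proof -
    have "r K ^ m * (\<Sum>k\<le>K. r k * g ^ k) = r K ^ m * (r K * g ^ K) + (\<Sum>k<K. r K ^ m * (r k * g ^ k))"
      by (simp add: lessThan_Suc_atMost[symmetric] sum_distrib_left distrib_left add.commute)
    also have "r K ^ m * (r K * g ^ K) = h ^ K"
      by (simp add: h_def power_mult_distrib Suc mult_ac)
    also have "(\<Sum>k<K. r K ^ m * (r k * g ^ k)) = (\<Sum>k<K. r k * r K ^ (K - 1 - k) * h ^ k)"
    proof (intro sum.cong refl)
      fix k assume "k \<in> {..<K}"
      then have "r K ^ m = r K ^ (K - 1 - k) * r K ^ k" by (simp add: Suc flip: power_add)
      then show "r K ^ m * (r k * g ^ k) = r k * r K ^ (K - 1 - k) * h ^ k"
        by (simp add: h_def power_mult_distrib mult_ac)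
    qed
    finally show ?thesis .
  qed
  then have "h ^ K + (\<Sum>k<K. r k * r K ^ (K - 1 - k) * h ^ k) = 0" using assms by simp
  then have eq: "h ^ K = - (\<Sum>k<K. r k * r K ^ (K - 1 - k) * h ^ k)" by (simp add: eq_neg_iff_add_eq_0)
  show ?thesis
  proof (cases "cmod h \<le> 1")
    case True
    then show ?thesis using S by (simp add: S_def h_def)
  next
    case False
    have "cmod h * cmod h ^ m = cmod (h ^ K)" by (simp add: Suc norm_mult norm_power)
    also have "\<dots> \<le> (\<Sum>k<K. cmod (r k * r K ^ (K - 1 - k) * h ^ k))"
      unfolding eq norm_minus_cancel by (rule norm_sum)
    also have "\<dots> \<le> (\<Sum>k<K. cmod (r k * r K ^ (K - 1 - k)) * cmod h ^ m)"
    proof (rule sum_mono)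
      fix k assume "k \<in> {..<K}"
      then have "cmod h ^ k \<le> cmod h ^ m" using False Suc by (intro power_increasing) auto
      then show "cmod (r k * r K ^ (K - 1 - k) * h ^ k) \<le> cmod (r k * r K ^ (K - 1 - k)) * cmod h ^ m"
        unfolding norm_mult[of _ "h ^ k"] norm_power[of h k] by (rule mult_left_mono) simp
    qed
    also have "\<dots> = S * cmod h ^ m" by (simp only: S_def sum_distrib_right)
    finally have "cmod h * cmod h ^ m \<le> S * cmod h ^ m" .
    moreover have "0 < cmod h ^ m" using False by (intro zero_less_power) auto
    ultimately have "cmod h \<le> S" by (rule mult_right_le_imp_le)
    then show ?thesis by (simp add: S_def h_def)
  qed
qed

lemma poly_growth:
  fixes p :: "complex poly"
  assumes "degree p \<le> M"
  shows "\<exists>C\<ge>0. \<forall>t. 1 \<le> cmod t \<longrightarrow> cmod (poly p t) \<le> C * cmod t ^ M"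
proof (intro exI[of _ "\<Sum>i\<le>degree p. cmod (coeff p i)"] conjI allI impI)
  fix t assume t: "1 \<le> cmod t"
  have "cmod (poly p t) \<le> (\<Sum>i\<le>degree p. cmod (coeff p i * t ^ i))"
    unfolding poly_altdef by (rule norm_sum)
  also have "\<dots> \<le> (\<Sum>i\<le>degree p. cmod (coeff p i) * cmod t ^ M)"
    unfolding norm_mult norm_power
    by (intro sum_mono mult_left_mono power_increasing) (use assms t in auto)
  finally show "cmod (poly p t) \<le> (\<Sum>i\<le>degree p. cmod (coeff p i)) * cmod t ^ M"
    by (simp only: sum_distrib_right)
qed (auto intro: sum_nonneg)

text \<open>Riemann's theorem on removable singularities, applied to one point of \<open>Z\<close>
  at a time.\<close>

lemma holomorphic_extend_finite:
  assumes "finite Z" "f holomorphic_on (- Z)"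
    "\<And>z. z \<in> Z \<Longrightarrow> \<exists>B. \<forall>\<^sub>F t in at z. cmod (f t) \<le> B"
  shows "\<exists>g. g holomorphic_on UNIV \<and> (\<forall>t. t \<notin> Z \<longrightarrow> g t = f t)"
  using assms
proof (induction Z arbitrary: f rule: finite_induct)
  case empty then show ?case by auto
next
  case (insert z Z)
  have op: "open (- Z)" using finite_imp_closed[OF insert.hyps(1)] by (simp add: open_Compl)
  have "\<exists>g. g holomorphic_on (- Z) \<and> (\<forall>t\<in>- Z - {z}. g t = f t)"
  proof (subst holomorphic_on_extend_bounded)
    show "f holomorphic_on (- Z - {z})"
      using insert.prems(1) by (rule holomorphic_on_subset) auto
    show "z \<in> interior (- Z)" using op insert.hyps by (simp add: interior_open)
    show "\<exists>B. \<forall>\<^sub>F t in at z. cmod (f t) \<le> B" by (rule insert.prems(2)) simp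
  qed
  then obtain g where g: "g holomorphic_on (- Z)" "\<forall>t\<in>- Z - {z}. g t = f t" by auto
  have "\<exists>g'. g' holomorphic_on UNIV \<and> (\<forall>t. t \<notin> Z \<longrightarrow> g' t = g t)"
  proof (rule insert.IH[OF g(1)])
    fix z' assume z': "z' \<in> Z"
    obtain B where B: "\<forall>\<^sub>F t in at z'. cmod (f t) \<le> B" using insert.prems(2)[of z'] z' by auto
    have "\<forall>\<^sub>F t in at z'. t \<notin> insert z Z"
      using islimpt_finite[of "insert z Z" z'] insert.hyps by (simp add: islimpt_iff_eventually)
    with B have "\<forall>\<^sub>F t in at z'. cmod (g t) \<le> B"
      by eventually_elim (use g(2) in auto)
    then show "\<exists>B. \<forall>\<^sub>F t in at z'. cmod (g t) \<le> B" ..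
  qed
  then obtain g' where "g' holomorphic_on UNIV" "\<forall>t. t \<notin> Z \<longrightarrow> g' t = g t" by auto
  then show ?case using g(2) by (intro exI[of _ g']) auto
qed

context inj_keller_map
begin

text \<open>Away from the zeros of the leading coefficients, the parameters whose curve point lies
  in the image form an open set, and a relatively closed one, because there the relations bound the
  preimages. The plane without finitely many points is connected.\<close>

lemma curve_cofinite:
  fixes yp :: "nat \<Rightarrow> complex poly" and r :: "nat \<Rightarrow> nat \<Rightarrow> complex poly" and K :: "nat \<Rightarrow> nat"
  assumes lead: "\<And>i. i < n \<Longrightarrow> r i (K i) \<noteq> 0"
    and rel: "\<And>i t. i < n \<Longrightarrow> img (\<lambda>i. poly (yp i) t) \<Longrightarrow>
       (\<Sum>k\<le>K i. poly (r i k) t * G (\<lambda>i. poly (yp i) t) i ^ k) = 0"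
    and ne: "img (\<lambda>i. poly (yp i) t1)"
  shows "finite {t. \<not> img (\<lambda>i. poly (yp i) t)}"
proof -
  define V where "V = {t. img (\<lambda>i. poly (yp i) t)}"
  define Z where "Z = (\<Union>i<n. {t. poly (r i (K i)) t = 0})"
  have Z: "finite Z" unfolding Z_def by (intro finite_UN_I poly_roots_finite lead) auto
  have opV: "open V"
  proof (subst open_subopen, intro ballI)
    fix t assume "t \<in> V"
    then have "\<forall>\<^sub>F s in nhds t. img (\<lambda>i. poly (yp i) s)"
      by (intro img_eventually[of "\<lambda>i. poly (yp i) t"])
         (auto simp: V_def intro!: tendsto_intros filterlim_ident)
    then have "\<forall>\<^sub>F s in nhds t. s \<in> V" by (simp add: V_def)
    then show "\<exists>U. open U \<and> t \<in> U \<and> U \<subseteq> V"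
      by (simp only: eventually_nhds subset_eq)
  qed
  have "connected (- Z)"
    by (rule path_connected_imp_connected[OF path_connected_complement_countable])
       (use Z in \<open>auto intro: countable_finite\<close>)
  moreover have "openin (top_of_set (- Z)) (- Z \<inter> V)" by (rule openin_open_Int[OF opV])
  moreover have "closedin (top_of_set (- Z)) (- Z \<inter> V)"
  proof -
    have lim: "t0 \<in> V" if tk: "\<And>k. t k \<in> - Z \<inter> V" and lim: "t \<longlonglongrightarrow> t0" and t0: "t0 \<notin> Z" for t t0
    proof -
      have "img (\<lambda>i. poly (yp i) t0)"
      proof (rule img_closed[of "\<lambda>k i. poly (yp i) (t k)"])
        show "img (\<lambda>i. poly (yp i) (t k))" for k using tk[of k] by (simp add: V_def)
        show "(\<lambda>k. poly (yp i) (t k)) \<longlonglongrightarrow> poly (yp i) t0" for i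
          by (intro tendsto_intros lim)
        show "bounded (range (\<lambda>k. G (\<lambda>i. poly (yp i) (t k)) i))" if i: "i < n" for i
        proof -
          define b where "b t = (1 + (\<Sum>k<K i. cmod (poly (r i k) t * poly (r i (K i)) t ^ (K i - 1 - k))))
            / cmod (poly (r i (K i)) t)" for t
          have nz: "poly (r i (K i)) t0 \<noteq> 0" using t0 i by (auto simp: Z_def)
          have "(\<lambda>k. b (t k)) \<longlonglongrightarrow> b t0"
            unfolding b_def by (intro tendsto_intros lim) (use nz in auto)
          then have "bounded (range (\<lambda>k. b (t k)))" by (rule convergent_imp_bounded)
          then obtain B where B: "\<And>k. norm (b (t k)) \<le> B" unfolding bounded_iff by auto
          have "cmod (G (\<lambda>i. poly (yp i) (t k)) i) \<le> B" for k
          proof -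
            have nzk: "poly (r i (K i)) (t k) \<noteq> 0" using tk[of k] i by (auto simp: Z_def)
            have "cmod (poly (r i (K i)) (t k) * G (\<lambda>i. poly (yp i) (t k)) i)
              \<le> 1 + (\<Sum>l<K i. cmod (poly (r i l) (t k) * poly (r i (K i)) (t k) ^ (K i - 1 - l)))"
              by (rule leading_coefficient_bound[of "\<lambda>l. poly (r i l) (t k)"])
                 (rule rel[OF i], use tk[of k] in \<open>simp add: V_def\<close>)
            then have "cmod (G (\<lambda>i. poly (yp i) (t k)) i) * cmod (poly (r i (K i)) (t k))
              \<le> 1 + (\<Sum>l<K i. cmod (poly (r i l) (t k) * poly (r i (K i)) (t k) ^ (K i - 1 - l)))"
              by (simp only: norm_mult[of _ "G (\<lambda>i. poly (yp i) (t k)) i"] mult.commute)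
            then have "cmod (G (\<lambda>i. poly (yp i) (t k)) i) \<le> b (t k)"
              unfolding b_def by (rule mult_imp_le_div_pos[rotated]) (use nzk in simp)
            also have "\<dots> \<le> B" using B[of k] by simp
            finally show ?thesis .
          qed
          then show ?thesis unfolding bounded_iff by auto
        qed
      qed
      then show ?thesis by (simp add: V_def)
    qed
    show ?thesis
      unfolding closedin_limpt
    proof (intro conjI allI impI)
      fix x assume x: "x islimpt - Z \<inter> V \<and> x \<in> - Z"
      then obtain t where t: "\<forall>k. t k \<in> - Z \<inter> V - {x}" "t \<longlonglongrightarrow> x"
        unfolding islimpt_sequential by auto
      have "x \<in> V" by (rule lim[of t x]) (use x t in auto)
      then show "x \<in> - Z \<inter> V" using x by auto
    qed auto
  qed
  \<comment> \<open>A nonempty open set of parameters is infinite and cannot lie inside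
    \<open>Z\<close>.\<close>
  moreover have "- Z \<inter> V \<noteq> {}"
  proof
    assume "- Z \<inter> V = {}"
    then have "V \<subseteq> Z" by auto
    then have "finite V" using Z by (rule finite_subset)
    moreover have "t1 \<in> V" using ne by (simp add: V_def)
    ultimately show False using opV finite_imp_not_open[of V] by auto
  qed
  ultimately have "- Z \<inter> V = - Z" unfolding connected_clopen by auto
  then have "{t. \<not> img (\<lambda>i. poly (yp i) t)} \<subseteq> Z" by (auto simp: V_def)
  then show ?thesis using Z by (rule finite_subset)
qed

text \<open>The leading coefficient times the inverse is bounded near each exceptional parameter, so
  it extends to an entire function; it grows polynomially and is a polynomial by Liouville. Its
  degree bound depends only on the relation, hence can be shared by all slices of a surface.\<close>

lemma curve_rational:
  fixes yp :: "nat \<Rightarrow> complex poly" and r :: "nat \<Rightarrow> complex poly"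
  assumes i: "i < n" and deg: "\<And>k. k \<le> K \<Longrightarrow> degree (r k) \<le> M"
    and rel: "\<And>t. img (\<lambda>i. poly (yp i) t) \<Longrightarrow>
       (\<Sum>k\<le>K. poly (r k) t * G (\<lambda>i. poly (yp i) t) i ^ k) = 0"
    and fin: "finite {t. \<not> img (\<lambda>i. poly (yp i) t)}"
  shows "\<exists>h. degree h \<le> M * K \<and>
     (\<forall>t. img (\<lambda>i. poly (yp i) t) \<longrightarrow> poly (r K) t * G (\<lambda>i. poly (yp i) t) i = poly h t)"
proof -
  define Z where "Z = {t. \<not> img (\<lambda>i. poly (yp i) t)}"
  define f where "f t = poly (r K) t * G (\<lambda>i. poly (yp i) t) i" for t
  define b where "b t = 1 + (\<Sum>k<K. cmod (poly (r k * r K ^ (K - 1 - k)) t))" for t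
  have fb: "cmod (f t) \<le> b t" if "t \<notin> Z" for t
    unfolding f_def b_def poly_mult poly_power
    by (rule leading_coefficient_bound[of "\<lambda>l. poly (r l) t"], rule rel) (use that in \<open>simp add: Z_def\<close>)
  have finZ: "finite Z" using fin by (simp add: Z_def)
  have "f holomorphic_on (- Z)"
  proof -
    have fd: "(\<lambda>t. poly p t) field_differentiable at t" for p :: "complex poly" and t
      unfolding field_differentiable_def by (rule exI, rule poly_DERIV)
    have "(\<lambda>t. G (\<lambda>i. poly (yp i) t) i) field_differentiable at t" if "t \<in> - Z" for t
      by (rule G_differentiable[OF _ _ i])
         (use that fd in \<open>auto simp: Z_def\<close>)
    then have "(\<lambda>t. G (\<lambda>i. poly (yp i) t) i) holomorphic_on (- Z)"
      by (simp add: holomorphic_on_def field_differentiable_at_within)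
    then show ?thesis unfolding f_def by (intro holomorphic_intros)
  qed
  moreover have "\<exists>B. \<forall>\<^sub>F t in at z. cmod (f t) \<le> B" for z
  proof -
    have "(b \<longlongrightarrow> b z) (at z)" unfolding b_def by (intro tendsto_intros)
    then have "\<forall>\<^sub>F t in at z. b t < b z + 1" by (rule order_tendstoD) simp
    moreover have "\<forall>\<^sub>F t in at z. t \<notin> Z"
      using islimpt_finite[OF finZ] by (simp add: islimpt_iff_eventually)
    ultimately have "\<forall>\<^sub>F t in at z. cmod (f t) \<le> b z + 1"
    proof eventually_elim
      case (elim t)
      show ?case using fb[OF elim(2)] elim(1) by linarith
    qed
    then show ?thesis ..
  qed
  ultimately obtain g where g: "g holomorphic_on UNIV" "\<forall>t. t \<notin> Z \<longrightarrow> g t = f t"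
    using holomorphic_extend_finite[OF finZ, of f] by auto
  have "\<exists>C. \<forall>t. 1 \<le> cmod t \<longrightarrow> b t \<le> C * cmod t ^ (M * K)"
  proof -
    have "\<exists>C\<ge>0. \<forall>t. 1 \<le> cmod t \<longrightarrow> cmod (poly (r k * r K ^ (K - 1 - k)) t) \<le> C * cmod t ^ (M * K)" if "k < K" for k
    proof (rule poly_growth)
      have "degree (r k * r K ^ (K - 1 - k)) \<le> degree (r k) + degree (r K ^ (K - 1 - k))" by (rule degree_mult_le)
      also have "\<dots> \<le> degree (r k) + degree (r K) * (K - 1 - k)" by (simp add: degree_power_le)
      also have "\<dots> \<le> M + M * (K - 1 - k)" using that by (intro add_mono mult_right_mono deg) auto
      also have "\<dots> = M * Suc (K - 1 - k)" by simp
      also have "\<dots> \<le> M * K" using that by (intro mult_left_mono) auto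
      finally show "degree (r k * r K ^ (K - 1 - k)) \<le> M * K" .
    qed
    then obtain C where C: "\<And>k t. k < K \<Longrightarrow> 1 \<le> cmod t \<Longrightarrow> cmod (poly (r k * r K ^ (K - 1 - k)) t) \<le> C k * cmod t ^ (M * K)"
      by metis
    show ?thesis
    proof (intro exI[of _ "1 + (\<Sum>k<K. C k)"] allI impI)
      fix t assume t: "1 \<le> cmod t"
      have "b t \<le> 1 * cmod t ^ (M * K) + (\<Sum>k<K. C k * cmod t ^ (M * K))"
        unfolding b_def using t by (intro add_mono sum_mono C) auto
      then show "b t \<le> (1 + (\<Sum>k<K. C k)) * cmod t ^ (M * K)"
        by (simp only: distrib_right sum_distrib_right)
    qed
  qed
  then obtain C where C: "\<forall>t. 1 \<le> cmod t \<longrightarrow> b t \<le> C * cmod t ^ (M * K)" by auto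
  have "\<exists>A. \<forall>z\<in>Z. cmod z \<le> A" using finite_imp_bounded[OF finZ] by (auto simp: bounded_iff)
  then obtain A where A: "\<And>z. z \<in> Z \<Longrightarrow> cmod z \<le> A" by auto
  have gb: "norm (g z) \<le> C * norm z ^ (M * K)" if "max 1 (A + 1) \<le> norm z" for z
  proof -
    have "z \<notin> Z" using A[of z] that by auto
    then show ?thesis using g(2) fb[of z] C[rule_format, of z] that by auto
  qed
  define h where "h = (\<Sum>k\<le>M * K. monom ((deriv ^^ k) g 0 / fact k) k)"
  have L: "g z = (\<Sum>k\<le>M * K. (deriv ^^ k) g 0 / fact k * z ^ k)" for z
    by (rule Liouville_polynomial[OF g(1) gb])
  have "g z = poly h z" for z
    by (simp add: h_def poly_sum poly_monom L)
  moreover have "degree h \<le> M * K" unfolding h_def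
    by (intro degree_sum_le) (auto intro: order_trans[OF degree_monom_le])
  ultimately show ?thesis using g(2) by (intro exI[of _ h]) (auto simp: Z_def f_def)
qed

end

section \<open>Bivariate polynomials\<close>

text \<open>The outer variable is t and the coefficients are polynomials in s. Thus
  \<open>degree\<close> is the degree in t, while \<open>fix_s\<close> and evaluation at the
  constant \<open>[:t:]\<close> give the two kinds of slices.\<close>

definition ev2 :: "complex poly poly \<Rightarrow> complex \<Rightarrow> complex \<Rightarrow> complex" where
  "ev2 p s t = poly (poly p [:t:]) s"

lemma ev2_simps [simp]:
  "ev2 0 s t = 0" "ev2 1 s t = 1" "ev2 (p + q) s t = ev2 p s t + ev2 q s t"
  "ev2 (p - q) s t = ev2 p s t - ev2 q s t" "ev2 (- p) s t = - ev2 p s t"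
  "ev2 (p * q) s t = ev2 p s t * ev2 q s t" "ev2 (p ^ m) s t = ev2 p s t ^ m"
  "ev2 [:c:] s t = poly c s" "ev2 (pCons c p) s t = poly c s + t * ev2 p s t"
  "ev2 (smult c p) s t = poly c s * ev2 p s t"
  by (simp_all add: ev2_def)

lemma ev2_sum: "ev2 (sum f A) s t = (\<Sum>a\<in>A. ev2 (f a) s t)"
  by (simp add: ev2_def poly_sum)

lemma ev2_altdef: "ev2 p s t = (\<Sum>k\<le>degree p. poly (coeff p k) s * t ^ k)"
  unfolding ev2_def poly_altdef[of p] by (simp add: poly_sum)

definition fix_s :: "complex poly poly \<Rightarrow> complex \<Rightarrow> complex poly" where
  "fix_s p s = map_poly (\<lambda>q. poly q s) p"

lemma poly_fix_s: "poly (fix_s p s) t = ev2 p s t"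
  unfolding fix_s_def by (induction p) (simp_all add: map_poly_pCons)

lemma degree_fix_s: "degree (fix_s p s) \<le> degree p"
  by (rule degree_le) (simp add: fix_s_def coeff_map_poly coeff_eq_0)

lemma coeff_fix_s: "coeff (fix_s p s) k = poly (coeff p k) s"
  unfolding fix_s_def by (simp add: coeff_map_poly)

lemma finite_fix_s_eq_0:
  assumes "p \<noteq> 0"
  shows "finite {s. fix_s p s = 0}"
proof (rule finite_subset)
  show "{s. fix_s p s = 0} \<subseteq> {s. poly (lead_coeff p) s = 0}"
    by (auto simp flip: coeff_fix_s)
  show "finite {s. poly (lead_coeff p) s = 0}"
    using assms by (intro poly_roots_finite) simp
qed

lemma finite_fix_t_eq_0:
  fixes p :: "complex poly poly"
  assumes "p \<noteq> 0"
  shows "finite {t. poly p [:t:] = 0}"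
proof -
  have "finite ((\<lambda>t. [:t:]) -` {q. poly p q = 0})"
    by (intro finite_vimageI poly_roots_finite assms injI) simp
  then show ?thesis by (simp add: vimage_def)
qed

lemma ev2_tendsto:
  assumes "(\<sigma> \<longlongrightarrow> s) A" "(\<tau> \<longlongrightarrow> t) A"
  shows "((\<lambda>a. ev2 p (\<sigma> a) (\<tau> a)) \<longlongrightarrow> ev2 p s t) A"
  unfolding ev2_altdef by (intro tendsto_intros assms)

text \<open>This is the Bezout identity over the field of rational functions in s, with denominators
  cleared. By pseudodivision, an element \<open>e\<close> of least degree in the ideal divides \<pi>
  and \<open>p\<close> up to factors free of t. If \<open>e\<close> had positive degree, primality
  would make \<pi> divide \<open>e\<close> and then \<open>p\<close> or a nonzero polynomial free of
  t.\<close>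

lemma prime_bezout:
  fixes \<pi> p :: "complex poly poly"
  assumes "prime_elem \<pi>" "degree \<pi> > 0" "\<not> \<pi> dvd p"
  shows "\<exists>\<alpha> \<beta> r. \<alpha> * \<pi> + \<beta> * p = [:r:] \<and> r \<noteq> 0"
proof -
  define I where "I = {e. e \<noteq> 0 \<and> (\<exists>\<alpha> \<beta>. e = \<alpha> * \<pi> + \<beta> * p)}"
  have pi0: "\<pi> \<noteq> 0" using assms(2) by auto
  have "\<pi> = 1 * \<pi> + 0 * p" "p = 0 * \<pi> + 1 * p" by simp_all
  then have "\<pi> \<in> I" using pi0 unfolding I_def by blast
  then obtain e where e: "e \<in> I" "\<And>e'. e' \<in> I \<Longrightarrow> degree e \<le> degree e'"
    using ex_has_least_nat[of "\<lambda>e. e \<in> I" \<pi> degree] by auto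
  then obtain \<alpha> \<beta> where e0: "e \<noteq> 0" and ee: "e = \<alpha> * \<pi> + \<beta> * p" by (auto simp: I_def)
  have dv: "\<exists>a q. a \<noteq> 0 \<and> [:a:] * f = e * q" if f: "f = \<alpha>' * \<pi> + \<beta>' * p" for f \<alpha>' \<beta>'
  proof -
    obtain a q where a: "a \<noteq> 0" "smult a f = e * q + pseudo_mod f e"
      using pseudo_mod(1)[OF e0, of f] by blast
    have "pseudo_mod f e = smult a f - e * q" using a(2) by simp
    also have "\<dots> = ([:a:] * \<alpha>' - \<alpha> * q) * \<pi> + ([:a:] * \<beta>' - \<beta> * q) * p"
      by (simp add: f ee algebra_simps smult_add_right)
    finally have "pseudo_mod f e = 0 \<or> pseudo_mod f e \<in> I" unfolding I_def by blast
    then have "pseudo_mod f e = 0"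
      using pseudo_mod(2)[OF e0, of f] e(2) by fastforce
    then show ?thesis using a by (intro exI[of _ a] exI[of _ q]) simp
  qed
  show ?thesis
  proof (cases "degree e = 0")
    case True
    then obtain r where "e = [:r:]" by (rule degree_eq_zeroE)
    then show ?thesis using e0 ee by (intro exI[of _ \<alpha>] exI[of _ \<beta>] exI[of _ r]) auto
  next
    case False
    obtain a q where a: "a \<noteq> 0" "[:a:] * \<pi> = e * q" using dv[of \<pi> 1 0] by auto
    obtain a' q' where a': "a' \<noteq> 0" "[:a':] * p = e * q'" using dv[of p 0 1] by auto
    have "\<pi> dvd e * q" unfolding a(2)[symmetric] by (rule dvd_triv_right)
    then have "\<pi> dvd e \<or> \<pi> dvd q" by (rule prime_elem_dvd_multD[OF assms(1)])
    moreover have "\<not> \<pi> dvd q"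
    proof
      assume "\<pi> dvd q"
      then obtain q1 where "q = \<pi> * q1" by (elim dvdE)
      then have "\<pi> * [:a:] = \<pi> * (e * q1)" using a(2) by (simp only: mult_ac)
      then have eq: "[:a:] = e * q1" by (rule iffD1[OF mult_left_cancel[OF pi0]])
      then have "q1 \<noteq> 0" using a(1) by auto
      then have "degree (e * q1) = degree e + degree q1" using e0 by (simp add: degree_mult_eq)
      with False show False by (simp flip: eq)
    qed
    ultimately have "\<pi> dvd [:a':] * p" unfolding a'(2) by auto
    from prime_elem_dvd_multD[OF assms(1) this] have "\<pi> dvd [:a':]" using assms(3) by blast
    then have "degree \<pi> \<le> degree [:a':]" using a'(1) by (intro dvd_imp_degree_le) auto
    then show ?thesis using assms(2) by simp
  qed
qed

lemma prime_factor_vanishing: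
  fixes a :: "complex poly poly"
  assumes "a \<noteq> 0" "ev2 a s t = 0"
  shows "\<exists>\<pi>. prime \<pi> \<and> \<pi> dvd a \<and> ev2 \<pi> s t = 0"
  using assms
proof (induction a rule: prime_divisors_induct)
  case (unit x)
  then obtain y where "1 = x * y" by (elim dvdE)
  from arg_cong[OF this, of "\<lambda>p. ev2 p s t"] show ?case using unit by simp
next
  case (factor p x)
  show ?case
  proof (cases "ev2 p s t = 0")
    case True
    then show ?thesis using factor by (intro exI[of _ p]) auto
  next
    case False
    then have "x \<noteq> 0" "ev2 x s t = 0" using factor by auto
    then show ?thesis using factor.IH by (meson dvd_mult)
  qed
qed simp

lemma fix_s_eq_0_iff: "fix_s p s = 0 \<longleftrightarrow> [:[:- s, 1:]:] dvd p"
  by (auto simp: poly_eq_iff coeff_fix_s const_poly_dvd_iff poly_eq_0_iff_dvd)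

text \<open>Vanishing on the whole vertical line at s means divisibility by the linear polynomial of
  that line, which a prime can have only by being associated to it. A prime free of t vanishes on
  the line as soon as it has a zero there.\<close>

lemma prime_vertical:
  assumes "prime \<pi>" "fix_s \<pi> s = 0 \<or> (degree \<pi> = 0 \<and> ev2 \<pi> s t = 0)"
  shows "\<pi> dvd [:[:- s, 1:]:] \<and> degree \<pi> = 0"
proof -
  have "fix_s \<pi> s = 0"
    using assms(2) by (auto simp: elim!: degree_eq_zeroE simp: fix_s_def map_poly_pCons)
  then have d: "[:[:- s, 1:]:] dvd \<pi>" by (simp add: fix_s_eq_0_iff)
  have irr: "irreducible \<pi>" using assms(1) by (simp add: prime_elem_imp_irreducible)
  have "\<not> [:[:- s, 1:]:] dvd (1 :: complex poly poly)"
  proof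
    assume "[:[:- s, 1:]:] dvd (1 :: complex poly poly)"
    then obtain y where "1 = [:[:- s, 1:]:] * y" by (elim dvdE)
    from arg_cong[OF this, of "\<lambda>p. ev2 p s 0"] show False
      by (simp only: ev2_simps poly_pCons poly_0) simp
  qed
  then have "\<pi> dvd [:[:- s, 1:]:]" using irreducibleD'[OF irr d] by auto
  moreover from this have "degree \<pi> \<le> degree [:[:- s, 1:]:]" by (intro dvd_imp_degree_le) auto
  ultimately show ?thesis by simp
qed

lemma linear_factor:
  fixes q :: "complex poly"
  assumes "degree q > 0"
  shows "\<exists>z p. q = [:- z, 1:] * p"
proof -
  have "\<exists>z. poly q z = 0"
    by (rule Fundamental_Theorem_Algebra.fundamental_theorem_of_algebra)
      (use assms in \<open>simp add: Fundamental_Theorem_Algebra.constant_degree\<close>)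
  then obtain z where "poly q z = 0" by blast
  then have "[:- z, 1:] dvd q" by (simp add: poly_eq_0_iff_dvd)
  then show ?thesis by (auto simp: dvd_def)
qed

text \<open>For each root z, |t - z| <= |t - c| + |c - z| <= 2 |c - z|. The constant depends only on
  the degree, so the inequality survives limits in a parameter and replaces continuity of the
  roots.\<close>

lemma poly_bound_no_roots:
  fixes q :: "complex poly"
  assumes "\<And>z. poly q z = 0 \<Longrightarrow> \<rho> \<le> cmod (z - c)" "cmod (t - c) \<le> \<rho>"
  shows "cmod (poly q t) \<le> 2 ^ degree q * cmod (poly q c)"
  using assms(1)
proof (induction "degree q" arbitrary: q)
  case 0
  then obtain a where "q = [:a:]" using degree_eq_zeroE[of q] by auto
  then show ?case by simp
next
  case (Suc m)
  then have "degree q > 0" by simp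
  then obtain z p where p: "q = [:- z, 1:] * p" using linear_factor[of q] by blast
  then have z: "poly q z = 0" by simp
  have "p \<noteq> 0" using Suc.hyps(2) p by auto
  then have dp: "degree q = Suc (degree p)" by (simp add: p degree_mult_eq del: mult_pCons_left)
  have IH: "cmod (poly p t) \<le> 2 ^ degree p * cmod (poly p c)"
    by (rule Suc.hyps(1)) (use Suc.hyps(2) dp Suc.prems in \<open>auto simp: p\<close>)
  have "t - z = (t - c) + (c - z)" by simp
  then have "cmod (t - z) \<le> cmod (t - c) + cmod (c - z)" by (simp only: norm_triangle_ineq)
  also have "\<dots> \<le> 2 * cmod (c - z)" using assms(2) Suc.prems[OF z] by (simp add: norm_minus_commute)
  finally have tz: "cmod (t - z) \<le> 2 * cmod (c - z)" .
  have "cmod (poly q t) = cmod (t - z) * cmod (poly p t)" by (simp add: p norm_mult flip: left_diff_distrib)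
  also have "\<dots> \<le> (2 * cmod (c - z)) * (2 ^ degree p * cmod (poly p c))"
    by (intro mult_mono tz IH) auto
  also have "\<dots> = 2 ^ degree q * cmod (poly q c)"
    unfolding dp by (simp add: p norm_mult flip: left_diff_distrib)
  finally show ?case .
qed

text \<open>Each root is nearer to 0 than to 1, so each linear factor is smaller at 0.\<close>

lemma poly_roots_near_0:
  fixes q :: "complex poly"
  assumes "q \<noteq> 0" "\<And>z. poly q z = 0 \<Longrightarrow> cmod z < 1/2"
  shows "cmod (poly q 0) \<le> cmod (poly q 1) \<and> (degree q > 0 \<longrightarrow> cmod (poly q 0) < cmod (poly q 1))"
  using assms
proof (induction "degree q" arbitrary: q)
  case 0
  then obtain a where "q = [:a:]" using degree_eq_zeroE[of q] by auto
  then show ?case by simp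
next
  case (Suc m)
  then have "degree q > 0" by simp
  then obtain z p where p: "q = [:- z, 1:] * p" using linear_factor[of q] by blast
  then have z: "poly q z = 0" by simp
  have "p \<noteq> 0" using Suc.hyps(2) p by auto
  then have dp: "degree q = Suc (degree p)" by (simp add: p degree_mult_eq del: mult_pCons_left)
  have IH: "cmod (poly p 0) \<le> cmod (poly p 1)"
    using Suc.hyps(1)[of p] \<open>p \<noteq> 0\<close> Suc.hyps(2) dp Suc.prems(2) by (auto simp: p)
  have "poly p 1 \<noteq> 0" using Suc.prems(2)[of 1] by (auto simp: p)
  have "cmod z < 1/2" by (rule Suc.prems(2)[OF z])
  moreover have "1 \<le> cmod (1 - z) + cmod z" using norm_triangle_ineq[of "1 - z" z] by simp
  ultimately have lt: "cmod z < cmod (1 - z)" by simp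
  have "cmod (poly q 0) = cmod z * cmod (poly p 0)" by (simp add: p norm_mult)
  also have "\<dots> \<le> cmod z * cmod (poly p 1)" by (intro mult_left_mono IH) auto
  also have "\<dots> < cmod (1 - z) * cmod (poly p 1)" using lt \<open>poly p 1 \<noteq> 0\<close> by simp
  also have "\<dots> = cmod (poly q 1)" by (simp add: p norm_mult[symmetric] left_diff_distrib)
  finally have "cmod (poly q 0) < cmod (poly q 1)" .
  then show ?case by (intro conjI impI less_imp_le)
qed

lemma no_roots_constant:
  fixes q :: "complex poly"
  assumes "\<And>z. poly q z \<noteq> 0"
  shows "poly q x = poly q y"
proof -
  have "degree q = 0"
  proof (rule ccontr)
    assume "degree q \<noteq> 0"
    then obtain z p where "q = [:- z, 1:] * p" using linear_factor[of q] by blast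
    then have "poly q z = 0" by simp
    then show False using assms by simp
  qed
  then obtain c where "q = [:c:]" by (rule degree_eq_zeroE)
  then show ?thesis by simp
qed

section \<open>The image of an injective Keller map along a surface\<close>

text \<open>The displacement \<epsilon> is a third, outermost variable, so \<open>coeff C m\<close>
  is the bivariate coefficient of the m-th power of \<epsilon>.\<close>

definition ev3 :: "complex poly poly poly \<Rightarrow> complex \<Rightarrow> complex \<Rightarrow> complex \<Rightarrow> complex" where
  "ev3 C s t \<epsilon> = ev2 (poly C [:[:\<epsilon>:]:]) s t"

lemma pd_subst3:
  assumes "pd n d f" "\<And>i. i < n \<Longrightarrow> degree (Yp i) \<le> e"
  shows "\<exists>C. (\<forall>s t \<epsilon>. ev3 C s t \<epsilon> = f (\<lambda>i. ev2 (Yp i) s t + \<epsilon> * w i)) \<and> (\<forall>m. degree (coeff C m) \<le> d * e)"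
  using assms
proof (induction rule: pd.induct)
  case (pd_const d c)
  show ?case by (rule exI[of _ "[:[:[:c:]:]:]"]) (auto simp: ev3_def coeff_pCons split: nat.split)
next
  case (pd_var i d)
  then show ?case
    by (intro exI[of _ "[:Yp i, [:[:w i:]:]:]"])
       (auto simp: ev3_def coeff_pCons trans_le_add1 split: nat.split)
next
  case (pd_add d f g)
  then obtain C C' where
    "(\<forall>s t \<epsilon>. ev3 C s t \<epsilon> = f (\<lambda>i. ev2 (Yp i) s t + \<epsilon> * w i)) \<and> (\<forall>m. degree (coeff C m) \<le> d * e)"
    "(\<forall>s t \<epsilon>. ev3 C' s t \<epsilon> = g (\<lambda>i. ev2 (Yp i) s t + \<epsilon> * w i)) \<and> (\<forall>m. degree (coeff C' m) \<le> d * e)"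
    by auto
  then show ?case by (intro exI[of _ "C + C'"]) (auto simp: ev3_def intro!: degree_add_le)
next
  case (pd_mult a f b g)
  then obtain C C' where C:
    "(\<forall>s t \<epsilon>. ev3 C s t \<epsilon> = f (\<lambda>i. ev2 (Yp i) s t + \<epsilon> * w i)) \<and> (\<forall>m. degree (coeff C m) \<le> a * e)"
    "(\<forall>s t \<epsilon>. ev3 C' s t \<epsilon> = g (\<lambda>i. ev2 (Yp i) s t + \<epsilon> * w i)) \<and> (\<forall>m. degree (coeff C' m) \<le> b * e)"
    by auto
  have "degree (coeff (C * C') m) \<le> (a + b) * e" for m
    unfolding coeff_mult
  proof (rule degree_sum_le)
    fix i assume "i \<in> {..m}"
    have "degree (coeff C i * coeff C' (m - i)) \<le> degree (coeff C i) + degree (coeff C' (m - i))"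
      by (rule degree_mult_le)
    also have "\<dots> \<le> a * e + b * e" using C by (intro add_mono) auto
    finally show "degree (coeff C i * coeff C' (m - i)) \<le> (a + b) * e" by (simp add: distrib_right)
  qed simp
  then show ?case using C by (intro exI[of _ "C * C'"]) (auto simp: ev3_def)
next
  case (pd_mono a f b)
  then obtain C where C:
    "\<forall>s t \<epsilon>. ev3 C s t \<epsilon> = f (\<lambda>i. ev2 (Yp i) s t + \<epsilon> * w i)" "\<forall>m. degree (coeff C m) \<le> a * e" by auto
  have "a * e \<le> b * e" using pd_mono.hyps by simp
  then show ?case using C order_trans by (intro exI[of _ C] conjI) blast+
qed

lemma ev3_tendsto_0: "((\<lambda>\<epsilon>. ev3 C s t \<epsilon>) \<longlongrightarrow> ev2 (coeff C 0) s t) (at 0)"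
proof -
  have eq: "ev3 C s t \<epsilon> = (\<Sum>m\<le>degree C. ev2 (coeff C m) s t * \<epsilon> ^ m)" for \<epsilon>
    unfolding ev3_def poly_altdef by (simp add: ev2_sum)
  have "((\<lambda>\<epsilon>. ev3 C s t \<epsilon>) \<longlongrightarrow> ev3 C s t 0) (at 0)"
    unfolding eq by (intro tendsto_intros)
  then show ?thesis by (simp add: ev3_def poly_0_coeff_0)
qed

lemma ev3_shift:
  assumes "\<And>m. m < e0 \<Longrightarrow> coeff C m = 0"
  shows "ev3 C s t \<epsilon> = \<epsilon> ^ e0 * ev3 (poly_shift e0 C) s t \<epsilon>"
proof -
  have "C = monom 1 e0 * poly_shift e0 C"
    by (rule poly_eqI) (use assms in \<open>auto simp: coeff_monom_mult coeff_poly_shift\<close>)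
  then have "ev3 C s t \<epsilon> = ev3 (monom 1 e0 * poly_shift e0 C) s t \<epsilon>" by simp
  also have "\<dots> = \<epsilon> ^ e0 * ev3 (poly_shift e0 C) s t \<epsilon>"
    by (simp add: ev3_def poly_monom)
  finally show ?thesis .
qed

context inj_keller_map
begin

abbreviation U :: "(nat \<Rightarrow> complex poly poly) \<Rightarrow> complex \<Rightarrow> complex \<Rightarrow> bool" where
  "U Yp s t \<equiv> img (\<lambda>i. ev2 (Yp i) s t)"

abbreviation g :: "(nat \<Rightarrow> complex poly poly) \<Rightarrow> nat \<Rightarrow> complex \<Rightarrow> complex \<Rightarrow> complex" where
  "g Yp i s t \<equiv> G (\<lambda>i. ev2 (Yp i) s t) i"

text \<open>The relation of \<open>coordinate_algebraic\<close> may vanish identically on the given surface; it is therefore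
  taken on the parallel surface displaced by \<open>\<epsilon> w\<close> and divided by the lowest power of \<open>\<epsilon>\<close>.\<close>

lemma surface_algebraic:
  assumes i: "i < n"
  shows "\<exists>D. \<forall>Yp e. (\<forall>j<n. degree (Yp j) \<le> e) \<longrightarrow>
    (\<exists>K r. r K \<noteq> 0 \<and> (\<forall>k\<le>K. degree (r k) \<le> D * e) \<and>
      (\<forall>s t. U Yp s t \<longrightarrow> (\<Sum>k\<le>K. ev2 (r k) s t * g Yp i s t ^ k) = 0))"
proof -
  from coordinate_algebraic[OF i] obtain K0 D c where
    cc: "(\<forall>k<K0. pd n D (c k)) \<and> (\<exists>k<K0. \<exists>y. c k y \<noteq> 0) \<and>
      (\<forall>x. (\<Sum>k<K0. c k (\<lambda>j. F j x) * x i ^ k) = 0)"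
    by (elim exE) (rule that)
  note c = cc[THEN conjunct1] cc[THEN conjunct2, THEN conjunct1] cc[THEN conjunct2, THEN conjunct2]
  obtain k0 ys where k0: "k0 < K0" "c k0 ys \<noteq> 0" using c(2) by auto
  show ?thesis
  \<comment> \<open>\<open>D\<close> is fixed before the surface; the common degree bound for the
    inverse on all coordinate lines rests on this order.\<close>
  proof (rule exI[of _ D], intro allI impI)
    fix Yp :: "nat \<Rightarrow> complex poly poly" and e
    assume Yp: "\<forall>j<n. degree (Yp j) \<le> e"
    \<comment> \<open>For \<epsilon> = 1 this displacement moves the surface point at (0, 0) to
      \<open>ys\<close>, where \<open>c k0\<close> does not vanish; so \<open>C k0\<close> is not
      the zero polynomial.\<close>
    define w where "w j = ys j - ev2 (Yp j) 0 0" for j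
    define P where "P k C \<longleftrightarrow> (\<forall>s t \<epsilon>. ev3 C s t \<epsilon> = c k (\<lambda>i. ev2 (Yp i) s t + \<epsilon> * w i)) \<and>
      (\<forall>m. degree (coeff C m) \<le> D * e)" for k C
    have "\<forall>k\<in>{..<K0}. \<exists>C. P k C"
      unfolding P_def using pd_subst3[of n D _ Yp e w] c(1) Yp by simp
    then obtain C where "\<forall>k\<in>{..<K0}. P k (C k)" by (rule bchoice[THEN exE])
    then have C: "ev3 (C k) s t \<epsilon> = c k (\<lambda>i. ev2 (Yp i) s t + \<epsilon> * w i)" "degree (coeff (C k) m) \<le> D * e"
      if "k < K0" for k s t \<epsilon> m
      using that by (auto simp: P_def)
    have "ev3 (C k0) 0 0 1 = c k0 ys" using C(1)[OF k0(1)] by (simp add: w_def)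
    then have "C k0 \<noteq> 0" using k0(2) by (auto simp: ev3_def)
    then have "lead_coeff (C k0) \<noteq> 0" by simp
    with k0(1) have ex: "\<exists>m. \<exists>k<K0. coeff (C k) m \<noteq> 0"
      by (intro exI[of _ "degree (C k0)"] exI[of _ k0] conjI)
    define e0 where "e0 = (LEAST m. \<exists>k<K0. coeff (C k) m \<noteq> 0)"
    have e0: "\<exists>k<K0. coeff (C k) e0 \<noteq> 0" unfolding e0_def by (rule LeastI_ex[OF ex])
    have less: "coeff (C k) m = 0" if "m < e0" "k < K0" for m k
      using not_less_Least[OF that(1)[unfolded e0_def]] that(2) by blast
    define r where "r k = coeff (C k) e0" for k
    \<comment> \<open>Powers above the last nonzero coefficient are dropped, so that the relation
      has a nonzero leading coefficient.\<close>
    define K where "K = Max {k. k < K0 \<and> r k \<noteq> 0}"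
    have fin: "finite {k. k < K0 \<and> r k \<noteq> 0}" by simp
    have ne: "{k. k < K0 \<and> r k \<noteq> 0} \<noteq> {}" using e0 by (auto simp: r_def)
    have K: "K < K0" "r K \<noteq> 0" using Max_in[OF fin ne] by (auto simp: K_def)
    have above: "r k = 0" if kK: "k < K0" "K < k" for k
    proof (rule ccontr)
      assume "r k \<noteq> 0"
      with kK(1) have "k \<in> {k. k < K0 \<and> r k \<noteq> 0}" by simp
      from Max_ge[OF fin this] have "k \<le> K" unfolding K_def .
      with kK(2) show False by simp
    qed
    have rel: "(\<Sum>k\<le>K. ev2 (r k) s t * g Yp i s t ^ k) = 0" if u: "U Yp s t" for s t
    proof -
      define y where "y \<epsilon> = (\<lambda>j. ev2 (Yp j) s t + \<epsilon> * w j)" for \<epsilon>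
      have yl: "((\<lambda>\<epsilon>. y \<epsilon> j) \<longlongrightarrow> ev2 (Yp j) s t) (at 0)" for j
        unfolding y_def by (rule tendsto_eq_intros refl | simp)+
      have Gl: "((\<lambda>\<epsilon>. G (y \<epsilon>) i) \<longlongrightarrow> g Yp i s t) (at 0)"
        by (rule G_tendsto[OF u _ i, where y = y]) (rule yl)
      have "\<forall>\<^sub>F \<epsilon> in at 0. img (y \<epsilon>)" by (rule img_eventually[OF u, where y = y]) (rule yl)
      moreover have "\<forall>\<^sub>F \<epsilon> in at (0::complex). \<epsilon> \<noteq> 0" by (rule eventually_neq_at_within)
      \<comment> \<open>For small nonzero \<epsilon> the displaced point still lies in the image,
        and the common factor \<open>\<epsilon> ^ e0\<close> cancels.\<close>
      ultimately have "\<forall>\<^sub>F \<epsilon> in at 0. (\<Sum>k<K0. ev3 (poly_shift e0 (C k)) s t \<epsilon> * G (y \<epsilon>) i ^ k) = 0"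
      proof eventually_elim
        case (elim \<epsilon>)
        have "c k (\<lambda>j. F j (G (y \<epsilon>))) = \<epsilon> ^ e0 * ev3 (poly_shift e0 (C k)) s t \<epsilon>" if "k < K0" for k
        proof -
          have "c k (\<lambda>j. F j (G (y \<epsilon>))) = c k (y \<epsilon>)"
            by (rule pd_cong[OF c(1)[rule_format, OF that]]) (simp add: F_G elim)
          also have "\<dots> = ev3 (C k) s t \<epsilon>" by (simp add: y_def C(1)[OF that])
          also have "\<dots> = \<epsilon> ^ e0 * ev3 (poly_shift e0 (C k)) s t \<epsilon>"
            by (rule ev3_shift) (rule less[OF _ that])
          finally show ?thesis .
        qed
        then have "(\<Sum>k<K0. c k (\<lambda>j. F j (G (y \<epsilon>))) * G (y \<epsilon>) i ^ k)
          = \<epsilon> ^ e0 * (\<Sum>k<K0. ev3 (poly_shift e0 (C k)) s t \<epsilon> * G (y \<epsilon>) i ^ k)"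
          by (simp add: sum_distrib_left mult.assoc)
        then show ?case using c(3) elim(2) by simp
      qed
      then have "((\<lambda>\<epsilon>. \<Sum>k<K0. ev3 (poly_shift e0 (C k)) s t \<epsilon> * G (y \<epsilon>) i ^ k) \<longlongrightarrow> 0) (at 0)"
        by (rule tendsto_eventually)
      moreover have "((\<lambda>\<epsilon>. \<Sum>k<K0. ev3 (poly_shift e0 (C k)) s t \<epsilon> * G (y \<epsilon>) i ^ k) \<longlongrightarrow>
          (\<Sum>k<K0. ev2 (coeff (poly_shift e0 (C k)) 0) s t * g Yp i s t ^ k)) (at 0)"
        by (intro tendsto_sum tendsto_mult tendsto_power ev3_tendsto_0 Gl)
      ultimately have "0 = (\<Sum>k<K0. ev2 (coeff (poly_shift e0 (C k)) 0) s t * g Yp i s t ^ k)"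
        by (rule tendsto_unique[OF at_neq_bot])
      then have "(\<Sum>k<K0. ev2 (r k) s t * g Yp i s t ^ k) = 0"
        by (simp add: coeff_poly_shift r_def)
      moreover have "(\<Sum>k\<le>K. ev2 (r k) s t * g Yp i s t ^ k) = (\<Sum>k<K0. ev2 (r k) s t * g Yp i s t ^ k)"
        by (rule sum.mono_neutral_left) (use K(1) above in \<open>auto simp: not_le\<close>)
      ultimately show ?thesis by simp
    qed
    have dr: "\<forall>k\<le>K. degree (r k) \<le> D * e" using C(2) K(1) by (auto simp: r_def)
    show "\<exists>K r. r K \<noteq> 0 \<and> (\<forall>k\<le>K. degree (r k) \<le> D * e) \<and>
      (\<forall>s t. U Yp s t \<longrightarrow> (\<Sum>k\<le>K. ev2 (r k) s t * g Yp i s t ^ k) = 0)"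
      using K(2) dr rel by (intro exI[of _ K] exI[of _ r]) simp
  qed
qed

lemma U_eventually:
  assumes "U Yp s1 t1" "(\<sigma> \<longlongrightarrow> s1) A" "(\<tau> \<longlongrightarrow> t1) A"
  shows "\<forall>\<^sub>F a in A. U Yp (\<sigma> a) (\<tau> a)"
  by (rule img_eventually[OF assms(1)]) (intro ev2_tendsto assms)

lemma g_tendsto:
  assumes "U Yp s1 t1" "(\<sigma> \<longlongrightarrow> s1) A" "(\<tau> \<longlongrightarrow> t1) A" "i < n"
  shows "((\<lambda>a. g Yp i (\<sigma> a) (\<tau> a)) \<longlongrightarrow> g Yp i s1 t1) A"
  by (rule G_tendsto[OF assms(1) _ assms(4)]) (intro ev2_tendsto assms)

lemma surface_identity_limit:
  assumes u: "U Yp s1 t1" and lim: "(\<sigma> \<longlongrightarrow> s1) A" "(\<tau> \<longlongrightarrow> t1) A" and "A \<noteq> bot" "i < n"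
    and ev: "\<forall>\<^sub>F a in A. U Yp (\<sigma> a) (\<tau> a) \<longrightarrow> ev2 p (\<sigma> a) (\<tau> a) * g Yp i (\<sigma> a) (\<tau> a) = ev2 q (\<sigma> a) (\<tau> a)"
  shows "ev2 p s1 t1 * g Yp i s1 t1 = ev2 q s1 t1"
proof (rule tendsto_unique[OF \<open>A \<noteq> bot\<close>])
  show "((\<lambda>a. ev2 q (\<sigma> a) (\<tau> a)) \<longlongrightarrow> ev2 q s1 t1) A" by (intro ev2_tendsto lim)
  have "\<forall>\<^sub>F a in A. ev2 p (\<sigma> a) (\<tau> a) * g Yp i (\<sigma> a) (\<tau> a) = ev2 q (\<sigma> a) (\<tau> a)"
    using U_eventually[OF u lim] ev by eventually_elim simp
  moreover have "((\<lambda>a. ev2 p (\<sigma> a) (\<tau> a) * g Yp i (\<sigma> a) (\<tau> a)) \<longlongrightarrow> ev2 p s1 t1 * g Yp i s1 t1) A"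
    by (intro tendsto_mult ev2_tendsto lim g_tendsto u \<open>i < n\<close>)
  ultimately show "((\<lambda>a. ev2 q (\<sigma> a) (\<tau> a)) \<longlongrightarrow> ev2 p s1 t1 * g Yp i s1 t1) A"
    by (rule Lim_transform_eventually[rotated])
qed

lemma eventually_not_in_finite: "finite E \<Longrightarrow> \<forall>\<^sub>F s in at s1. s \<notin> E" for s1 :: complex
  using islimpt_finite[of E s1] by (simp add: islimpt_iff_eventually)

text \<open>Continuity in two stages: from generic t to all t on a generic vertical line, then from
  generic s to all s. Openness of \<open>U\<close> keeps the nearby points inside it.\<close>

lemma surface_identity:
  assumes "i < n" "finite E" "\<And>s. s \<notin> E \<Longrightarrow> finite (B s)"
    and "\<And>s t. s \<notin> E \<Longrightarrow> t \<notin> B s \<Longrightarrow> U Yp s t \<Longrightarrow> ev2 p s t * g Yp i s t = ev2 q s t"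
    and "U Yp s1 t1"
  shows "ev2 p s1 t1 * g Yp i s1 t1 = ev2 q s1 t1"
proof -
  have 1: "ev2 p s t * g Yp i s t = ev2 q s t" if "s \<notin> E" "U Yp s t" for s t
  proof (rule surface_identity_limit[OF that(2), of "\<lambda>_. s" "at t" "\<lambda>t. t"])
    show "\<forall>\<^sub>F t' in at t. U Yp s t' \<longrightarrow> ev2 p s t' * g Yp i s t' = ev2 q s t'"
      using eventually_not_in_finite[OF assms(3)[OF that(1)]]
      by eventually_elim (use assms(4) that(1) in auto)
  qed (use assms(1) in auto)
  show ?thesis
  proof (rule surface_identity_limit[OF assms(5), of "\<lambda>s. s" "at s1" "\<lambda>_. t1"])
    show "\<forall>\<^sub>F s in at s1. U Yp s t1 \<longrightarrow> ev2 p s t1 * g Yp i s t1 = ev2 q s t1"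
      using eventually_not_in_finite[OF assms(2)] by eventually_elim (use 1 in auto)
  qed (use assms(1) in auto)
qed

end

section \<open>Slices, denominators and the complement of the image on a surface\<close>

definition const_coeffs :: "complex poly \<Rightarrow> complex poly poly" where
  "const_coeffs q = map_poly (\<lambda>c. [:c:]) q"

lemma ev2_const_coeffs: "ev2 (const_coeffs q) s t = poly q t"
  unfolding const_coeffs_def by (induction q) (simp_all add: map_poly_pCons)

context inj_keller_map
begin

lemma slice_s: "(\<lambda>i. ev2 (Yp i) s t) = (\<lambda>i. poly (fix_s (Yp i) s) t)"
  by (simp add: poly_fix_s)

lemma slice_t: "(\<lambda>i. ev2 (Yp i) s t) = (\<lambda>i. poly (poly (Yp i) [:t:]) s)"
  by (simp add: ev2_def)

lemma slice_cofinite: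
  assumes lead: "\<And>i. i < n \<Longrightarrow> fix_s (r i (K i)) s \<noteq> 0"
    and rel: "\<And>i t. i < n \<Longrightarrow> U Yp s t \<Longrightarrow> (\<Sum>k\<le>K i. ev2 (r i k) s t * g Yp i s t ^ k) = 0"
    and u: "U Yp s t0"
  shows "finite {t. \<not> U Yp s t}"
  using u unfolding slice_s
proof (rule curve_cofinite[where r = "\<lambda>i k. fix_s (r i k) s" and K = K, rotated 2])
  show "(\<Sum>k\<le>K i. poly (fix_s (r i k) s) t * G (\<lambda>i. poly (fix_s (Yp i) s) t) i ^ k) = 0"
    if "i < n" "img (\<lambda>i. poly (fix_s (Yp i) s) t)" for i t
    using rel[of i t] that by (simp add: poly_fix_s)
qed (rule lead)

text \<open>On generic vertical slices the product is a polynomial in t of uniformly bounded degree,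
  on generic horizontal slices a polynomial in s. Interpolation in t between M + 1 horizontal slices
  joins them to a bivariate polynomial.\<close>

lemma surface_rational_coordinate:
  assumes i: "i < n"
    and K: "\<And>i. i < n \<Longrightarrow> r i (K i) \<noteq> 0"
      "\<And>i s t. i < n \<Longrightarrow> U Yp s t \<Longrightarrow> (\<Sum>k\<le>K i. ev2 (r i k) s t * g Yp i s t ^ k) = 0"
    and Us: "\<And>s. \<exists>t. U Yp s t" and Ut: "\<And>t. \<exists>s. U Yp s t"
  shows "\<exists>p. \<forall>s t. U Yp s t \<longrightarrow> ev2 (r i (K i)) s t * g Yp i s t = ev2 p s t"
proof -
  define bs where "bs = (\<Union>i<n. {s. fix_s (r i (K i)) s = 0})"
  define bt where "bt = (\<Union>i<n. {t. poly (r i (K i)) [:t:] = 0})"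
  have fin: "finite bs" "finite bt" unfolding bs_def bt_def
    by (intro finite_UN_I finite_fix_s_eq_0 finite_fix_t_eq_0 K(1); simp)+
  have cof_s: "finite {t. \<not> U Yp s t}" if s: "s \<notin> bs" for s
  proof -
    obtain t0 where "U Yp s t0" using Us[of s] by (rule exE)
    then show ?thesis
      by (rule slice_cofinite[where r = r and K = K, rotated 2]) (use s K(2) in \<open>auto simp: bs_def\<close>)
  qed
  have cof_t: "finite {s. \<not> U Yp s t}" if t: "t \<notin> bt" for t
  proof -
    obtain s0 where "U Yp s0 t" using Ut[of t] by (rule exE)
    then show ?thesis unfolding slice_t
    proof (rule curve_cofinite[where r = "\<lambda>i k. poly (r i k) [:t:]" and K = K, rotated 2])
      show "poly (r i (K i)) [:t:] \<noteq> 0" if "i < n" for i using t that by (auto simp: bt_def)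
      show "(\<Sum>k\<le>K i. poly (poly (r i k) [:t:]) s * G (\<lambda>i. poly (poly (Yp i) [:t:]) s) i ^ k) = 0"
        if "i < n" "img (\<lambda>i. poly (poly (Yp i) [:t:]) s)" for i s
        using K(2)[of i s t] that by (simp add: ev2_def)
    qed
  qed
  define a where "a = r i (K i)"
  define M where "M = (\<Sum>k\<le>K i. degree (r i k)) * K i"
  have hs: "\<exists>h. degree h \<le> M \<and> (\<forall>t. U Yp s t \<longrightarrow> ev2 a s t * g Yp i s t = poly h t)" if s: "s \<notin> bs" for s
    using curve_rational[OF i, of "K i" "\<lambda>k. fix_s (r i k) s" "\<Sum>k\<le>K i. degree (r i k)" "\<lambda>i. fix_s (Yp i) s"]
      cof_s[OF s] K(2)[OF i, of s] order_trans[OF degree_fix_s member_le_sum[of _ "{..K i}" "\<lambda>k. degree (r i k)"]]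
    by (simp add: poly_fix_s M_def a_def)
  have "\<exists>h. \<forall>s. U Yp s t \<longrightarrow> ev2 a s t * g Yp i s t = poly h s" if t: "t \<notin> bt" for t
  proof -
    have "\<exists>h. degree h \<le> (\<Sum>k\<le>K i. degree (poly (r i k) [:t:])) * K i \<and>
     (\<forall>s. img (\<lambda>i. poly (poly (Yp i) [:t:]) s) \<longrightarrow> poly (poly (r i (K i)) [:t:]) s * G (\<lambda>i. poly (poly (Yp i) [:t:]) s) i = poly h s)"
    proof (rule curve_rational[OF i, of "K i" "\<lambda>k. poly (r i k) [:t:]"])
      show "degree (poly (r i k) [:t:]) \<le> (\<Sum>k\<le>K i. degree (poly (r i k) [:t:]))" if "k \<le> K i" for k
        using that by (intro member_le_sum) auto
      show "(\<Sum>k\<le>K i. poly (poly (r i k) [:t:]) s * G (\<lambda>i. poly (poly (Yp i) [:t:]) s) i ^ k) = 0"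
        if "img (\<lambda>i. poly (poly (Yp i) [:t:]) s)" for s
        using K(2)[OF i, of s t] that by (simp add: ev2_def)
      show "finite {s. \<not> img (\<lambda>i. poly (poly (Yp i) [:t:]) s)}"
        using cof_t[OF t] by (simp add: ev2_def)
    qed
    then show ?thesis by (auto simp: ev2_def a_def)
  qed
  then have "\<forall>t\<in>- bt. \<exists>h. \<forall>s. U Yp s t \<longrightarrow> ev2 a s t * g Yp i s t = poly h s" by simp
  then obtain H where H: "\<forall>t\<in>- bt. \<forall>s. U Yp s t \<longrightarrow> ev2 a s t * g Yp i s t = poly (H t) s"
    by (rule bchoice[THEN exE])
  have "infinite (- bt)" using fin(2) infinite_UNIV_char_0 by (simp add: Compl_eq_Diff_UNIV)
  then obtain T where T: "finite T" "card T = Suc M" "T \<subseteq> - bt"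
    using infinite_arbitrarily_large[of "- bt" "Suc M"] by auto
  define p where "p = (\<Sum>b\<in>T. const_coeffs (lagrange_poly T b) * [:H b:])"
  \<comment> \<open>For s outside \<open>E\<close> every point (s, b) with b in \<open>T\<close>
    lies in \<open>U\<close>, so both descriptions can be compared at the nodes.\<close>
  define E where "E = bs \<union> (\<Union>b\<in>T. {s. \<not> U Yp s b})"
  have E: "finite E" unfolding E_def using fin(1) T cof_t by auto
  have "ev2 a s t * g Yp i s t = ev2 p s t" if u: "U Yp s t" for s t
  proof (rule surface_identity[OF i E, of "\<lambda>_. {}"])
    show "U Yp s t" by (rule u)
    fix s t assume s: "s \<notin> E" and u: "U Yp s t"
    obtain h where h: "degree h \<le> M" "\<forall>t. U Yp s t \<longrightarrow> ev2 a s t * g Yp i s t = poly h t"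
      using hs[of s] s by (auto simp: E_def)
    have hb: "poly h b = poly (H b) s" if "b \<in> T" for b
    proof -
      have "U Yp s b" using s that by (auto simp: E_def)
      then show ?thesis using h(2) H T(3) that by fastforce
    qed
    have "ev2 a s t * g Yp i s t = poly h t" using h(2) u by simp
    also have "\<dots> = (\<Sum>b\<in>T. poly h b * poly (lagrange_poly T b) t)"
      by (rule lagrange_interpolation) (use T h(1) in auto)
    also have "\<dots> = ev2 p s t"
      unfolding p_def ev2_sum by (intro sum.cong refl) (simp add: hb ev2_const_coeffs mult.commute)
    finally show "ev2 a s t * g Yp i s t = ev2 p s t" .
  qed simp
  then show ?thesis unfolding a_def by (intro exI[of _ p]) simp
qed

text \<open>One \<open>a\<close> serves all coordinates, and the identity is multiplied out so that
  it says something also where \<open>a\<close> vanishes.\<close>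

definition denominator :: "(nat \<Rightarrow> complex poly poly) \<Rightarrow> complex poly poly \<Rightarrow> (nat \<Rightarrow> complex poly poly) \<Rightarrow> bool" where
  "denominator Yp a p \<longleftrightarrow> a \<noteq> 0 \<and> (\<forall>i<n. \<forall>s t. U Yp s t \<longrightarrow> ev2 a s t * g Yp i s t = ev2 (p i) s t)"

lemma denominatorD: "denominator Yp a p \<Longrightarrow> i < n \<Longrightarrow> U Yp s t \<Longrightarrow> ev2 a s t * g Yp i s t = ev2 (p i) s t"
  unfolding denominator_def by simp

lemma surface_relation:
  assumes i: "i < n"
  shows "\<exists>K r. r K \<noteq> 0 \<and> (\<forall>s t. U Yp s t \<longrightarrow> (\<Sum>k\<le>K. ev2 (r k) s t * g Yp i s t ^ k) = 0)"
proof -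
  define e where "e = (\<Sum>j<n. degree (Yp j))"
  have e: "\<forall>j<n. degree (Yp j) \<le> e" unfolding e_def by (auto intro: member_le_sum)
  from surface_algebraic[OF i] obtain D where "\<forall>Yp e. (\<forall>j<n. degree (Yp j) \<le> e) \<longrightarrow>
    (\<exists>K r. r K \<noteq> 0 \<and> (\<forall>k\<le>K. degree (r k) \<le> D * e) \<and>
    (\<forall>s t. U Yp s t \<longrightarrow> (\<Sum>k\<le>K. ev2 (r k) s t * g Yp i s t ^ k) = 0))" by (rule exE)
  from mp[OF spec[OF spec[OF this, of Yp], of e] e] obtain K r where
    "r K \<noteq> 0 \<and> (\<forall>k\<le>K. degree (r k) \<le> D * e) \<and>
    (\<forall>s t. U Yp s t \<longrightarrow> (\<Sum>k\<le>K. ev2 (r k) s t * g Yp i s t ^ k) = 0)"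
    by (elim exE) (rule that)
  then show ?thesis by (intro exI[of _ K] exI[of _ r]) simp
qed

lemma surface_relations:
  "\<exists>K r. \<forall>i<n. r i (K i) \<noteq> 0 \<and>
    (\<forall>s t. U Yp s t \<longrightarrow> (\<Sum>k\<le>K i. ev2 (r i k) s t * g Yp i s t ^ k) = 0)"
proof -
  have "\<exists>K r. r K \<noteq> 0 \<and> (\<forall>s t. U Yp s t \<longrightarrow> (\<Sum>k\<le>K. ev2 (r k) s t * g Yp i s t ^ k) = 0)" if "i < n" for i
    by (rule surface_relation[OF that])
  then have "\<forall>i\<in>{..<n}. \<exists>Kr. snd Kr (fst Kr) \<noteq> 0 \<and>
      (\<forall>s t. U Yp s t \<longrightarrow> (\<Sum>k\<le>fst Kr. ev2 (snd Kr k) s t * g Yp i s t ^ k) = 0)" by simp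
  then obtain Kr where "\<forall>i\<in>{..<n}. snd (Kr i) (fst (Kr i)) \<noteq> 0 \<and>
      (\<forall>s t. U Yp s t \<longrightarrow> (\<Sum>k\<le>fst (Kr i). ev2 (snd (Kr i) k) s t * g Yp i s t ^ k) = 0)"
    by (rule bchoice[THEN exE])
  then show ?thesis by (intro exI[of _ "\<lambda>i. fst (Kr i)"] exI[of _ "\<lambda>i. snd (Kr i)"]) auto
qed

lemma slices_cofinite:
  assumes Us: "\<And>s. \<exists>t. U Yp s t"
  shows "\<exists>E. finite E \<and> (\<forall>s. s \<notin> E \<longrightarrow> finite {t. \<not> U Yp s t})"
proof -
  obtain K r where "\<forall>i<n. r i (K i) \<noteq> 0 \<and>
    (\<forall>s t. U Yp s t \<longrightarrow> (\<Sum>k\<le>K i. ev2 (r i k) s t * g Yp i s t ^ k) = 0)"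
    using surface_relations[of Yp] by (elim exE) (rule that)
  then have K: "\<And>i. i < n \<Longrightarrow> r i (K i) \<noteq> 0"
    "\<And>i s t. i < n \<Longrightarrow> U Yp s t \<Longrightarrow> (\<Sum>k\<le>K i. ev2 (r i k) s t * g Yp i s t ^ k) = 0"
    by simp_all
  show ?thesis
  proof (intro exI[of _ "\<Union>i<n. {s. fix_s (r i (K i)) s = 0}"] conjI allI impI)
    show "finite (\<Union>i<n. {s. fix_s (r i (K i)) s = 0})"
      using K(1) by (intro finite_UN_I finite_fix_s_eq_0) auto
    fix s assume s: "s \<notin> (\<Union>i<n. {s. fix_s (r i (K i)) s = 0})"
    obtain t0 where "U Yp s t0" using Us[of s] by (rule exE)
    then show "finite {t. \<not> U Yp s t}"
      by (rule slice_cofinite[where r = r and K = K, rotated 2]) (use s K(2) in auto)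
  qed
qed

text \<open>The line is regarded as a surface that does not depend on s; any s outside the
  exceptional set gives the result.\<close>

lemma line_cofinite:
  assumes "img (\<lambda>i. poly (yp i) t1)"
  shows "finite {t. \<not> img (\<lambda>i. poly (yp i) t)}"
proof -
  have "\<exists>t. U (\<lambda>i. const_coeffs (yp i)) s t" for s
    by (rule exI[of _ t1]) (simp add: ev2_const_coeffs assms)
  from slices_cofinite[of "\<lambda>i. const_coeffs (yp i)", OF this] obtain E where
    E: "finite E \<and> (\<forall>s. s \<notin> E \<longrightarrow> finite {t. \<not> U (\<lambda>i. const_coeffs (yp i)) s t})" by (rule exE)
  obtain s where "s \<notin> E" using ex_new_if_finite[OF infinite_UNIV_char_0 conjunct1[OF E]] by (rule exE)
  with E have "finite {t. \<not> U (\<lambda>i. const_coeffs (yp i)) s t}" by simp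
  then show ?thesis by (simp only: ev2_const_coeffs)
qed

lemma surface_denominator:
  assumes Us: "\<And>s. \<exists>t. U Yp s t" and Ut: "\<And>t. \<exists>s. U Yp s t"
  shows "\<exists>a p. denominator Yp a p"
proof -
  obtain K r where "\<forall>i<n. r i (K i) \<noteq> 0 \<and>
    (\<forall>s t. U Yp s t \<longrightarrow> (\<Sum>k\<le>K i. ev2 (r i k) s t * g Yp i s t ^ k) = 0)"
    using surface_relations[of Yp] by (elim exE) (rule that)
  then have K: "\<And>i. i < n \<Longrightarrow> r i (K i) \<noteq> 0"
    "\<And>i s t. i < n \<Longrightarrow> U Yp s t \<Longrightarrow> (\<Sum>k\<le>K i. ev2 (r i k) s t * g Yp i s t ^ k) = 0"
    by simp_all
  define a where "a i = r i (K i)" for i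
  have "\<forall>i\<in>{..<n}. \<exists>p. \<forall>s t. U Yp s t \<longrightarrow> ev2 (a i) s t * g Yp i s t = ev2 p s t"
    unfolding a_def using surface_rational_coordinate[of _ r K Yp, OF _ K Us Ut] by simp
  then obtain p where p: "\<forall>i\<in>{..<n}. \<forall>s t. U Yp s t \<longrightarrow> ev2 (a i) s t * g Yp i s t = ev2 (p i) s t"
    by (rule bchoice[THEN exE])
  have "denominator Yp (\<Prod>j<n. a j) (\<lambda>i. p i * (\<Prod>j\<in>{..<n} - {i}. a j))"
    unfolding denominator_def
  proof (intro conjI allI impI)
    show "(\<Prod>j<n. a j) \<noteq> 0" using K(1) by (simp add: a_def)
    fix i s t assume "i < n" "U Yp s t"
    then have "ev2 (a i) s t * g Yp i s t = ev2 (p i) s t" using p by simp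
    moreover have "(\<Prod>j<n. a j) = a i * (\<Prod>j\<in>{..<n} - {i}. a j)"
      using \<open>i < n\<close> by (intro prod.remove) auto
    ultimately show "ev2 (\<Prod>j<n. a j) s t * g Yp i s t = ev2 (p i * (\<Prod>j\<in>{..<n} - {i}. a j)) s t"
      by (simp add: mult_ac)
  qed
  then show ?thesis by (intro exI)
qed

text \<open>A denominator with the fewest prime factors will do: a prime dividing it and all
  numerators could be cancelled, first where the prime does not vanish and then on all of
  \<open>U\<close> by continuity.\<close>

lemma reduced_denominator:
  assumes ex: "\<exists>a p. denominator Yp a p"
  shows "\<exists>a p. denominator Yp a p \<and> (\<forall>\<pi>. prime \<pi> \<longrightarrow> \<pi> dvd a \<longrightarrow> (\<exists>i<n. \<not> \<pi> dvd p i))"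
proof -
  define m where "m a = size (prime_factorization a)" for a :: "complex poly poly"
  define P where "P a \<longleftrightarrow> (\<exists>p. denominator Yp a p)" for a
  have "\<exists>a. P a" unfolding P_def by (rule ex)
  then obtain a0 where "P a0" by (rule exE)
  from ex_has_least_nat[of P, OF this, of m] obtain a where aa: "P a \<and> (\<forall>b. P b \<longrightarrow> m a \<le> m b)"
    by (rule exE)
  then have a: "P a" "\<And>b. P b \<Longrightarrow> m a \<le> m b" by simp_all
  obtain p where p: "denominator Yp a p" using a(1) unfolding P_def by (rule exE)
  have "\<exists>i<n. \<not> \<pi> dvd p i" if \<pi>: "prime \<pi>" "\<pi> dvd a" for \<pi>
  proof (rule ccontr)
    assume "\<not> (\<exists>i<n. \<not> \<pi> dvd p i)"
    then have "\<forall>i\<in>{..<n}. \<exists>q. p i = \<pi> * q" by (auto simp: dvd_def)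
    then obtain q where q: "\<forall>i\<in>{..<n}. p i = \<pi> * q i" by (rule bchoice[THEN exE])
    obtain b where b: "a = \<pi> * b" using \<pi>(2) by (rule dvdE)
    have nz: "b \<noteq> 0" "\<pi> \<noteq> 0" using p by (auto simp: b denominator_def)
    have "denominator Yp b q"
      unfolding denominator_def
    proof (intro conjI nz(1) allI impI)
      fix i s t assume i: "i < n" and u: "U Yp s t"
      show "ev2 b s t * g Yp i s t = ev2 (q i) s t"
      proof (rule surface_identity[OF i, of "{s. fix_s \<pi> s = 0}" "\<lambda>s. {t. poly (fix_s \<pi> s) t = 0}"])
        show "finite {s. fix_s \<pi> s = 0}" by (rule finite_fix_s_eq_0[OF nz(2)])
        show "finite {t. poly (fix_s \<pi> s) t = 0}" if "s \<notin> {s. fix_s \<pi> s = 0}" for s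
          using that by (intro poly_roots_finite) auto
        show "U Yp s t" by (rule u)
        fix s t assume "t \<notin> {t. poly (fix_s \<pi> s) t = 0}" and u: "U Yp s t"
        then have "ev2 \<pi> s t \<noteq> 0" by (simp add: poly_fix_s)
        moreover have "ev2 \<pi> s t * (ev2 b s t * g Yp i s t) = ev2 \<pi> s t * ev2 (q i) s t"
          using denominatorD[OF p i u] q i by (simp add: b mult.assoc)
        ultimately show "ev2 b s t * g Yp i s t = ev2 (q i) s t" by simp
      qed
    qed
    then have "P b" unfolding P_def by (rule exI[of _ q])
    moreover have "m a = Suc (m b)"
      using nz \<pi>(1) by (simp add: m_def b prime_factorization_mult prime_factorization_prime)
    ultimately show False using a(2)[of b] by simp
  qed
  then show ?thesis using p by (intro exI[of _ a] exI[of _ p]) simp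
qed

text \<open>Where a prime factor \<open>\<pi>\<close> of the denominator meets \<open>U\<close>, every numerator vanishes on the zeros of \<open>\<pi>\<close>. As
  \<open>\<pi>\<close> does not divide all numerators, Bezout leaves finitely many \<open>s\<close> for which \<open>\<pi>(s, \<cdot>)\<close> has a zero near
  \<open>t1\<close>; the bound \<open>poly_bound_no_roots\<close> then lets \<open>\<pi>(s1, \<cdot>)\<close> inherit the zero at \<open>t1\<close> on a whole disc.\<close>

lemma reduced_denominator_nonzero:
  assumes den: "denominator Yp a p"
    and red: "\<And>\<pi>. prime \<pi> \<Longrightarrow> \<pi> dvd a \<Longrightarrow> \<exists>i<n. \<not> \<pi> dvd p i"
    and u: "U Yp s1 t1"
  shows "ev2 a s1 t1 \<noteq> 0"
proof
  assume "ev2 a s1 t1 = 0"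
  moreover have "a \<noteq> 0" using den by (simp add: denominator_def)
  ultimately obtain \<pi> where \<pi>: "prime \<pi>" "\<pi> dvd a" "ev2 \<pi> s1 t1 = 0"
    using prime_factor_vanishing[of a s1 t1] by auto
  obtain i where i: "i < n" "\<not> \<pi> dvd p i" using red[OF \<pi>(1,2)] by auto
  have vanish: "ev2 (p i) s t = 0" if "U Yp s t" "ev2 \<pi> s t = 0" for s t
  proof -
    have "ev2 a s t = 0" using \<pi>(2) that(2) by (auto elim!: dvdE)
    then show ?thesis using denominatorD[OF den i(1) that(1)] by simp
  qed
  show False
  \<comment> \<open>If \<pi> vanishes on the vertical line through the point, \<open>p i\<close>
    vanishes there near t1, hence on the whole line, and \<pi> divides it. Otherwise \<pi> has
    positive degree in t and Bezout applies.\<close>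
  proof (cases "fix_s \<pi> s1 = 0 \<or> degree \<pi> = 0")
    case True
    then have v: "\<pi> dvd [:[:- s1, 1:]:]" "degree \<pi> = 0" using prime_vertical[OF \<pi>(1), of s1 t1] \<pi>(3) by auto
    have pi0: "ev2 \<pi> s1 t = 0" for t
      using v(2) \<pi>(3) by (auto elim!: degree_eq_zeroE)
    have "\<forall>\<^sub>F t in at t1. U Yp s1 t" by (rule U_eventually[OF u tendsto_const tendsto_ident_at])
    then have Z: "\<forall>\<^sub>F t in at t1. poly (fix_s (p i) s1) t = 0"
      by eventually_elim (simp add: poly_fix_s vanish pi0)
    have "fix_s (p i) s1 = 0"
    proof (rule ccontr)
      assume "fix_s (p i) s1 \<noteq> 0"
      from eventually_not_in_finite[OF poly_roots_finite[OF this], of t1] Z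
      have "\<forall>\<^sub>F t in at t1. False" by eventually_elim simp
      then show False by simp
    qed
    then have "[:[:- s1, 1:]:] dvd p i" by (simp only: fix_s_eq_0_iff)
    then show False using dvd_trans[OF v(1)] i(2) by simp
  next
    case False
    then have pr: "prime_elem \<pi>" "degree \<pi> > 0" using \<pi>(1) by auto
    from prime_bezout[OF pr i(2)] obtain \<alpha> \<beta> r where r: "\<alpha> * \<pi> + \<beta> * p i = [:r:]" "r \<noteq> 0"
      by (elim exE conjE) (rule that)
    from arg_cong[OF r(1)] have rv: "ev2 \<alpha> s t * ev2 \<pi> s t + ev2 \<beta> s t * ev2 (p i) s t = poly r s" for s t
      by (metis ev2_simps(3,6,8))
    have "\<forall>\<^sub>F z in nhds (s1, t1). U Yp (fst z) (snd z)"
      by (rule U_eventually[OF u]) (auto intro!: tendsto_eq_intros filterlim_ident)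
    then obtain \<rho> where \<rho>: "\<rho> > 0" "\<forall>z. dist z (s1, t1) < \<rho> \<longrightarrow> U Yp (fst z) (snd z)"
      by (auto simp: eventually_nhds_metric)
    have near: "U Yp s t" if "cmod (s - s1) < \<rho>/2" "cmod (t - t1) < \<rho>/2" for s t
    proof -
      have "dist (s, t) (s1, t1) \<le> dist s s1 + dist t t1" by (simp add: dist_Pair_Pair sqrt_sum_squares_le_sum)
      also have "\<dots> < \<rho>" using that by (simp add: dist_norm)
      finally show ?thesis using \<rho>(2) by fastforce
    qed
    have "poly (fix_s \<pi> s1) t = 0" if t: "cmod (t - t1) \<le> \<rho>/2" for t
    proof -
      have "\<forall>\<^sub>F s in at s1. cmod (ev2 \<pi> s t) \<le> 2 ^ degree \<pi> * cmod (ev2 \<pi> s t1)"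
      proof -
        have "\<forall>\<^sub>F s in at s1. dist s s1 < \<rho>/2"
          by (rule tendstoD[OF tendsto_ident_at]) (use \<rho>(1) in simp)
        moreover have "\<forall>\<^sub>F s in at s1. s \<notin> {s. poly r s = 0}"
          by (rule eventually_not_in_finite[OF poly_roots_finite[OF r(2)]])
        ultimately show ?thesis
        proof eventually_elim
          case (elim s)
          have "cmod (poly (fix_s \<pi> s) t) \<le> 2 ^ degree (fix_s \<pi> s) * cmod (poly (fix_s \<pi> s) t1)"
          proof (rule poly_bound_no_roots[OF _ t])
            fix z assume z: "poly (fix_s \<pi> s) z = 0"
            \<comment> \<open>A closer zero would be a common zero of \<pi> and \<open>p i\<close>,
              which makes s a root of \<open>r\<close>.\<close>
            show "\<rho>/2 \<le> cmod (z - t1)"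
            proof (rule ccontr)
              assume "\<not> \<rho>/2 \<le> cmod (z - t1)"
              then have "U Yp s z" using elim(1) by (intro near) (auto simp: dist_norm)
              then have "ev2 (p i) s z = 0" using z by (intro vanish) (auto simp: poly_fix_s)
              then show False using rv[of s z] z elim(2) by (simp add: poly_fix_s)
            qed
          qed
          also have "\<dots> \<le> 2 ^ degree \<pi> * cmod (poly (fix_s \<pi> s) t1)"
            by (intro mult_right_mono power_increasing degree_fix_s) auto
          finally show ?case by (simp only: poly_fix_s)
        qed
      qed
      \<comment> \<open>The limit s to s1; the right-hand side becomes 0 because \<pi> vanishes at
        (s1, t1).\<close>
      then have "cmod (ev2 \<pi> s1 t) \<le> 2 ^ degree \<pi> * cmod (ev2 \<pi> s1 t1)"
        by (intro tendsto_le[OF at_neq_bot[of s1] _ _])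
           (auto intro!: tendsto_intros ev2_tendsto)
      then show ?thesis using \<pi>(3) by (simp add: poly_fix_s)
    qed
    then have "cball t1 (\<rho>/2) \<subseteq> {t. poly (fix_s \<pi> s1) t = 0}"
      by (auto simp: dist_norm norm_minus_commute)
    moreover have "infinite (cball t1 (\<rho>/2))"
    proof
      assume "finite (cball t1 (\<rho>/2))"
      then have "finite (ball t1 (\<rho>/2))" by (rule finite_subset[OF ball_subset_cball])
      then show False using finite_imp_not_open[of "ball t1 (\<rho>/2)"] \<rho>(1) by auto
    qed
    ultimately have "infinite {t. poly (fix_s \<pi> s1) t = 0}" by (rule infinite_super)
    then show False using poly_roots_finite[of "fix_s \<pi> s1"] False by simp
  qed
qed

text \<open>The quotients of \<open>p i\<close> by \<open>a\<close> are the candidate preimage. At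
  nearby points of \<open>U\<close> they are a preimage, and the equations pass to the limit, first
  along a generic vertical line and then along a horizontal one.\<close>

lemma denominator_nonzero_imp_U:
  assumes den: "denominator Yp a p"
    and E: "finite E" "\<And>s. s \<notin> E \<Longrightarrow> finite {t. \<not> U Yp s t}"
    and nz: "ev2 a s1 t1 \<noteq> 0"
  shows "U Yp s1 t1"
proof -
  have lim: "U Yp s0 t0" if nz: "ev2 a s0 t0 \<noteq> 0" and "A \<noteq> bot"
      and l: "(\<sigma> \<longlongrightarrow> s0) A" "(\<tau> \<longlongrightarrow> t0) A" and ev: "\<forall>\<^sub>F z in A. U Yp (\<sigma> z) (\<tau> z)"
    for s0 t0 :: complex and A :: "complex filter" and \<sigma> \<tau>
  proof (rule imgI[of "\<lambda>i. ev2 (p i) s0 t0 / ev2 a s0 t0"])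
    fix j assume j: "j < n"
    have "((\<lambda>z. F j (\<lambda>i. ev2 (p i) (\<sigma> z) (\<tau> z) / ev2 a (\<sigma> z) (\<tau> z))) \<longlongrightarrow>
        F j (\<lambda>i. ev2 (p i) s0 t0 / ev2 a s0 t0)) A"
      by (rule pd_tendsto[OF pdF[OF j]]) (intro tendsto_divide ev2_tendsto l nz)
    moreover have "\<forall>\<^sub>F z in A. F j (\<lambda>i. ev2 (p i) (\<sigma> z) (\<tau> z) / ev2 a (\<sigma> z) (\<tau> z)) = ev2 (Yp j) (\<sigma> z) (\<tau> z)"
    proof -
      have "\<forall>\<^sub>F z in A. ev2 a (\<sigma> z) (\<tau> z) \<noteq> 0"
        by (rule tendsto_imp_eventually_ne[OF ev2_tendsto[OF l] nz])
      with ev show ?thesis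
      proof eventually_elim
        case (elim z)
        have "F j (\<lambda>i. ev2 (p i) (\<sigma> z) (\<tau> z) / ev2 a (\<sigma> z) (\<tau> z)) = F j (G (\<lambda>i. ev2 (Yp i) (\<sigma> z) (\<tau> z)))"
        proof (rule pd_cong[OF pdF[OF j]])
          fix i assume "i < n"
          then show "ev2 (p i) (\<sigma> z) (\<tau> z) / ev2 a (\<sigma> z) (\<tau> z) = G (\<lambda>i. ev2 (Yp i) (\<sigma> z) (\<tau> z)) i"
            using denominatorD[OF den _ elim(1)] elim(2) by (simp add: field_simps)
        qed
        then show ?case using F_G[OF elim(1) j] by simp
      qed
    qed
    ultimately have "((\<lambda>z. ev2 (Yp j) (\<sigma> z) (\<tau> z)) \<longlongrightarrow> F j (\<lambda>i. ev2 (p i) s0 t0 / ev2 a s0 t0)) A"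
      by (rule Lim_transform_eventually)
    then show "F j (\<lambda>i. ev2 (p i) s0 t0 / ev2 a s0 t0) = ev2 (Yp j) s0 t0"
      using tendsto_unique[OF \<open>A \<noteq> bot\<close> _ ev2_tendsto[OF l]] by simp
  qed
  have 1: "U Yp s t" if "s \<notin> E" "ev2 a s t \<noteq> 0" for s t
  proof (rule lim[OF that(2), of "at t" "\<lambda>_. s" "\<lambda>t. t"])
    show "\<forall>\<^sub>F z in at t. U Yp s z"
      using eventually_not_in_finite[OF E(2)[OF that(1)], of t] by simp
  qed auto
  show ?thesis
  proof (rule lim[OF nz, of "at s1" "\<lambda>s. s" "\<lambda>_. t1"])
    have "\<forall>\<^sub>F s in at s1. ev2 a s t1 \<noteq> 0"
      by (rule tendsto_imp_eventually_ne[OF ev2_tendsto[OF tendsto_ident_at tendsto_const] nz])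
    with eventually_not_in_finite[OF E(1), of s1] show "\<forall>\<^sub>F s in at s1. U Yp s t1"
      by eventually_elim (rule 1)
  qed auto
qed

text \<open>Reducedness gives one direction, the limit of quotients the other. The assumptions
  supply on every slice the starting point that \<open>curve_cofinite\<close> asks for.\<close>

theorem surface_complement:
  assumes Us: "\<And>s. \<exists>t. U Yp s t" and Ut: "\<And>t. \<exists>s. U Yp s t"
  shows "\<exists>a p. denominator Yp a p \<and> (\<forall>s t. U Yp s t \<longleftrightarrow> ev2 a s t \<noteq> 0)"
proof -
  from reduced_denominator[OF surface_denominator[OF Us Ut]] obtain a p where
    ap: "denominator Yp a p \<and> (\<forall>\<pi>. prime \<pi> \<longrightarrow> \<pi> dvd a \<longrightarrow> (\<exists>i<n. \<not> \<pi> dvd p i))" by (elim exE) (rule that)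
  from slices_cofinite[OF Us] obtain E where E: "finite E \<and> (\<forall>s. s \<notin> E \<longrightarrow> finite {t. \<not> U Yp s t})" by (rule exE)
  have "U Yp s t \<longleftrightarrow> ev2 a s t \<noteq> 0" for s t
    using reduced_denominator_nonzero[of Yp a p s t] denominator_nonzero_imp_U[of Yp a p E s t] ap E by auto
  then show ?thesis using ap by (intro exI[of _ a] exI[of _ p]) simp
qed

end

section \<open>Injective Keller maps are invertible\<close>

lemma degree_const_coeffs: "degree (const_coeffs q) \<le> degree q"
  by (rule degree_le) (simp add: const_coeffs_def coeff_map_poly coeff_eq_0)

text \<open>If h had degree above \<open>D\<close>, each further power of h would outweigh any
  coefficient, and the leading term could not cancel.\<close>

lemma polynomial_root_degree:
  fixes r :: "nat \<Rightarrow> complex poly"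
  assumes lead: "r K \<noteq> 0" and deg: "\<And>k. k \<le> K \<Longrightarrow> degree (r k) \<le> D"
    and rel: "(\<Sum>k\<le>K. r k * h ^ k) = 0"
  shows "degree h \<le> D"
proof (rule ccontr)
  assume "\<not> degree h \<le> D"
  then have gt: "D < degree h" and "h \<noteq> 0" by auto
  have eq: "r K * h ^ K = - (\<Sum>k<K. r k * h ^ k)"
    using rel by (simp add: lessThan_Suc_atMost[symmetric] eq_neg_iff_add_eq_0 add.commute)
  show False
  proof (cases K)
    case 0
    then show ?thesis using rel lead by simp
  next
    case (Suc m)
    have "degree (r K * h ^ K) = degree (r K) + K * degree h"
      using lead \<open>h \<noteq> 0\<close> by (simp add: degree_mult_eq degree_power_eq)
    moreover have "degree (- (\<Sum>k<K. r k * h ^ k)) \<le> D + m * degree h"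
      unfolding degree_minus
    proof (rule degree_sum_le)
      fix k assume k: "k \<in> {..<K}"
      have "degree (r k * h ^ k) \<le> degree (r k) + degree (h ^ k)" by (rule degree_mult_le)
      also have "\<dots> \<le> D + m * degree h"
      proof (rule add_mono)
        show "degree (r k) \<le> D" using k by (intro deg) simp
        have "degree (h ^ k) \<le> degree h * k" by (rule degree_power_le)
        also have "\<dots> \<le> m * degree h" using k Suc by simp
        finally show "degree (h ^ k) \<le> m * degree h" .
      qed
      finally show "degree (r k * h ^ k) \<le> D + m * degree h" .
    qed simp
    ultimately have "K * degree h \<le> D + m * degree h" unfolding eq by simp
    then show False using gt Suc by simp
  qed
qed

context inj_keller_map
begin

lemma surjective: "img y0"
proof (rule ccontr)
  assume y0: "\<not> img y0"
  define F0 where "F0 j = F j (\<lambda>_. 0)" for j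
  define l where "l j = [:F0 j, y0 j - F0 j:]" for j
  have l0: "img (\<lambda>j. poly (l j) 0)" by (rule imgI[of "\<lambda>_. 0"]) (simp add: l_def F0_def)
  define T where "T = {t. \<not> img (\<lambda>j. poly (l j) t)}"
  have T: "finite T" unfolding T_def by (rule line_cofinite[OF l0])
  have "1 \<in> T" using y0 by (simp add: T_def l_def)
  \<comment> \<open>The factor 2 brings the roots \<tau> / t1 of \<open>q\<close> below into the
    disc of radius 1/2; the added 1 makes the inequality strict.\<close>
  define t1 where "t1 = complex_of_real (2 * (\<Sum>\<tau>\<in>T. cmod \<tau>) + 1)"
  have s0: "0 \<le> (\<Sum>\<tau>\<in>T. cmod \<tau>)" by (intro sum_nonneg) simp
  have ct1: "cmod t1 = 2 * (\<Sum>\<tau>\<in>T. cmod \<tau>) + 1" unfolding t1_def norm_of_real using s0 by simp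
  have small: "2 * cmod \<tau> < cmod t1" if "\<tau> \<in> T" for \<tau>
    using member_le_sum[OF that _ T, of cmod] by (simp add: ct1)
  have "t1 \<notin> T" using small[of t1] norm_ge_zero[of t1] by linarith
  have "t1 \<noteq> 0" using ct1 s0 by auto
  define x1 where "x1 = G (\<lambda>j. poly (l j) t1)"
  have Fx1: "F j x1 = poly (l j) t1" if "j < n" for j
    unfolding x1_def by (rule F_G) (use \<open>t1 \<notin> T\<close> that in \<open>simp_all add: T_def\<close>)
  have "\<forall>j\<in>{..<n}. \<exists>p. \<forall>s. F j (\<lambda>i. poly [:0, x1 i:] s) = poly p s"
  proof
    fix j assume "j \<in> {..<n}"
    then have "j < n" by simp
    have "degree [:0, x1 i:] \<le> 1" for i by (rule order_trans[OF degree_pCons_le]) simp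
    from pd_curve[OF pdF[OF \<open>j < n\<close>], of "\<lambda>i. [:0, x1 i:]", OF this]
    show "\<exists>p. \<forall>s. F j (\<lambda>i. poly [:0, x1 i:] s) = poly p s" by (elim exE conjE) (rule exI)
  qed
  then obtain P where P: "\<forall>j\<in>{..<n}. \<forall>s. F j (\<lambda>i. poly [:0, x1 i:] s) = poly (P j) s"
    by (rule bchoice[THEN exE])
  \<comment> \<open>For t = 0 or s = 0 the surface stays at F(0), for t = 1 it is the image of s x1,
    and for s = 1 it runs along the line \<open>l\<close>.\<close>
  define Y where "Y j = [:[:F0 j:], P j - [:F0 j:]:]" for j
  have Y: "ev2 (Y j) s t = F0 j + t * (F j (\<lambda>i. s * x1 i) - F0 j)" if "j < n" for j s t
    using P that by (simp add: Y_def)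
  have U0: "U Y s 0" for s
    by (rule imgI[of "\<lambda>_. 0"]) (simp add: Y F0_def)
  have U1: "U Y s 1" for s
    by (rule imgI[of "\<lambda>i. s * x1 i"]) (simp add: Y)
  have U2: "U Y 0 t" for t
    by (rule imgI[of "\<lambda>_. 0"]) (simp add: Y F0_def)
  have "\<exists>a p. denominator Y a p \<and> (\<forall>s t. U Y s t \<longleftrightarrow> ev2 a s t \<noteq> 0)"
    by (rule surface_complement) (rule exI, rule U0, rule exI, rule U2)
  then obtain a p where "denominator Y a p \<and> (\<forall>s t. U Y s t \<longleftrightarrow> ev2 a s t \<noteq> 0)"
    by (elim exE) (rule that)
  then have a: "U Y s t \<longleftrightarrow> ev2 a s t \<noteq> 0" for s t by simp
  have n0: "ev2 a s 0 \<noteq> 0" and n1: "ev2 a s 1 \<noteq> 0" for s using U0 U1 a by simp_all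
  have e1: "ev2 a 1 1 = ev2 a 0 1"
    unfolding ev2_def by (rule no_roots_constant) (rule n1[unfolded ev2_def])
  have e2: "ev2 a 0 1 = ev2 a 0 0"
    unfolding poly_fix_s[symmetric] by (rule no_roots_constant) (use U2 a in \<open>simp add: poly_fix_s\<close>)
  have e3: "ev2 a 0 0 = ev2 a 1 0"
    unfolding ev2_def by (rule no_roots_constant) (rule n0[unfolded ev2_def])
  define q where "q = fix_s a 1"
  have q01: "poly q 0 = poly q 1" using e1 e2 e3 by (simp add: q_def poly_fix_s)
  have root: "poly q z = 0 \<longleftrightarrow> z * t1 \<in> T" for z
  proof -
    have "poly q z = 0 \<longleftrightarrow> \<not> U Y 1 z" by (simp add: q_def poly_fix_s a)
    also have "U Y 1 z \<longleftrightarrow> img (\<lambda>j. poly (l j) (z * t1))"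
      by (rule img_cong) (simp add: Y Fx1, simp add: l_def algebra_simps)
    finally show ?thesis by (simp add: T_def)
  qed
  have "poly q 0 \<noteq> 0" using U0[of 1] a by (simp add: q_def poly_fix_s)
  then have "q \<noteq> 0" by auto
  have small_root: "cmod z < 1/2" if "poly q z = 0" for z
  proof -
    have "2 * (cmod z * cmod t1) < 1 * cmod t1" using small[of "z * t1"] root that by (simp add: norm_mult)
    then show ?thesis using \<open>t1 \<noteq> 0\<close> by (simp add: mult.assoc[symmetric])
  qed
  \<comment> \<open>The parameter 1 / t1 belongs to the missing point \<open>y0\<close>, so
    \<open>q\<close> is not constant.\<close>
  have "poly q (1 / t1) = 0" using root[of "1 / t1"] \<open>1 \<in> T\<close> \<open>t1 \<noteq> 0\<close> by simp
  have "degree q > 0"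
  proof (rule ccontr)
    assume "\<not> degree q > 0"
    then obtain c where "q = [:c:]" using degree_eq_zeroE[of q] by auto
    then show False using \<open>poly q (1 / t1) = 0\<close> \<open>q \<noteq> 0\<close> by simp
  qed
  then show False using poly_roots_near_0[OF \<open>q \<noteq> 0\<close> small_root] q01 by simp
qed

text \<open>On a line parallel to an axis the denominator has no zeros, by surjectivity, so the
  inverse is a polynomial there. The relation bounds its degree by the same \<open>D\<close> for all
  such lines, since they are surfaces of degree at most 1.\<close>

lemma inverse_polynomial_coordinate:
  assumes i: "i < n"
  shows "\<exists>d'. pd n d' (\<lambda>y. G y i)"
proof -
  from surface_algebraic[OF i] obtain D where D: "\<forall>Yp e. (\<forall>j<n. degree (Yp j) \<le> e) \<longrightarrow>
      (\<exists>K r. r K \<noteq> 0 \<and> (\<forall>k\<le>K. degree (r k) \<le> D * e) \<and>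
      (\<forall>s t. U Yp s t \<longrightarrow> (\<Sum>k\<le>K. ev2 (r k) s t * g Yp i s t ^ k) = 0))" by (rule exE)
  show ?thesis
  proof (rule separately_polynomial[where D = D])
    show "G x i = G y i" if "\<And>i. i < n \<Longrightarrow> x i = y i" for x y
      by (simp only: G_cong[of x y, OF that])
    fix x j assume j: "j < n"
    define Y where "Y k = const_coeffs (if k = j then [:0, 1:] else [:x k:])" for k
    have Y: "(\<lambda>k. ev2 (Y k) s t) = x(j := t)" for s t by (auto simp: Y_def ev2_const_coeffs)
    have "\<forall>k<n. degree (Y k) \<le> 1"
      unfolding Y_def by (intro allI impI order_trans[OF degree_const_coeffs]) simp
    from mp[OF spec[OF spec[OF D, of Y], of 1] this] obtain K r where r: "r K \<noteq> 0 \<and> (\<forall>k\<le>K. degree (r k) \<le> D * 1) \<and>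
      (\<forall>s t. U Y s t \<longrightarrow> (\<Sum>k\<le>K. ev2 (r k) s t * g Y i s t ^ k) = 0)"
      by (elim exE) (rule that)
    obtain s where s: "fix_s (r K) s \<noteq> 0"
      using ex_new_if_finite[OF infinite_UNIV_char_0 finite_fix_s_eq_0[of "r K"]] r by auto
    have "\<exists>a p. denominator Y a p \<and> (\<forall>s t. U Y s t \<longleftrightarrow> ev2 a s t \<noteq> 0)"
      by (rule surface_complement) (rule exI, rule surjective, rule exI, rule surjective)
    then obtain a p where ap: "denominator Y a p \<and> (\<forall>s t. U Y s t \<longleftrightarrow> ev2 a s t \<noteq> 0)"
      by (elim exE) (rule that)
    then have nz: "ev2 a s t \<noteq> 0" for t using surjective by simp
    have c: "ev2 a s t = ev2 a s 0" for t
      unfolding poly_fix_s[symmetric] by (rule no_roots_constant) (use nz in \<open>simp add: poly_fix_s\<close>)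
    define h where "h = smult (1 / ev2 a s 0) (fix_s (p i) s)"
    have h: "G (x(j := t)) i = poly h t" for t
    proof -
      have "ev2 a s 0 * g Y i s t = ev2 (p i) s t"
        using denominatorD[of Y a p i s t] ap i surjective c[of t] by simp
      then show ?thesis using nz[of 0] by (simp add: h_def poly_fix_s Y field_simps)
    qed
    have "degree h \<le> D"
    proof (rule polynomial_root_degree[of "\<lambda>k. fix_s (r k) s" K, OF s])
      show "degree (fix_s (r k) s) \<le> D" if "k \<le> K" for k
        using r that order_trans[OF degree_fix_s] by simp
      have "poly (\<Sum>k\<le>K. fix_s (r k) s * h ^ k) t = 0" for t
        using r surjective by (simp add: poly_sum poly_fix_s Y h)
      then show "(\<Sum>k\<le>K. fix_s (r k) s * h ^ k) = 0" by (intro iffD1[OF poly_all_0_iff_0] allI)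
    qed
    then show "\<exists>p. degree p \<le> D \<and> (\<forall>t. G (x(j := t)) i = poly p t)"
      using h by (intro exI[of _ h]) simp
  qed
qed

theorem polynomial_inverse:
  "\<exists>d' H. (\<forall>i<n. pd n d' (H i)) \<and>
    (\<forall>x. \<forall>i<n. H i (\<lambda>j. F j x) = x i \<and> F i (\<lambda>j. H j x) = x i)"
proof -
  have "\<forall>i\<in>{..<n}. \<exists>d'. pd n d' (\<lambda>y. G y i)" using inverse_polynomial_coordinate by simp
  then obtain e where e: "\<forall>i\<in>{..<n}. pd n (e i) (\<lambda>y. G y i)" by (rule bchoice[THEN exE])
  have "pd n (\<Sum>i<n. e i) (\<lambda>y. G y i)" if "i < n" for i
    by (rule pd_mono[of n "e i"]) (use e that in \<open>auto intro: member_le_sum\<close>)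
  moreover have "G (\<lambda>j. F j x) i = x i \<and> F i (\<lambda>j. G x j) = x i" if "i < n" for x i
    using G_eq[of x "\<lambda>j. F j x" i] F_G[OF surjective that] that by simp
  ultimately show ?thesis
    by (intro exI[of _ "\<Sum>i<n. e i"] exI[of _ "\<lambda>i y. G y i"]) simp
qed

end

section \<open>Reduction to cubic homogeneous maps\<close>

text \<open>Monomials are words in the variables: concatenation multiplies them and cutting a word
  factors them. Several words may name one monomial.\<close>

definition index_lists :: "nat \<Rightarrow> nat \<Rightarrow> nat list set" where
  "index_lists n d = {m. set m \<subseteq> {..<n} \<and> length m = d}"

definition list_monom :: "nat list \<Rightarrow> (nat \<Rightarrow> complex) \<Rightarrow> complex" where
  "list_monom m x = prod_list (map x m)"

definition form :: "nat \<Rightarrow> nat \<Rightarrow> ((nat \<Rightarrow> complex) \<Rightarrow> complex) \<Rightarrow> bool" where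
  "form n d f \<longleftrightarrow> (\<exists>c. \<forall>x. f x = (\<Sum>m\<in>index_lists n d. c m * list_monom m x))"

lemma finite_index_lists: "finite (index_lists n d)"
  using finite_lists_length_eq[of "{..<n}" d] by (simp add: index_lists_def)

lemma list_monom_append: "list_monom (m @ m') x = list_monom m x * list_monom m' x"
  by (simp add: list_monom_def)

lemma pd_list_monom: "m \<in> index_lists n d \<Longrightarrow> pd n d (list_monom m)"
  using pd_prod_list[of m n] by (simp add: index_lists_def list_monom_def[abs_def])

lemma form_pd: "form n d f \<Longrightarrow> pd n d f"
proof -
  assume "form n d f"
  then obtain c where "\<forall>x. f x = (\<Sum>m\<in>index_lists n d. c m * list_monom m x)" unfolding form_def by (rule exE)
  then have "f = (\<lambda>x. \<Sum>m\<in>index_lists n d. c m * list_monom m x)" by auto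
  then show ?thesis by (simp add: pd_sum pd_cmult pd_list_monom)
qed

lemma form_list_monom:
  assumes "m \<in> index_lists n d"
  shows "form n d (\<lambda>x. a * list_monom m x)"
  unfolding form_def
proof (intro exI[of _ "\<lambda>m'. if m' = m then a else 0"] allI)
  fix x
  have "(\<Sum>m'\<in>index_lists n d. (if m' = m then a else 0) * list_monom m' x) = (\<Sum>m'\<in>index_lists n d. if m' = m then a * list_monom m x else 0)"
    by (intro sum.cong) auto
  then show "a * list_monom m x = (\<Sum>m'\<in>index_lists n d. (if m' = m then a else 0) * list_monom m' x)"
    using assms by (simp add: finite_index_lists)
qed

lemma form_zero: "form n d (\<lambda>_. 0)"
  unfolding form_def by (rule exI[of _ "\<lambda>_. 0"]) simp

lemma form_add: "form n d f \<Longrightarrow> form n d g \<Longrightarrow> form n d (\<lambda>x. f x + g x)"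
proof -
  assume "form n d f" "form n d g"
  then obtain c c' where "\<forall>x. f x = (\<Sum>m\<in>index_lists n d. c m * list_monom m x)" "\<forall>x. g x = (\<Sum>m\<in>index_lists n d. c' m * list_monom m x)"
    unfolding form_def by (elim exE) (rule that)
  then show ?thesis unfolding form_def
    by (intro exI[of _ "\<lambda>m. c m + c' m"]) (simp add: distrib_right sum.distrib)
qed

lemma form_sum: "(\<And>k. k \<in> S \<Longrightarrow> form n d (f k)) \<Longrightarrow> form n d (\<lambda>x. \<Sum>k\<in>S. f k x)"
proof (induction S rule: infinite_finite_induct)
  case (insert k S)
  then show ?case by (simp add: form_add)
qed (auto intro: form_zero)

lemma form_mult:
  assumes "form n a f" "form n b g"
  shows "form n (a + b) (\<lambda>x. f x * g x)"
proof -
  obtain c c' where c: "\<forall>x. f x = (\<Sum>m\<in>index_lists n a. c m * list_monom m x)" "\<forall>x. g x = (\<Sum>m\<in>index_lists n b. c' m * list_monom m x)"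
    using assms unfolding form_def by (elim exE) (rule that)
  have "(\<lambda>x. f x * g x) = (\<lambda>x. \<Sum>m\<in>index_lists n a. \<Sum>m'\<in>index_lists n b. (c m * c' m') * list_monom (m @ m') x)"
    unfolding c(1)[rule_format] c(2)[rule_format] sum_product
    by (intro ext sum.cong refl) (simp add: list_monom_append)
  moreover have "form n (a + b) (\<lambda>x. \<Sum>m\<in>index_lists n a. \<Sum>m'\<in>index_lists n b. (c m * c' m') * list_monom (m @ m') x)"
    by (intro form_sum form_list_monom) (auto simp: index_lists_def)
  ultimately show ?thesis by simp
qed

lemma form_cmult: "form n d f \<Longrightarrow> form n d (\<lambda>x. a * f x)"
  using form_mult[of n 0 "\<lambda>x. a * list_monom [] x" d f] form_list_monom[of "[]" n 0 a] by (simp add: index_lists_def list_monom_def)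

lemma form_diff: "form n d f \<Longrightarrow> form n d g \<Longrightarrow> form n d (\<lambda>x. f x - g x)"
  using form_add[of n d f "\<lambda>x. (-1) * g x"] form_cmult[of n d g "-1"] by simp

lemma form_var: "i < n \<Longrightarrow> form n 1 (\<lambda>x. x i)"
  using form_list_monom[of "[i]" n 1 1] by (simp add: index_lists_def list_monom_def)

lemma form_dim_mono:
  assumes "form n d f" "n \<le> n'"
  shows "form n' d f"
proof -
  obtain c where c: "\<forall>x. f x = (\<Sum>m\<in>index_lists n d. c m * list_monom m x)"
    using assms(1) unfolding form_def by (rule exE)
  then have "f = (\<lambda>x. \<Sum>m\<in>index_lists n d. c m * list_monom m x)" by auto
  moreover have "form n' d (\<lambda>x. \<Sum>m\<in>index_lists n d. c m * list_monom m x)"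
    by (intro form_sum form_list_monom) (use assms(2) in \<open>auto simp: index_lists_def\<close>)
  ultimately show ?thesis by simp
qed

lemma form_homogeneous:
  assumes "form n d f"
  shows "f (\<lambda>i. t * x i) = t ^ d * f x"
proof -
  obtain c where c: "\<forall>x. f x = (\<Sum>m\<in>index_lists n d. c m * list_monom m x)"
    using assms unfolding form_def by (rule exE)
  have mh: "list_monom m (\<lambda>i. t * x i) = t ^ length m * list_monom m x" for m
    by (induction m) (simp_all add: list_monom_def mult_ac)
  show ?thesis unfolding c[rule_format] sum_distrib_left
    by (intro sum.cong refl) (simp add: mh index_lists_def)
qed

lemma pd_forms:
  assumes "pd n d f"
  shows "\<exists>h. (\<forall>e. form n e (h e)) \<and> (\<forall>x. f x = (\<Sum>e\<le>d. h e x))"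
proof -
  define nf where "nf d f \<longleftrightarrow> (\<exists>h. (\<forall>e. form n e (h e)) \<and> (\<forall>x. f x = (\<Sum>e\<le>d. h e x)))"
    for d and f :: "(nat \<Rightarrow> complex) \<Rightarrow> complex"
  have single: "nf d f" if "form n e f" "e \<le> d" for e d f
    unfolding nf_def
  proof (intro exI[of _ "\<lambda>e' x. if e' = e then f x else 0"] conjI allI)
    show "form n e' (\<lambda>x. if e' = e then f x else 0)" for e'
      using that(1) by (cases "e' = e") (auto intro: form_zero)
    show "f x = (\<Sum>e'\<le>d. if e' = e then f x else 0)" for x using that(2) by simp
  qed
  have add: "nf d (\<lambda>x. f x + g x)" if "nf d f" "nf d g" for d f g
  proof -
    from that(1)[unfolded nf_def] obtain h where
      h: "(\<forall>e. form n e (h e)) \<and> (\<forall>x. f x = (\<Sum>e\<le>d. h e x))" by (rule exE)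
    from that(2)[unfolded nf_def] obtain h' where
      h': "(\<forall>e. form n e (h' e)) \<and> (\<forall>x. g x = (\<Sum>e\<le>d. h' e x))" by (rule exE)
    show ?thesis using h h' unfolding nf_def
      by (intro exI[of _ "\<lambda>e x. h e x + h' e x"]) (simp add: form_add sum.distrib)
  qed
  have sum: "nf d (\<lambda>x. \<Sum>k\<in>S. f k x)" if "finite S" "\<And>k. k \<in> S \<Longrightarrow> nf d (f k)"
    for d and S :: "nat set" and f
    using that
  proof (induction rule: finite_induct)
    case empty
    then show ?case using single[OF form_zero, of 0 d] by simp
  next
    case (insert k S) then show ?case using add[of d "f k"] by simp
  qed
  have "nf d f" using assms
  proof (induction rule: pd.induct)
    case (pd_const d c)
    then show ?case using single[of 0 "\<lambda>x. c * list_monom [] x" d] form_list_monom[of "[]" n 0 c] by (simp add: index_lists_def list_monom_def)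
  next
    case (pd_var i d)
    then show ?case using single[OF form_var] by simp
  next
    case (pd_add d f g) then show ?case by (simp add: add)
  next
    case (pd_mult a f b g)
    from pd_mult.IH(1)[unfolded nf_def] obtain h where
      h: "(\<forall>e. form n e (h e)) \<and> (\<forall>x. f x = (\<Sum>e\<le>a. h e x))" by (rule exE)
    from pd_mult.IH(2)[unfolded nf_def] obtain h' where
      h': "(\<forall>e. form n e (h' e)) \<and> (\<forall>x. g x = (\<Sum>e\<le>b. h' e x))" by (rule exE)
    have "(\<lambda>x. f x * g x) = (\<lambda>x. \<Sum>i\<le>a. \<Sum>j\<le>b. h i x * h' j x)"
      using h h' by (simp add: sum_product)
    moreover have "nf (a + b) (\<lambda>x. \<Sum>i\<le>a. \<Sum>j\<le>b. h i x * h' j x)"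
    proof (intro sum)
      fix i j assume "i \<in> {..a}" "j \<in> {..b}"
      then show "nf (a + b) (\<lambda>x. h i x * h' j x)" using h h' by (intro single[of "i + j"] form_mult) auto
    qed auto
    ultimately show ?case by simp
  next
    case (pd_mono a f b)
    from pd_mono.IH[unfolded nf_def] obtain h where
      h: "(\<forall>e. form n e (h e)) \<and> (\<forall>x. f x = (\<Sum>e\<le>a. h e x))" by (rule exE)
    then have "f = (\<lambda>x. \<Sum>e\<le>a. h e x)" by auto
    moreover have "nf b (\<lambda>x. \<Sum>e\<le>a. h e x)"
      by (rule sum) (use h pd_mono.hyps in \<open>auto intro: single\<close>)
    ultimately show ?case by simp
  qed
  then show ?thesis by (simp only: nf_def)
qed

section \<open>Counterexamples, lowering of the degree and homogenisation\<close>

lemma pd_dd: "pd n d f \<Longrightarrow> \<exists>l. dd f x v l"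
  using pd_grad[of n d f x] by auto

lemma kellerD:
  assumes "keller n F" "\<And>i. i < n \<Longrightarrow> dd (F i) x v 0" "i < n"
  shows "v i = 0"
  using assms(1)[unfolded keller_def, THEN spec, THEN spec, THEN mp, of x v] assms(2,3) by simp

lemma dd_constant_direction:
  assumes "pd n d f" "\<And>i. i < n \<Longrightarrow> v i = 0"
  shows "dd f x v 0"
proof -
  have "f (\<lambda>i. x i + t * v i) = f x" for t
    by (rule pd_cong[OF assms(1)]) (simp add: assms(2))
  then show ?thesis by (simp add: dd_def)
qed

text \<open>By \<open>polynomial_inverse\<close> every Keller map without polynomial inverse is
  noninjective, and noninjectivity is easy to carry into other dimensions.\<close>

definition counterexample :: "nat \<Rightarrow> nat \<Rightarrow> (nat \<Rightarrow> (nat \<Rightarrow> complex) \<Rightarrow> complex) \<Rightarrow> bool" where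
  "counterexample n d F \<longleftrightarrow> (\<forall>i<n. pd n d (F i)) \<and> keller n F \<and> noninj n F"

text \<open>A top-degree monomial \<open>p q\<close> is replaced by \<open>p q - (y + p) (z + q)\<close> with new variables \<open>y\<close>, \<open>z\<close>, and the
  factors \<open>y + p\<close>, \<open>z + q\<close> become new coordinates of the map.\<close>

lemma degree_reduction_step:
  assumes ce: "counterexample n (Suc d) F" and d: "3 \<le> d"
  shows "\<exists>n' F'. counterexample n' d F'"
proof -
  have F: "pd n (Suc d) (F i)" if "i < n" for i using ce that by (simp add: counterexample_def)
  have "\<forall>i\<in>{..<n}. \<exists>h. (\<forall>e. form n e (h e)) \<and> (\<forall>x. F i x = (\<Sum>e\<le>Suc d. h e x))"
    using pd_forms[OF F] by simp
  then obtain h where h: "\<forall>i\<in>{..<n}. (\<forall>e. form n e (h i e)) \<and> (\<forall>x. F i x = (\<Sum>e\<le>Suc d. h i e x))"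
    by (rule bchoice[THEN exE])
  then have "\<forall>i\<in>{..<n}. \<exists>c. \<forall>x. h i (Suc d) x = (\<Sum>m\<in>index_lists n (Suc d). c m * list_monom m x)"
    unfolding form_def by simp
  then obtain c where c: "\<forall>i\<in>{..<n}. \<forall>x. h i (Suc d) x = (\<Sum>m\<in>index_lists n (Suc d). c i m * list_monom m x)"
    by (rule bchoice[THEN exE])
  define N where "N = card (index_lists n (Suc d))"
  obtain b where b: "bij_betw b {..<N} (index_lists n (Suc d))"
    using ex_bij_betw_nat_finite[OF finite_index_lists[of n "Suc d"]] unfolding N_def atLeast0LessThan by (rule exE)
  \<comment> \<open>Each monomial is cut in the middle. As 3 <= d, both halves have degree at most d
    - 1, so a half times one new variable has degree at most d; for d = 2 the longer half, of degree
    2, would break this.\<close>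
  define p where "p k = list_monom (take (Suc d div 2) (b k))" for k
  define q where "q k = list_monom (drop (Suc d div 2) (b k))" for k
  have bM: "b k \<in> index_lists n (Suc d)" if "k < N" for k using bij_betwE[OF b] that by simp
  have pp: "pd n (Suc d div 2) (p k)" and pq: "pd n (Suc d - Suc d div 2) (q k)" if "k < N" for k
    unfolding p_def q_def using bM[OF that] set_take_subset[of _ "b k"] set_drop_subset[of _ "b k"]
    by (intro pd_list_monom; force simp: index_lists_def)+
  have ppq: "p k x * q k x = list_monom (b k) x" for k x
    unfolding p_def q_def by (simp flip: list_monom_append)
  define g where "g i x = (\<Sum>e\<le>d. h i e x)" for i x
  have Fg: "F i x = g i x + (\<Sum>k<N. c i (b k) * (p k x * q k x))" if "i < n" for i x
  proof -
    have "F i x = g i x + h i (Suc d) x" using h that by (simp add: g_def)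
    also have "h i (Suc d) x = (\<Sum>k<N. c i (b k) * list_monom (b k) x)"
      using c that sum.reindex_bij_betw[OF b, of "\<lambda>m. c i m * list_monom m x"] by simp
    finally show ?thesis by (simp add: ppq)
  qed
  have pg: "pd n d (g i)" if "i < n" for i
    unfolding g_def[abs_def] using h that by (intro pd_sum) (auto intro: pd_mono[OF form_pd])
  define n' where "n' = n + N + N"
  define P where "P k x = x (n + k) + p k x" for k and x :: "nat \<Rightarrow> complex"
  define Q where "Q k x = x (n + N + k) + q k x" for k and x :: "nat \<Rightarrow> complex"
  define F' where "F' i = (if i < n then (\<lambda>x. F i x - (\<Sum>k<N. c i (b k) * (P k x * Q k x)))
    else if i < n + N then P (i - n) else Q (i - n - N))" for i
  have nn: "n \<le> n'" by (simp add: n'_def)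
  have lift: "pd n' e f" if "pd n a f" "a \<le> e" for a e f
    by (rule pd_mono[OF pd_dim_mono[OF that(1) nn] that(2)])
  have var: "pd n' 1 (\<lambda>x. x j)" if "j < n'" for j using pd_var[OF that, of 0] by simp
  have pd': "pd n' d (F' i)" if "i < n'" for i
  proof -
    consider "i < n" | "n \<le> i" "i < n + N" | "n + N \<le> i" by linarith
    then show ?thesis
    proof cases
      case 1
      \<comment> \<open>The term \<open>p k x * q k x\<close> of \<open>F\<close> cancels against
        the one in the product of \<open>P k x\<close> and \<open>Q k x\<close>.\<close>
      have "F' i = (\<lambda>x. g i x - (\<Sum>k<N. c i (b k) * ((x (n + k) * q k x + p k x * x (n + N + k))
          + x (n + k) * x (n + N + k))))"
        using 1 by (intro ext)
          (simp add: F'_def Fg P_def Q_def algebra_simps sum.distrib)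
      moreover have "pd n' d (\<lambda>x. g i x - (\<Sum>k<N. c i (b k) * ((x (n + k) * q k x + p k x * x (n + N + k))
          + x (n + k) * x (n + N + k))))"
      proof (intro pd_diff pd_sum pd_cmult pd_add)
        show "pd n' d (g i)" by (rule lift[OF pg[OF 1]]) simp
        fix k assume "k \<in> {..<N}"
        then have k: "k < N" by simp
        show "pd n' d (\<lambda>x. x (n + k) * q k x)"
          by (rule pd_mult'[OF var lift[OF pq[OF k]]]) (use k d in \<open>auto simp: n'_def\<close>)
        show "pd n' d (\<lambda>x. p k x * x (n + N + k))"
          by (rule pd_mult'[OF lift[OF pp[OF k]] var]) (use k d in \<open>auto simp: n'_def\<close>)
        show "pd n' d (\<lambda>x. x (n + k) * x (n + N + k))"
          by (rule pd_mult'[OF var var]) (use k d in \<open>auto simp: n'_def\<close>)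
      qed
      ultimately show ?thesis by simp
    next
      case 2
      then have k: "i - n < N" by simp
      have "pd n' d (\<lambda>x. x (n + (i - n)) + p (i - n) x)"
        using d 2 by (intro pd_add pd_mono[OF var] lift[OF pp[OF k]]) (auto simp: n'_def)
      then show ?thesis using 2 by (simp add: F'_def P_def[abs_def])
    next
      case 3
      then have k: "i - n - N < N" using that by (simp add: n'_def)
      have "pd n' d (\<lambda>x. x (n + N + (i - n - N)) + q (i - n - N) x)"
        using d k by (intro pd_add pd_mono[OF var] lift[OF pq[OF k]]) (auto simp: n'_def)
      then show ?thesis using 3 by (simp add: F'_def Q_def[abs_def])
    qed
  qed
  have kel: "keller n F" using ce by (simp add: counterexample_def)
  have "keller n' F'"
    unfolding keller_def
  proof (intro allI impI)
    fix x v i assume z: "\<forall>i<n'. dd (F' i) x v 0" and "i < n'"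
    have zP: "dd (P k) x v 0" and zQ: "dd (Q k) x v 0" if "k < N" for k
      using z[rule_format, of "n + k"] z[rule_format, of "n + N + k"] that by (simp_all add: F'_def n'_def)
    have "dd (F j) x v 0" if j: "j < n" for j
    proof -
      have "dd (\<lambda>x. F' j x + (\<Sum>k<N. c j (b k) * (P k x * Q k x))) x v (0 + (\<Sum>k<N. c j (b k) * (0 * Q k x + P k x * 0)))"
        by (intro dd_add dd_sum dd_cmult dd_mult zP zQ z[rule_format]) (use j in \<open>auto simp: n'_def\<close>)
      moreover have "(\<lambda>x. F' j x + (\<Sum>k<N. c j (b k) * (P k x * Q k x))) = F j"
        using j by (simp add: F'_def)
      ultimately show ?thesis by simp
    qed
    then have v0: "v j = 0" if "j < n" for j by (rule kellerD[OF kel _ that])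
    have vP: "v (n + k) = 0" if "k < N" for k
    proof -
      have "dd (\<lambda>x. P k x - p k x) x v (0 - 0)"
        by (intro dd_diff zP[OF that] dd_constant_direction[OF pp[OF that] v0])
      then have "dd (\<lambda>x. x (n + k)) x v 0" by (simp add: P_def)
      from dd_unique[OF this dd_var] show ?thesis by simp
    qed
    have vQ: "v (n + N + k) = 0" if "k < N" for k
    proof -
      have "dd (\<lambda>x. Q k x - q k x) x v (0 - 0)"
        by (intro dd_diff zQ[OF that] dd_constant_direction[OF pq[OF that] v0])
      then have "dd (\<lambda>x. x (n + N + k)) x v 0" by (simp add: Q_def)
      from dd_unique[OF this dd_var] show ?thesis by simp
    qed
    show "v i = 0"
      using v0[of i] vP[of "i - n"] vQ[of "i - n - N"] \<open>i < n'\<close>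
      by (cases "i < n"; cases "i < n + N") (auto simp: n'_def)
  qed
  moreover have "noninj n' F'"
  proof -
    have "noninj n F" using ce by (simp add: counterexample_def)
    then obtain a a' where a: "(\<forall>i<n. F i a = F i a') \<and> (\<exists>i<n. a i \<noteq> a' i)"
      unfolding noninj_def by (elim exE) (rule that)
    \<comment> \<open>Points are lifted to the locus where all \<open>P\<close> and \<open>Q\<close>
      vanish; there the first n components of \<open>F'\<close> are those of
      \<open>F\<close>.\<close>
    define e where "e u i = (if i < n then u i else if i < n + N then - p (i - n) u else - q (i - n - N) u)"
      for u :: "nat \<Rightarrow> complex" and i
    have Pe: "P k (e u) = 0" and Qe: "Q k (e u) = 0" if "k < N" for k u
      using that pd_cong[OF pp[OF that], of "e u" u] pd_cong[OF pq[OF that], of "e u" u]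
      by (simp_all add: P_def Q_def e_def)
    have Fe: "F' i (e u) = (if i < n then F i u else 0)" if "i < n'" for i u
    proof -
      have "F i (e u) = F i u" if "i < n" by (rule pd_cong[OF F[OF that]]) (simp add: e_def)
      then show ?thesis using that Pe[of "i - n" u] Qe[of "i - n - N" u] by (auto simp: F'_def Pe Qe n'_def)
    qed
    show ?thesis unfolding noninj_def
    proof (rule exI[of _ "e a"], rule exI[of _ "e a'"], intro conjI allI impI)
      show "F' i (e a) = F' i (e a')" if "i < n'" for i using a that by (simp add: Fe)
      from a obtain i where "i < n" "a i \<noteq> a' i" by auto
      then show "\<exists>i<n'. e a i \<noteq> e a' i" by (intro exI[of _ i]) (simp add: e_def n'_def)
    qed
  qed
  ultimately have "counterexample n' d F'" using pd' by (simp add: counterexample_def)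
  then show ?thesis by (intro exI[of _ n'] exI[of _ F'])
qed

lemma degree_reduction:
  "counterexample n d F \<Longrightarrow> \<exists>n' F'. counterexample n' 3 F'"
proof (induction d arbitrary: n F)
  case 0
  then have "counterexample n 3 F" by (auto simp: counterexample_def intro: pd_mono)
  then show ?case by (intro exI[of _ n] exI[of _ F])
next
  case (Suc d)
  show ?case
  proof (cases "3 \<le> d")
    case True
    from degree_reduction_step[OF Suc.prems True] show ?thesis by (elim exE) (rule Suc.IH)
  next
    case False
    then have "counterexample n 3 F" using Suc.prems by (auto simp: counterexample_def intro: pd_mono)
    then show ?thesis by (intro exI[of _ n] exI[of _ F])
  qed
qed

lemma inverse_vanish:
  fixes l :: "nat \<Rightarrow> complex"
  assumes "\<And>i j. i < n \<Longrightarrow> j < n \<Longrightarrow> (\<Sum>k<n. M i k * K k j) = (if i = j then 1 else 0)"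
    and "\<And>i. i < n \<Longrightarrow> (\<Sum>j<n. K i j * l j) = 0" and i: "i < n"
  shows "l i = 0"
proof -
  have "(\<Sum>k<n. M i k * (\<Sum>j<n. K k j * l j)) = (\<Sum>j<n. (\<Sum>k<n. M i k * K k j) * l j)"
    unfolding sum_distrib_left sum_distrib_right by (subst sum.swap) (simp only: mult.assoc)
  also have "\<dots> = (\<Sum>j<n. if j = i then l j else 0)"
    by (intro sum.cong refl) (use i in \<open>auto simp: assms(1)\<close>)
  also have "\<dots> = l i" using i by simp
  finally have "l i = (\<Sum>k<n. M i k * (\<Sum>j<n. K k j * l j))" by (rule sym)
  also have "\<dots> = 0" by (rule sum.neutral) (simp add: assms(2))
  finally show ?thesis .
qed

text \<open>\<open>F\<close> is shifted by F(0) and multiplied from the left by the inverse of its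
  Jacobian at 0; affine bijections of the target change neither kernels nor fibres.\<close>

lemma normalisation:
  assumes ce: "counterexample n d F"
  shows "\<exists>f. counterexample n d f \<and> (\<forall>i<n. f i (\<lambda>_. 0) = 0) \<and> (\<forall>i<n. \<forall>v. dd (f i) (\<lambda>_. 0) v (v i))"
proof -
  have F: "pd n d (F i)" if "i < n" for i using ce that by (simp add: counterexample_def)
  have kel: "keller n F" using ce by (simp add: counterexample_def)
  have ni: "noninj n F" using ce by (simp add: counterexample_def)
  have "\<forall>i\<in>{..<n}. \<exists>g. \<forall>v. dd (F i) (\<lambda>_. 0) v (\<Sum>j<n. g j * v j)"
    using pd_grad[OF F] by simp
  then obtain M where M: "\<forall>i\<in>{..<n}. \<forall>v. dd (F i) (\<lambda>_. 0) v (\<Sum>j<n. M i j * v j)"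
    by (rule bchoice[THEN exE])
  have ker: "v i = 0" if v: "\<And>i. i < n \<Longrightarrow> (\<Sum>j<n. M i j * v j) = 0" and i: "i < n" for v i
  proof (rule kellerD[OF kel _ i])
    show "dd (F j) (\<lambda>_. 0) v 0" if j: "j < n" for j
    proof -
      have "dd (F j) (\<lambda>_. 0) v (\<Sum>k<n. M j k * v k)" using M j by simp
      then show ?thesis by (simp only: v[OF j])
    qed
  qed
  have "\<exists>K. (\<forall>i<n. \<forall>j<n. (\<Sum>k<n. K i k * M k j) = (if i = j then 1 else 0)) \<and>
             (\<forall>i<n. \<forall>j<n. (\<Sum>k<n. M i k * K k j) = (if i = j then 1 else 0))"
    by (rule left_right_inverse) (rule ker)
  then obtain K where K: "(\<forall>i<n. \<forall>j<n. (\<Sum>k<n. K i k * M k j) = (if i = j then 1 else 0)) \<and>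
             (\<forall>i<n. \<forall>j<n. (\<Sum>k<n. M i k * K k j) = (if i = j then 1 else 0))"
    by (rule exE)
  have MK: "(\<Sum>k<n. M i k * K k j) = (if i = j then 1 else 0)" if "i < n" "j < n" for i j using K that by simp
  define f where "f i x = (\<Sum>j<n. K i j * (F j x - F j (\<lambda>_. 0)))" for i x
  have pf: "pd n d (f i)" for i
    unfolding f_def by (intro pd_sum pd_cmult pd_diff F pd_const) auto
  have "keller n f"
    unfolding keller_def
  proof (intro allI impI)
    fix x v i assume z: "\<forall>i<n. dd (f i) x v 0" and i: "i < n"
    have "\<forall>j\<in>{..<n}. \<exists>l. dd (F j) x v l" using pd_dd[OF F] by simp
    then obtain l where l: "\<forall>j\<in>{..<n}. dd (F j) x v (l j)" by (rule bchoice[THEN exE])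
    have fl: "dd (f i) x v (\<Sum>j<n. K i j * (l j - 0))" for i
      unfolding f_def by (intro dd_sum dd_cmult dd_diff dd_const) (use l in auto)
    have Kl: "(\<Sum>j<n. K i j * l j) = 0" if "i < n" for i
      using dd_unique[OF fl z[rule_format, OF that]] by simp
    have l0: "l j = 0" if "j < n" for j by (rule inverse_vanish[OF MK Kl that])
    show "v i = 0"
    proof (rule kellerD[OF kel _ i])
      fix j assume j: "j < n"
      then have "dd (F j) x v (l j)" using l by simp
      then show "dd (F j) x v 0" by (simp only: l0[OF j])
    qed
  qed
  moreover have "noninj n f"
  proof -
    obtain a b where ab: "(\<forall>i<n. F i a = F i b) \<and> (\<exists>i<n. a i \<noteq> b i)"
      using ni unfolding noninj_def by (elim exE) (rule that)
    show ?thesis unfolding noninj_def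
      by (rule exI[of _ a], rule exI[of _ b]) (use ab in \<open>simp add: f_def\<close>)
  qed
  moreover have "dd (f i) (\<lambda>_. 0) v (v i)" if i: "i < n" for i v
  proof -
    have "dd (f i) (\<lambda>_. 0) v (\<Sum>k<n. K i k * ((\<Sum>j<n. M k j * v j) - 0))"
      unfolding f_def by (intro dd_sum dd_cmult dd_diff dd_const) (use M in auto)
    moreover have "(\<Sum>k<n. K i k * ((\<Sum>j<n. M k j * v j) - 0)) = (\<Sum>j<n. (\<Sum>k<n. K i k * M k j) * v j)"
      unfolding diff_0_right sum_distrib_left sum_distrib_right by (subst sum.swap) (simp only: mult.assoc)
    moreover have "\<dots> = (\<Sum>j<n. if j = i then v j else 0)"
      by (intro sum.cong refl) (use i K in auto)
    ultimately show ?thesis using i by simp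
  qed
  ultimately have "counterexample n d f \<and> (\<forall>i<n. f i (\<lambda>_. 0) = 0) \<and> (\<forall>i<n. \<forall>v. dd (f i) (\<lambda>_. 0) v (v i))"
    using pf by (simp add: counterexample_def f_def[of _ "\<lambda>_. 0"])
  then show ?thesis by (rule exI[of _ f])
qed

lemma cubic_normal_form:
  assumes pf: "pd n 3 f" and f0: "f (\<lambda>_. 0) = 0" and df: "\<And>v. dd f (\<lambda>_. 0) v (v i)"
  shows "\<exists>Q K. form n 2 Q \<and> form n 3 K \<and> (\<forall>x. f x = x i + Q x + K x)"
proof -
  obtain h where h: "(\<forall>e. form n e (h e)) \<and> (\<forall>x. f x = (\<Sum>e\<le>3. h e x))"
    using pd_forms[OF pf] by (rule exE)
  have fx: "f x = h 0 x + h 1 x + h 2 x + h 3 x" for x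
    using h by (simp add: eval_nat_numeral)
  have hom: "h e (\<lambda>i. t * x i) = t ^ e * h e x" for e t x
    using h by (intro form_homogeneous) auto
  have z: "h e (\<lambda>_. 0) = 0 ^ e * h e x" for e x using hom[of e 0 x] by simp
  have "h 0 x = h 0 (\<lambda>_. 0)" for x using z[of 0 x] by simp
  moreover have "h 0 (\<lambda>_. 0) = 0" using fx[of "\<lambda>_. 0"] f0 z[of 1 "\<lambda>_. 0"] z[of 2 "\<lambda>_. 0"] z[of 3 "\<lambda>_. 0"] by simp
  ultimately have h0: "h 0 x = 0" for x by simp
  have h1: "h 1 v = v i" for v
  proof -
    have "f (\<lambda>i. 0 + t * v i) = t * h 1 v + t ^ 2 * h 2 v + t ^ 3 * h 3 v" for t
      using hom[of _ t v] by (simp add: fx h0)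
    then have "dd f (\<lambda>_. 0) v (h 1 v)"
      unfolding dd_def by (auto intro!: derivative_eq_intros)
    from dd_unique[OF this df] show ?thesis .
  qed
  show ?thesis
    by (rule exI[of _ "h 2"], rule exI[of _ "h 3"]) (use h fx h0 h1 in simp)
qed

text \<open>The homogeneous map is \<open>(x, y, t) \<mapsto> (x + t Q(x) - t\<^sup>2 y, y + K(x), t)\<close>: eliminating \<open>y\<close> leaves
  \<open>x + t Q(x) + t\<^sup>2 K(x)\<close>, which is \<open>f\<close> rescaled by \<open>t\<close>.\<close>

lemma homogenisation:
  assumes ce: "counterexample n 3 f"
    and Q: "\<And>i. i < n \<Longrightarrow> form n 2 (Q i)" and K: "\<And>i. i < n \<Longrightarrow> form n 3 (K i)"
    and f: "\<And>i x. i < n \<Longrightarrow> f i x = x i + Q i x + K i x"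
  shows "\<exists>n' H. (\<forall>i<n'. form n' 3 (H i)) \<and> keller n' (\<lambda>i x. x i + H i x) \<and> noninj n' (\<lambda>i x. x i + H i x)"
proof -
  define n' where "n' = Suc (2 * n)"
  \<comment> \<open>Coordinates below n are x, those from n to 2 n - 1 are y, and coordinate 2 n is
    t.\<close>
  define H where "H i = (if i < n then (\<lambda>x. x (2 * n) * Q i x - x (2 * n) * (x (2 * n) * x (n + i)))
    else if i < 2 * n then K (i - n) else (\<lambda>_. 0))" for i
  have kel: "keller n f" and ni: "noninj n f" using ce by (simp_all add: counterexample_def)
  have pQ: "pd n 2 (Q i)" and pK: "pd n 3 (K i)" if "i < n" for i
    using form_pd Q[OF that] K[OF that] by simp_all
  have "form n' 3 (H i)" if i: "i < n'" for i
  proof -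
    have "form n' (1 + 2) (\<lambda>x. x (2 * n) * Q i x)" if "i < n"
      by (intro form_mult form_var form_dim_mono[OF Q[OF that]]) (auto simp: n'_def)
    moreover have "form n' (1 + (1 + 1)) (\<lambda>x. x (2 * n) * (x (2 * n) * x (n + i)))" if "i < n"
      by (intro form_mult form_var) (use that in \<open>auto simp: n'_def\<close>)
    moreover have "form n' 3 (K (i - n))" if "n \<le> i" "i < 2 * n"
      by (rule form_dim_mono[OF K]) (use that in \<open>auto simp: n'_def\<close>)
    ultimately show ?thesis
      by (auto simp: H_def numeral_3_eq_3 intro!: form_diff form_zero)
  qed
  moreover have "keller n' (\<lambda>i x. x i + H i x)"
    unfolding keller_def
  proof (intro allI impI)
    fix x v i assume z: "\<forall>i<n'. dd (\<lambda>x. x i + H i x) x v 0" and i: "i < n'"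
    define T where "T = x (2 * n)"
    have \<tau>: "v (2 * n) = 0"
    proof -
      have "dd (\<lambda>x. x (2 * n)) x v 0" using z[rule_format, of "2 * n"] by (simp add: H_def n'_def)
      from dd_unique[OF this dd_var] show ?thesis by simp
    qed
    have "\<forall>i\<in>{..<n}. \<exists>l. dd (Q i) x v l" "\<forall>i\<in>{..<n}. \<exists>l. dd (K i) x v l"
      using pd_dd[OF pQ] pd_dd[OF pK] by simp_all
    then obtain q k where q: "\<forall>i\<in>{..<n}. dd (Q i) x v (q i)" and k: "\<forall>i\<in>{..<n}. dd (K i) x v (k i)"
      by (elim bchoice[THEN exE]) (rule that)
    have y: "v (n + i) = - k i" if "i < n" for i
    proof -
      have "dd (\<lambda>x. x (n + i) + K i x) x v 0" using z[rule_format, of "n + i"] that by (simp add: H_def n'_def)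
      moreover have "dd (\<lambda>x. x (n + i) + K i x) x v (v (n + i) + k i)"
        by (intro dd_add dd_var) (use k that in simp)
      ultimately have "0 = v (n + i) + k i" by (rule dd_unique)
      then show ?thesis by (simp add: eq_neg_iff_add_eq_0)
    qed
    have e: "v i + T * q i + T ^ 2 * k i = 0" if i: "i < n" for i
    proof -
      have "dd (\<lambda>x. x i + (x (2 * n) * Q i x - x (2 * n) * (x (2 * n) * x (n + i)))) x v
        (v i + ((v (2 * n) * Q i x + x (2 * n) * q i)
           - (v (2 * n) * (x (2 * n) * x (n + i)) + x (2 * n) * (v (2 * n) * x (n + i) + x (2 * n) * v (n + i)))))"
        by (intro dd_add dd_diff dd_mult dd_var) (use q i in auto)
      moreover have "dd (\<lambda>x. x i + (x (2 * n) * Q i x - x (2 * n) * (x (2 * n) * x (n + i)))) x v 0"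
        using z[rule_format, of i] i by (simp add: H_def n'_def)
      ultimately have "(v i + ((v (2 * n) * Q i x + x (2 * n) * q i)
           - (v (2 * n) * (x (2 * n) * x (n + i)) + x (2 * n) * (v (2 * n) * x (n + i) + x (2 * n) * v (n + i))))) = 0"
        by (rule dd_unique)
      then show ?thesis unfolding \<tau> y[OF i] T_def power2_eq_square by (simp add: algebra_simps)
    qed
    have v0: "v i = 0" if i: "i < n" for i
    proof (cases "T = 0")
      case True
      then show ?thesis using e[OF i] by simp
    next
      case False
      have "T * v i = 0"
      \<comment> \<open>T v is a kernel vector of \<open>f\<close> at T x, since f(T u) = T (u + T
        Q(u) + T^2 K(u)).\<close>
      proof (rule kellerD[OF kel _ i, where v = "\<lambda>j. T * v j" and x = "\<lambda>j. T * x j"])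
        fix j assume j: "j < n"
        have "f j (\<lambda>l. T * u l) = T * (u j + T * Q j u + T ^ 2 * K j u)" for u
          using form_homogeneous[OF Q[OF j], of T u] form_homogeneous[OF K[OF j], of T u]
          by (simp add: f[OF j] power2_eq_square power3_eq_cube algebra_simps)
        moreover have "dd (\<lambda>u. T * (u j + T * Q j u + T ^ 2 * K j u)) x v (T * (v j + T * q j + T ^ 2 * k j))"
          by (intro dd_cmult dd_add dd_var) (use q k j in auto)
        ultimately have "dd (\<lambda>u. f j (\<lambda>l. T * u l)) x v 0" using e[OF j] by simp
        then show "dd (f j) (\<lambda>j. T * x j) (\<lambda>j. T * v j) 0"
          unfolding dd_def by (simp add: algebra_simps)
      qed
      then show ?thesis using False by simp
    qed
    have k0: "k j = 0" if "j < n" for j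
    proof -
      have "dd (K j) x v 0" by (rule dd_constant_direction[OF pK[OF that]]) (rule v0)
      moreover have "dd (K j) x v (k j)" using k that by simp
      ultimately show ?thesis by (rule dd_unique[symmetric])
    qed
    consider "i < n" | "n \<le> i" "i < 2 * n" | "i = 2 * n" using i by (fastforce simp: n'_def)
    then show "v i = 0"
    proof cases
      case 2
      then have j: "i - n < n" "n + (i - n) = i" by auto
      from y[OF j(1)] k0[OF j(1)] show ?thesis unfolding j(2) by simp
    qed (use v0 \<tau> in auto)
  qed
  moreover have "noninj n' (\<lambda>i x. x i + H i x)"
  proof -
    obtain a b where ab: "(\<forall>i<n. f i a = f i b) \<and> (\<exists>i<n. a i \<noteq> b i)"
      using ni unfolding noninj_def by (elim exE) (rule that)
    \<comment> \<open>On the slice t = 1, y = - K(x) the homogeneous map reproduces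
      \<open>f\<close>.\<close>
    define e where "e u i = (if i < n then u i else if i < 2 * n then - K (i - n) u else 1)"
      for u :: "nat \<Rightarrow> complex" and i
    have Ke: "K i (e u) = K i u" and Qe: "Q i (e u) = Q i u" if "i < n" for i u
      by (rule pd_cong[OF pK[OF that]] pd_cong[OF pQ[OF that]], simp add: e_def)+
    have He: "e u i + H i (e u) = (if i < n then f i u else if i < 2 * n then 0 else 1)" for i u
      using Ke[of i u] Qe[of i u] Ke[of "i - n" u] f[of i u] by (auto simp: H_def e_def)
    show ?thesis unfolding noninj_def
    proof (rule exI[of _ "e a"], rule exI[of _ "e b"], intro conjI allI impI)
      show "e a i + H i (e a) = e b i + H i (e b)" for i using ab by (simp add: He)
      from ab obtain i where "i < n" "a i \<noteq> b i" by auto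
      then show "\<exists>i<n'. e a i \<noteq> e b i" by (intro exI[of _ i]) (simp add: e_def n'_def)
    qed
  qed
  ultimately show ?thesis by (intro exI[of _ n'] exI[of _ H]) simp
qed

lemma cubic_homogeneous_counterexample:
  assumes "counterexample n d F"
  shows "\<exists>n' H. (\<forall>i<n'. form n' 3 (H i)) \<and> keller n' (\<lambda>i x. x i + H i x) \<and> noninj n' (\<lambda>i x. x i + H i x)"
proof -
  obtain m F1 where "counterexample m 3 F1" using degree_reduction[OF assms] by (elim exE) (rule that)
  from normalisation[OF this] obtain f where
    f: "counterexample m 3 f \<and> (\<forall>i<m. f i (\<lambda>_. 0) = 0) \<and> (\<forall>i<m. \<forall>v. dd (f i) (\<lambda>_. 0) v (v i))" by (rule exE)
  have "\<forall>i\<in>{..<m}. \<exists>QK. form m 2 (fst QK) \<and> form m 3 (snd QK) \<and> (\<forall>x. f i x = x i + fst QK x + snd QK x)"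
  proof
    fix i assume "i \<in> {..<m}"
    then obtain Q K where "form m 2 Q \<and> form m 3 K \<and> (\<forall>x. f i x = x i + Q x + K x)"
      using cubic_normal_form[of m "f i" i] f by (auto simp: counterexample_def)
    then show "\<exists>QK. form m 2 (fst QK) \<and> form m 3 (snd QK) \<and> (\<forall>x. f i x = x i + fst QK x + snd QK x)"
      by (intro exI[of _ "(Q, K)"]) simp
  qed
  then obtain QK where QK: "\<forall>i\<in>{..<m}. form m 2 (fst (QK i)) \<and> form m 3 (snd (QK i)) \<and>
      (\<forall>x. f i x = x i + fst (QK i) x + snd (QK i) x)" by (rule bchoice[THEN exE])
  show ?thesis
    by (rule homogenisation[of m f "\<lambda>i. fst (QK i)" "\<lambda>i. snd (QK i)"]) (use f QK in auto)
qed

section \<open>Reduction to Druzkowski maps\<close>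

lemma dd_power3: "dd f x v l \<Longrightarrow> dd (\<lambda>x. f x ^ 3) x v (3 * f x ^ 2 * l)"
  unfolding dd_def by (auto intro!: derivative_eq_intros)

definition lin :: "nat \<Rightarrow> ('j \<Rightarrow> nat \<Rightarrow> complex) \<Rightarrow> 'j \<Rightarrow> (nat \<Rightarrow> complex) \<Rightarrow> complex" where
  "lin n B j x = (\<Sum>l<n. B j l * x l)"

text \<open>The index type is arbitrary: the cubes keep descriptive indices until
  \<open>normalised_druzkowski\<close> numbers them.\<close>

definition prodmat :: "nat \<Rightarrow> ('j \<Rightarrow> nat \<Rightarrow> complex) \<Rightarrow> (nat \<Rightarrow> 'j \<Rightarrow> complex) \<Rightarrow> 'j \<Rightarrow> 'j \<Rightarrow> complex" where
  "prodmat n B C j k = (\<Sum>l<n. B j l * C l k)"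

lemma prodmat_apply: "(\<Sum>k\<in>J. prodmat n B C j k * X k) = lin n B j (\<lambda>l. \<Sum>k\<in>J. C l k * X k)"
  unfolding prodmat_def lin_def sum_distrib_left sum_distrib_right
  by (subst sum.swap) (simp only: mult.assoc)

text \<open>The Gorni--Zampieri pairing: \<open>x + C(Bx)\<^sup>3\<close> and \<open>X + ((BC)X)\<^sup>3\<close> are intertwined by \<open>C\<close>, so the
  kernel of the Jacobian and the fibres of one are controlled by those of the other.\<close>

lemma pairing_kernel:
  assumes kel: "keller n (\<lambda>i x. x i + (\<Sum>j\<in>J. C i j * lin n B j x ^ 3))"
    and v: "\<And>j. j \<in> J \<Longrightarrow> v j + 3 * (\<Sum>k\<in>J. prodmat n B C j k * X k) ^ 2 * (\<Sum>k\<in>J. prodmat n B C j k * v k) = 0"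
    and j: "j \<in> J"
  shows "v j = 0"
proof -
  define x where "x l = (\<Sum>k\<in>J. C l k * X k)" for l
  \<comment> \<open>The vector w = C v is in the kernel of the derivative of the smaller map at x =
    C X; once it is 0, the equation for \<open>v\<close> reads v = 0.\<close>
  define w where "w l = (\<Sum>k\<in>J. C l k * v k)" for l
  have vj: "v j = - (3 * lin n B j x ^ 2 * lin n B j w)" if "j \<in> J" for j
    using v[OF that] unfolding prodmat_apply x_def[symmetric] w_def[symmetric]
    by (simp add: eq_neg_iff_add_eq_0)
  have w0: "w i = 0" if i: "i < n" for i
  proof (rule kellerD[OF kel _ i])
    fix i
    have "dd (\<lambda>x. x i + (\<Sum>j\<in>J. C i j * lin n B j x ^ 3)) x w
        (w i + (\<Sum>j\<in>J. C i j * (3 * lin n B j x ^ 2 * (\<Sum>l<n. B j l * w l))))"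
      unfolding lin_def by (intro dd_add dd_var dd_sum dd_cmult dd_power3)
    moreover have "w i = (\<Sum>j\<in>J. - (C i j * (3 * lin n B j x ^ 2 * lin n B j w)))"
      unfolding w_def[of i] by (intro sum.cong refl) (simp add: vj)
    ultimately show "dd (\<lambda>x. x i + (\<Sum>j\<in>J. C i j * lin n B j x ^ 3)) x w 0"
      by (simp add: lin_def sum_negf)
  qed
  then have "lin n B j w = 0" by (simp add: lin_def)
  then show ?thesis using vj[OF j] by simp
qed

text \<open>For a linear form with value u at the midpoint and w at the half difference, the two
  cubes differ by 2 (w^3 + 3 w u^2); applying \<open>B\<close> to the equality of images gives the
  relation. The section \<open>sec\<close> replaces \<open>B u\<close> by the product matrix applied
  to \<open>X\<close>.\<close>

lemma pairing_noninjective: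
  assumes ni: "noninj n (\<lambda>i x. x i + (\<Sum>j\<in>J. C i j * lin n B j x ^ 3))"
    and sec: "\<And>u. \<exists>X. \<forall>l<n. (\<Sum>k\<in>J. C l k * X k) = u l"
  shows "\<exists>w X. (\<exists>j\<in>J. lin n B j w \<noteq> 0) \<and>
    (\<forall>j\<in>J. lin n B j w + (\<Sum>k\<in>J. prodmat n B C j k *
      (lin n B k w ^ 3 + 3 * lin n B k w * (\<Sum>l\<in>J. prodmat n B C k l * X l) ^ 2)) = 0)"
proof -
  obtain a b where ab: "(\<forall>i<n. a i + (\<Sum>j\<in>J. C i j * lin n B j a ^ 3) = b i + (\<Sum>j\<in>J. C i j * lin n B j b ^ 3))
      \<and> (\<exists>i<n. a i \<noteq> b i)"
    using ni unfolding noninj_def by (elim exE) (rule that)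
  define w where "w i = (a i - b i) / 2" for i
  define u where "u i = (a i + b i) / 2" for i
  obtain X where X: "\<forall>l<n. (\<Sum>k\<in>J. C l k * X k) = u l" using sec[of u] by (rule exE)
  have s: "(\<Sum>k\<in>J. prodmat n B C j k * X k) = lin n B j u" for j
    unfolding prodmat_apply using X by (simp add: lin_def)
  define c where "c j = lin n B j w ^ 3 + 3 * lin n B j w * lin n B j u ^ 2" for j
  have la: "lin n B j a = lin n B j u + lin n B j w" and lb: "lin n B j b = lin n B j u - lin n B j w" for j
  proof -
    have "a = (\<lambda>i. u i + w i)" "b = (\<lambda>i. u i - w i)" by (auto simp: u_def w_def field_simps)
    then show "lin n B j a = lin n B j u + lin n B j w" "lin n B j b = lin n B j u - lin n B j w"
      by (simp_all add: lin_def distrib_left right_diff_distrib sum.distrib sum_subtractf)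
  qed
  have rel: "w i + (\<Sum>k\<in>J. C i k * c k) = 0" if "i < n" for i
  proof -
    have "C i j * lin n B j a ^ 3 - C i j * lin n B j b ^ 3 = 2 * (C i j * c j)" for j
      unfolding la lb c_def by (simp add: power3_eq_cube power2_eq_square algebra_simps)
    then have "(\<Sum>j\<in>J. C i j * lin n B j a ^ 3) - (\<Sum>j\<in>J. C i j * lin n B j b ^ 3) = 2 * (\<Sum>k\<in>J. C i k * c k)"
      by (simp add: sum_subtractf[symmetric] sum_distrib_left)
    moreover have "a i + (\<Sum>j\<in>J. C i j * lin n B j a ^ 3) = b i + (\<Sum>j\<in>J. C i j * lin n B j b ^ 3)"
      using ab that by simp
    ultimately have "a i - b i + 2 * (\<Sum>k\<in>J. C i k * c k) = 0" by (simp add: algebra_simps)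
    then show ?thesis by (simp add: w_def field_simps)
  qed
  have eq: "lin n B j w + (\<Sum>k\<in>J. prodmat n B C j k * c k) = 0" for j
  proof -
    have "lin n B j w + lin n B j (\<lambda>l. \<Sum>k\<in>J. C l k * c k) = (\<Sum>l<n. B j l * (w l + (\<Sum>k\<in>J. C l k * c k)))"
      by (simp add: lin_def distrib_left sum.distrib)
    also have "\<dots> = 0" by (rule sum.neutral) (simp add: rel)
    finally show ?thesis unfolding prodmat_apply .
  qed
  have nz: "\<exists>j\<in>J. lin n B j w \<noteq> 0"
  proof (rule ccontr)
    assume "\<not> ?thesis"
    then have "c j = 0" if "j \<in> J" for j using that by (simp add: c_def)
    then have "w i = 0" if "i < n" for i using rel[OF that] by simp
    then show False using ab by (auto simp: w_def)
  qed
  show ?thesis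
    by (rule exI[of _ w], rule exI[of _ X]) (use nz eq in \<open>simp add: s c_def\<close>)
qed

section \<open>Matrix form: Jacobian determinants and normalisation of the solution\<close>

lemma mult_mat_vec_index:
  assumes "A \<in> carrier_mat N N" "x \<in> carrier_vec N" "p < N"
  shows "(A *\<^sub>v x) $ p = (\<Sum>q<N. A $$ (p, q) * x $ q)"
  using assms by (simp add: scalar_prod_def atLeast0LessThan)

lemma druzkowski_map_index:
  assumes "A \<in> carrier_mat N N" "x \<in> carrier_vec N" "p < N"
  shows "druzkowski_map A x $ p = x $ p + (\<Sum>q<N. A $$ (p, q) * x $ q) ^ 3"
  unfolding druzkowski_map_def cw_power_def
  using assms by (simp add: mult_mat_vec_index[OF assms, symmetric])

lemma jacobian_druzkowski:
  assumes A: "A \<in> carrier_mat N N" and x: "x \<in> carrier_vec N"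
  shows "Defs.jacobian N (druzkowski_map A) x = Matrix.mat N N (\<lambda>(p, q).
    (if p = q then 1 else 0) + 3 * (\<Sum>r<N. A $$ (p, r) * x $ r) ^ 2 * A $$ (p, q))"
  unfolding Defs.jacobian_def
proof (rule cong_mat[OF refl refl])
  fix p q assume pq: "p < N" "q < N"
  have 1: "druzkowski_map A (Matrix.vec N (\<lambda>l. if l = q then t else x $ l)) $ p
      = (if p = q then t else x $ p) + (\<Sum>r<N. A $$ (p, r) * (if r = q then t else x $ r)) ^ 3" for t
    using druzkowski_map_index[OF A _ pq(1), of "Matrix.vec N (\<lambda>l. if l = q then t else x $ l)"] pq by simp
  have s: "((\<lambda>t. \<Sum>r<N. A $$ (p, r) * (if r = q then t else x $ r)) has_field_derivative A $$ (p, q)) (at (x $ q))"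
  proof -
    have "((\<lambda>t. A $$ (p, r) * (if r = q then t else x $ r)) has_field_derivative (if r = q then A $$ (p, q) else 0)) (at (x $ q))" for r
      by (cases "r = q") (auto intro!: derivative_eq_intros)
    then have "((\<lambda>t. \<Sum>r<N. A $$ (p, r) * (if r = q then t else x $ r)) has_field_derivative
        (\<Sum>r<N. if r = q then A $$ (p, q) else 0)) (at (x $ q))"
      by (intro DERIV_sum)
    then show ?thesis using pq by simp
  qed
  have e: "((\<lambda>t. if p = q then t else x $ p) has_field_derivative (if p = q then 1 else 0)) (at (x $ q))"
    by (cases "p = q") (auto intro!: derivative_eq_intros)
  have xx: "(\<Sum>r<N. A $$ (p, r) * (if r = q then x $ q else x $ r)) = (\<Sum>r<N. A $$ (p, r) * x $ r)"
    by (intro sum.cong refl) auto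
  have "((\<lambda>t. (if p = q then t else x $ p) + (\<Sum>r<N. A $$ (p, r) * (if r = q then t else x $ r)) ^ 3)
      has_field_derivative ((if p = q then 1 else 0) + 3 * (\<Sum>r<N. A $$ (p, r) * x $ r) ^ 2 * A $$ (p, q))) (at (x $ q))"
    using DERIV_add[OF e DERIV_power[OF s, of 3]] by (simp add: xx mult_ac)
  from DERIV_imp_deriv[OF this]
  show "(case (p, q) of (i, j) \<Rightarrow> deriv (\<lambda>t. druzkowski_map A (Matrix.vec N (\<lambda>l. if l = j then t else x $ l)) $ i) (x $ j))
    = (case (p, q) of (p, q) \<Rightarrow> (if p = q then 1 else 0) + 3 * (\<Sum>r<N. A $$ (p, r) * x $ r) ^ 2 * A $$ (p, q))"
    by (simp only: 1 prod.case)
qed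

lemma poly_det:
  assumes "M \<in> carrier_mat N N"
  shows "poly (Determinant.det M) t = Determinant.det (map_mat (\<lambda>p. poly p t) M)"
proof -
  have "poly (\<Prod>i = 0..<N. M $$ (i, p i)) t = (\<Prod>i = 0..<N. map_mat (\<lambda>p. poly p t) M $$ (i, p i))"
    if "p permutes {0..<N}" for p
    unfolding poly_prod
  proof (rule prod.cong[OF refl])
    fix i assume "i \<in> {0..<N}"
    then have "p i < N" using permutes_in_image[OF that, of i] by simp
    then show "poly (M $$ (i, p i)) t = map_mat (\<lambda>p. poly p t) M $$ (i, p i)" using assms \<open>i \<in> _\<close> by simp
  qed
  moreover have "poly (signof p) t = signof p" for p :: "nat \<Rightarrow> nat"
    by (simp add: sign_def)
  ultimately show ?thesis
    using assms by (simp add: det_def'[OF assms] det_def'[of "map_mat (\<lambda>p. poly p t) M" N] poly_sum)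
qed

text \<open>Along a ray t x the Jacobian determinant is a polynomial in t. Trivial kernels leave it
  without zeros, so it is constant and equals its value 1 at t = 0.\<close>

lemma druzkowski_criterion:
  assumes A: "A \<in> carrier_mat N N"
    and ker: "\<And>x v :: nat \<Rightarrow> complex. (\<And>p. p < N \<Longrightarrow> v p + 3 * (\<Sum>r<N. A $$ (p, r) * x r) ^ 2 * (\<Sum>r<N. A $$ (p, r) * v r) = 0)
       \<Longrightarrow> (\<And>p. p < N \<Longrightarrow> v p = 0)"
  shows "druzkowski N A"
  unfolding druzkowski_def
proof (intro conjI ballI A)
  fix x :: "complex vec" assume x: "x \<in> carrier_vec N"
  define s where "s p = (\<Sum>r<N. A $$ (p, r) * x $ r)" for p
  define J where "J t = Matrix.mat N N (\<lambda>(p, q). (if p = q then 1 else 0) + 3 * (t * s p) ^ 2 * A $$ (p, q))" for t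
  have Jc: "J t \<in> carrier_mat N N" for t by (simp add: J_def)
  have det_nz: "Determinant.det (J t) \<noteq> 0" for t
  proof
    assume "Determinant.det (J t) = 0"
    then obtain v where v: "v \<in> carrier_vec N" "v \<noteq> 0\<^sub>v N" "J t *\<^sub>v v = 0\<^sub>v N"
      using det_0_iff_vec_prod_zero[OF Jc] by auto
    have "v $ p = 0" if p: "p < N" for p
    proof (rule ker[of "\<lambda>p. v $ p" "\<lambda>r. t * x $ r", OF _ p])
      fix p assume p: "p < N"
      have "0 = (\<Sum>q<N. J t $$ (p, q) * v $ q)"
        using mult_mat_vec_index[OF Jc v(1) p, of t] v(3) p by simp
      also have "\<dots> = (\<Sum>q<N. (if q = p then v $ q else 0) + 3 * (t * s p) ^ 2 * (A $$ (p, q) * v $ q))"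
        by (intro sum.cong refl) (use p in \<open>auto simp: J_def algebra_simps\<close>)
      also have "\<dots> = v $ p + 3 * (t * s p) ^ 2 * (\<Sum>r<N. A $$ (p, r) * v $ r)"
        using p by (simp add: sum.distrib sum_distrib_left)
      also have "t * s p = (\<Sum>r<N. A $$ (p, r) * (t * x $ r))"
        by (simp add: s_def sum_distrib_left mult_ac)
      finally show "v $ p + 3 * (\<Sum>r<N. A $$ (p, r) * (t * x $ r)) ^ 2 * (\<Sum>r<N. A $$ (p, r) * v $ r) = 0"
        by (rule sym)
    qed
    then have "v = 0\<^sub>v N" using v(1) by (intro eq_vecI) auto
    then show False using v(2) by simp
  qed
  define M where "M = Matrix.mat N N (\<lambda>(p, q). [:if p = q then 1 else 0, 0, 3 * s p ^ 2 * A $$ (p, q):])"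
  have M: "M \<in> carrier_mat N N" by (simp add: M_def)
  have MJ: "map_mat (\<lambda>p. poly p t) M = J t" for t
    by (rule eq_matI) (auto simp: M_def J_def power2_eq_square)
  have "poly (Determinant.det M) 1 = poly (Determinant.det M) 0"
    by (rule no_roots_constant) (simp add: poly_det[OF M] MJ det_nz)
  then have "Determinant.det (J 1) = Determinant.det (J 0)" by (simp add: poly_det[OF M] MJ)
  also have "J 0 = 1\<^sub>m N" by (rule eq_matI) (auto simp: J_def)
  finally have "Determinant.det (J 1) = 1" by simp
  moreover have "Defs.jacobian N (druzkowski_map A) x = J 1"
    unfolding jacobian_druzkowski[OF A x] J_def s_def by simp
  ultimately show "Determinant.det (Defs.jacobian N (druzkowski_map A) x) = 1" by simp
qed

lemma ordered_enumeration:
  assumes "finite J" "S \<subseteq> J"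
  shows "\<exists>b. bij_betw b {..<card J} J \<and> (\<forall>i<card J. b i \<in> S \<longleftrightarrow> i < card S)"
proof -
  obtain xs where xs: "set xs = S" "distinct xs" using finite_distinct_list finite_subset[OF assms(2,1)] by blast
  obtain ys where ys: "set ys = J - S" "distinct ys" using finite_distinct_list[of "J - S"] assms(1) by blast
  have lx: "length xs = card S" using distinct_card[OF xs(2)] xs(1) by simp
  have dist: "distinct (xs @ ys)" "set (xs @ ys) = J" using xs ys assms(2) by auto
  then have len: "length (xs @ ys) = card J" using distinct_card by metis
  have "bij_betw ((!) (xs @ ys)) {..<card J} J"
    by (rule bij_betw_nth) (use dist len in auto)
  moreover have "(xs @ ys) ! i \<in> S \<longleftrightarrow> i < card S" if i: "i < card J" for i
  proof (cases "i < card S")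
    case True
    then show ?thesis using nth_mem[of i xs] lx xs(1) by (simp add: nth_append)
  next
    case False
    then have "i - length xs < length ys" using i len lx by simp
    then have "ys ! (i - length xs) \<in> J - S" using nth_mem ys(1) by blast
    then show ?thesis using False lx by (simp add: nth_append)
  qed
  ultimately show ?thesis by (intro exI[of _ "(!) (xs @ ys)"]) simp
qed

lemma normalised_druzkowski:
  fixes A :: "'j \<Rightarrow> 'j \<Rightarrow> complex"
  assumes J: "finite J"
    and ker: "\<And>X v j. (\<And>j. j \<in> J \<Longrightarrow> v j + 3 * (\<Sum>k\<in>J. A j k * X k) ^ 2 * (\<Sum>k\<in>J. A j k * v k) = 0) \<Longrightarrow> j \<in> J \<Longrightarrow> v j = 0"
    and rel: "\<And>j. j \<in> J \<Longrightarrow> d j + (\<Sum>k\<in>J. A j k * (d k ^ 3 + 3 * d k * (\<Sum>l\<in>J. A k l * X l) ^ 2)) = 0"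
    and k: "k = card {j\<in>J. d j \<noteq> 0}" and N: "N = card J"
  shows "\<exists>M y. druzkowski N M \<and> y \<in> carrier_vec N \<and>
    Z_vec N k + M *\<^sub>v (Z_vec N k ^\<^sub>v 3 + Z_vec N k \<circledast> (M *\<^sub>v y) ^\<^sub>v 2) = 0\<^sub>v N"
proof -
  have "{j\<in>J. d j \<noteq> 0} \<subseteq> J" by auto
  from ordered_enumeration[OF J this] obtain b where
    bb: "bij_betw b {..<N} J \<and> (\<forall>i<N. b i \<in> {j\<in>J. d j \<noteq> 0} \<longleftrightarrow> i < k)"
    unfolding N k by (rule exE)
  then have b: "bij_betw b {..<N} J" by simp
  have bJ: "b i \<in> J" if "i < N" for i using bij_betwE[OF b] that by simp
  have bk: "d (b i) \<noteq> 0 \<longleftrightarrow> i < k" if "i < N" for i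
    using bb[THEN conjunct2, rule_format, OF that] bJ[OF that] by simp
  have re: "(\<Sum>q<N. f (b q)) = (\<Sum>j\<in>J. f j)" for f :: "'j \<Rightarrow> complex"
    by (rule sum.reindex_bij_betw[OF b])
  \<comment> \<open>Zero entries of \<open>d\<close> get the scale factor 1, which keeps the
    diagonal matrix invertible.\<close>
  define c where "c j = (if d j = 0 then 1 else d j)" for j
  have c: "c j \<noteq> 0" for j by (simp add: c_def)
  \<comment> \<open>With the diagonal matrix D of the \<open>c j\<close> this is D^(-1) A D^3,
    renumbered by \<open>b\<close>: inserting D^3 x into x + (A x)^3 and factoring out D^3 leaves
    the map of this matrix.\<close>
  define M where "M = Matrix.mat N N (\<lambda>(p, q). A (b p) (b q) * c (b q) ^ 3 / c (b p))"
  have M: "M \<in> carrier_mat N N" by (simp add: M_def)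
  define bi where "bi = the_inv_into {..<N} b"
  have bi: "bi (b i) = i" if "i < N" for i
    unfolding bi_def using b that by (intro the_inv_into_f_f) (auto simp: bij_betw_def)
  have Mapp: "(\<Sum>q<N. M $$ (p, q) * x q) = (\<Sum>j\<in>J. A (b p) j * (c j ^ 3 * x (bi j))) / c (b p)"
    if "p < N" for p and x :: "nat \<Rightarrow> complex"
  proof -
    have "(\<Sum>q<N. M $$ (p, q) * x q) = (\<Sum>q<N. A (b p) (b q) * (c (b q) ^ 3 * x (bi (b q)))) / c (b p)"
      unfolding sum_divide_distrib by (intro sum.cong refl) (use that in \<open>simp add: M_def bi\<close>)
    then show ?thesis by (simp only: re[of "\<lambda>j. A (b p) j * (c j ^ 3 * x (bi j))"])
  qed
  have "druzkowski N M"
  proof (rule druzkowski_criterion[OF M])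
    fix x v :: "nat \<Rightarrow> complex" and p
    assume z: "\<And>p. p < N \<Longrightarrow> v p + 3 * (\<Sum>r<N. M $$ (p, r) * x r) ^ 2 * (\<Sum>r<N. M $$ (p, r) * v r) = 0"
      and p: "p < N"
    define V where "V j = c j ^ 3 * v (bi j)" for j
    have "V (b p) = 0"
    proof (rule ker[of V "\<lambda>j. c j ^ 3 * x (bi j)", OF _ bJ[OF p]])
      fix j assume "j \<in> J"
      then have "j \<in> b ` {..<N}" using b by (simp add: bij_betw_def)
      then obtain q where q: "q < N" "j = b q" by auto
      have "v q + 3 * ((\<Sum>j\<in>J. A (b q) j * (c j ^ 3 * x (bi j))) / c (b q)) ^ 2 *
          ((\<Sum>j\<in>J. A (b q) j * (c j ^ 3 * v (bi j))) / c (b q)) = 0"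
        using z[OF q(1)] unfolding Mapp[OF q(1)] .
      then have "c (b q) ^ 3 * (v q + 3 * ((\<Sum>j\<in>J. A (b q) j * (c j ^ 3 * x (bi j))) / c (b q)) ^ 2 *
          ((\<Sum>j\<in>J. A (b q) j * (c j ^ 3 * v (bi j))) / c (b q))) = 0" by simp
      then show "V j + 3 * (\<Sum>k\<in>J. A j k * (c k ^ 3 * x (bi k))) ^ 2 * (\<Sum>k\<in>J. A j k * V k) = 0"
        using c[of "b q"] by (simp add: q(2) V_def bi[OF q(1)] distrib_left power2_eq_square power3_eq_cube)
    qed
    then show "v p = 0" using c[of "b p"] by (simp add: V_def bi[OF p])
  qed
  \<comment> \<open>The square in \<open>rel\<close> carries a factor 3, the one in the equation for
    \<open>Z_vec\<close> does not; scaling \<open>X\<close> by the square root of 3 absorbs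
    it.\<close>
  moreover define \<kappa> where "\<kappa> = csqrt 3"
  have \<kappa>: "\<kappa> ^ 2 = 3" unfolding \<kappa>_def by (rule power2_csqrt)
  define y where "y = Matrix.vec N (\<lambda>q. \<kappa> * X (b q) / c (b q) ^ 3)"
  have y: "y \<in> carrier_vec N" by (simp add: y_def)
  have My: "(M *\<^sub>v y) $ q = \<kappa> * (\<Sum>l\<in>J. A (b q) l * X l) / c (b q)" if "q < N" for q
  proof -
    have "(M *\<^sub>v y) $ q = (\<Sum>r<N. M $$ (q, r) * (\<kappa> * X (b r) / c (b r) ^ 3))"
      unfolding mult_mat_vec_index[OF M y that] by (intro sum.cong refl) (simp add: y_def)
    also have "\<dots> = (\<Sum>r<N. \<kappa> * (A (b q) (b r) * X (b r)) / c (b q))"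
      by (intro sum.cong refl) (use that c in \<open>simp add: M_def\<close>)
    also have "\<dots> = \<kappa> * (\<Sum>r<N. A (b q) (b r) * X (b r)) / c (b q)"
      by (simp add: sum_distrib_left sum_divide_distrib)
    finally show ?thesis by (simp only: re[of "\<lambda>l. A (b q) l * X l"])
  qed
  have Z: "Z_vec N k $ q = d (b q) / c (b q)" if "q < N" for q
    using bk[OF that] that by (auto simp: Z_vec_def c_def)
  have Zc: "Z_vec N k \<in> carrier_vec N" by (simp add: Z_vec_def)
  define W where "W = Z_vec N k ^\<^sub>v 3 + Z_vec N k \<circledast> (M *\<^sub>v y) ^\<^sub>v 2"
  have Wc: "W \<in> carrier_vec N" using Zc M by (simp add: W_def cw_power_def cw_mult_def)
  have W: "W $ q = (d (b q) ^ 3 + 3 * d (b q) * (\<Sum>l\<in>J. A (b q) l * X l) ^ 2) / c (b q) ^ 3" if "q < N" for q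
  proof -
    have "W $ q = (Z_vec N k $ q) ^ 3 + Z_vec N k $ q * ((M *\<^sub>v y) $ q) ^ 2"
      using that Zc M y by (simp add: W_def cw_power_def cw_mult_def)
    also have "\<dots> = (d (b q) ^ 3 + 3 * d (b q) * (\<Sum>l\<in>J. A (b q) l * X l) ^ 2) / c (b q) ^ 3"
      unfolding Z[OF that] My[OF that] using c[of "b q"]
      by (simp add: \<kappa> power_divide power_mult_distrib add_divide_distrib power2_eq_square[of "c (b q)"] power3_eq_cube[of "c (b q)"] mult_ac)
    finally show ?thesis .
  qed
  have "Z_vec N k + M *\<^sub>v W = 0\<^sub>v N"
  proof (rule eq_vecI)
    fix p assume "p < dim_vec (0\<^sub>v N)"
    then have p: "p < N" by simp
    have "(M *\<^sub>v W) $ p = (\<Sum>q<N. A (b p) (b q) * (d (b q) ^ 3 + 3 * d (b q) * (\<Sum>l\<in>J. A (b q) l * X l) ^ 2)) / c (b p)"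
      unfolding mult_mat_vec_index[OF M Wc p] sum_divide_distrib
      by (intro sum.cong refl) (use p c in \<open>simp add: M_def W\<close>)
    also have "\<dots> = (\<Sum>j\<in>J. A (b p) j * (d j ^ 3 + 3 * d j * (\<Sum>l\<in>J. A j l * X l) ^ 2)) / c (b p)"
      by (simp only: re[of "\<lambda>j. A (b p) j * (d j ^ 3 + 3 * d j * (\<Sum>l\<in>J. A j l * X l) ^ 2)"])
    finally have "(Z_vec N k + M *\<^sub>v W) $ p = (d (b p) + (\<Sum>j\<in>J. A (b p) j * (d j ^ 3 + 3 * d j * (\<Sum>l\<in>J. A j l * X l) ^ 2))) / c (b p)"
      using p M by (simp add: Z[OF p] add_divide_distrib)
    also have "\<dots> = 0" using rel[OF bJ[OF p]] by simp
    finally show "(Z_vec N k + M *\<^sub>v W) $ p = 0\<^sub>v N $ p" using p by simp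
  qed (use M in simp)
  ultimately show ?thesis using y unfolding W_def by (intro exI[of _ M] exI[of _ y]) simp
qed

lemma length_3_cases: "m \<in> index_lists n 3 \<Longrightarrow> \<exists>i j k. m = [i, j, k] \<and> i < n \<and> j < n \<and> k < n"
  by (auto simp: index_lists_def length_Suc_conv numeral_3_eq_3)

text \<open>Polarisation: \<open>24 x y z\<close> is the sum of \<open>\<sigma> \<tau> (x + \<sigma> y + \<tau> z)\<^sup>3\<close> over all signs \<open>\<sigma>, \<tau>\<close>. Every cube is
  listed three times, so that a nonzero vector of values of these linear forms has at least three
  nonzero entries; the indices \<open>Inr i\<close> carry no cube and only make the section of \<open>C\<close> available.\<close>

type_synonym cube_index = "(nat \<times> nat list \<times> complex \<times> complex) + nat"

definition cube_indices :: "nat \<Rightarrow> cube_index set" where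
  "cube_indices n = ({..<3} \<times> index_lists n 3 \<times> {1, -1} \<times> {1, -1}) <+> {..<n}"

definition cube_form :: "cube_index \<Rightarrow> nat \<Rightarrow> complex" where
  "cube_form j l = (case j of Inl (e, m, \<sigma>, \<tau>) \<Rightarrow>
      (if l = m ! 0 then 1 else 0) + \<sigma> * (if l = m ! 1 then 1 else 0) + \<tau> * (if l = m ! 2 then 1 else 0)
    | Inr i \<Rightarrow> 0)"

text \<open>72 = 3 * 24, the number of copies of each cube times the polarisation constant. The
  indices \<open>Inr\<close> form an identity block.\<close>

definition cube_coeff :: "(nat \<Rightarrow> nat list \<Rightarrow> complex) \<Rightarrow> nat \<Rightarrow> cube_index \<Rightarrow> complex" where
  "cube_coeff c i j = (case j of Inl (e, m, \<sigma>, \<tau>) \<Rightarrow> c i m * (\<sigma> * \<tau>) / 72 | Inr i' \<Rightarrow> if i' = i then 1 else 0)"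

lemma finite_cube_indices: "finite (cube_indices n)"
  unfolding cube_indices_def by (intro finite_Plus finite_cartesian_product finite_index_lists) auto

lemma lin_cube_form:
  assumes "m \<in> index_lists n 3"
  shows "lin n cube_form (Inl (e, m, \<sigma>, \<tau>)) x = x (m ! 0) + \<sigma> * x (m ! 1) + \<tau> * x (m ! 2)"
proof -
  have lt: "m ! 0 < n" "m ! 1 < n" "m ! 2 < n" using length_3_cases[OF assms] by auto
  have "lin n cube_form (Inl (e, m, \<sigma>, \<tau>)) x =
    (\<Sum>l<n. (if l = m ! 0 then x l else 0) + \<sigma> * (if l = m ! 1 then x l else 0) + \<tau> * (if l = m ! 2 then x l else 0))"
    unfolding lin_def cube_form_def by (intro sum.cong refl) (simp add: distrib_right)
  then show ?thesis using lt by (simp add: sum.distrib flip: sum_distrib_left)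
qed

lemma lin_cube_form_Inr: "lin n cube_form (Inr i) x = 0"
  by (simp add: lin_def cube_form_def)

lemma cubic_form_as_cubes:
  assumes i: "i < n"
  shows "(\<Sum>j\<in>cube_indices n. cube_coeff c i j * lin n cube_form j x ^ 3) = (\<Sum>m\<in>index_lists n 3. c i m * list_monom m x)"
proof -
  have "(\<Sum>j\<in>cube_indices n. cube_coeff c i j * lin n cube_form j x ^ 3) =
    (\<Sum>z\<in>{..<3::nat} \<times> index_lists n 3 \<times> {1, -1} \<times> {1, -1}. cube_coeff c i (Inl z) * lin n cube_form (Inl z) x ^ 3)"
    unfolding cube_indices_def
    by (subst sum.Plus) (auto simp: lin_cube_form_Inr finite_index_lists)
  also have "\<dots> = (\<Sum>e<3::nat. \<Sum>m\<in>index_lists n 3. \<Sum>\<sigma>\<in>{1, -1}. \<Sum>\<tau>\<in>{1, -1}.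
      cube_coeff c i (Inl (e, m, \<sigma>, \<tau>)) * lin n cube_form (Inl (e, m, \<sigma>, \<tau>)) x ^ 3)"
    by (simp only: sum.cartesian_product case_prod_unfold prod.collapse fst_conv snd_conv)
  also have "\<dots> = (\<Sum>e<3::nat. \<Sum>m\<in>index_lists n 3. c i m * list_monom m x / 3)"
  proof (intro sum.cong refl)
    fix e m assume m: "m \<in> index_lists n 3"
    then obtain a b d where abd: "m = [a, b, d]" using length_3_cases by blast
    have ne: "(1::complex) \<noteq> -1" by simp
    have "(\<Sum>\<sigma>\<in>{1, -1}. \<Sum>\<tau>\<in>{1, -1}. cube_coeff c i (Inl (e, m, \<sigma>, \<tau>)) * lin n cube_form (Inl (e, m, \<sigma>, \<tau>)) x ^ 3)
      = (\<Sum>\<sigma>\<in>{1, -1}. \<Sum>\<tau>\<in>{1, -1}. c i m * (\<sigma> * \<tau>) / 72 * (x a + \<sigma> * x b + \<tau> * x d) ^ 3)"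
      by (intro sum.cong refl) (simp add: lin_cube_form[OF m], simp add: cube_coeff_def abd)
    also have "\<dots> = c i m * (x a * x b * x d) / 3"
      using ne by (simp add: power3_eq_cube field_simps)
    finally show "(\<Sum>\<sigma>\<in>{1, -1}. \<Sum>\<tau>\<in>{1, -1}. cube_coeff c i (Inl (e, m, \<sigma>, \<tau>)) * lin n cube_form (Inl (e, m, \<sigma>, \<tau>)) x ^ 3)
      = c i m * list_monom m x / 3" by (simp add: abd list_monom_def mult.assoc)
  qed
  also have "\<dots> = (\<Sum>m\<in>index_lists n 3. c i m * list_monom m x)"
    by (simp add: sum_divide_distrib[symmetric])
  finally show ?thesis .
qed

lemma druzkowski_counterexample:
  assumes H: "\<And>i. i < n \<Longrightarrow> form n 3 (H i)"
    and kel: "keller n (\<lambda>i x. x i + H i x)" and ni: "noninj n (\<lambda>i x. x i + H i x)"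
  shows "\<exists>N. \<exists>k\<in>{3..N}. \<exists>M y. druzkowski N M \<and> y \<in> carrier_vec N \<and>
    Z_vec N k + M *\<^sub>v (Z_vec N k ^\<^sub>v 3 + Z_vec N k \<circledast> (M *\<^sub>v y) ^\<^sub>v 2) = 0\<^sub>v N"
proof -
  have "\<forall>i\<in>{..<n}. \<exists>c. \<forall>x. H i x = (\<Sum>m\<in>index_lists n 3. c m * list_monom m x)"
    using H by (simp add: form_def)
  then obtain c where c: "\<forall>i\<in>{..<n}. \<forall>x. H i x = (\<Sum>m\<in>index_lists n 3. c i m * list_monom m x)"
    by (rule bchoice[THEN exE])
  define J where "J = cube_indices n"
  define C where "C = cube_coeff c"
  define B where "B = cube_form"
  have HC: "x i + H i x = x i + (\<Sum>j\<in>J. C i j * lin n B j x ^ 3)" if "i < n" for i x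
    using c that by (simp add: J_def C_def B_def cubic_form_as_cubes)
  have kel': "keller n (\<lambda>i x. x i + (\<Sum>j\<in>J. C i j * lin n B j x ^ 3))"
    using kel unfolding keller_def by (simp add: HC)
  have ni': "noninj n (\<lambda>i x. x i + (\<Sum>j\<in>J. C i j * lin n B j x ^ 3))"
    using ni unfolding noninj_def by (simp add: HC)
  have sec: "\<exists>X. \<forall>l<n. (\<Sum>k\<in>J. C l k * X k) = u l" for u
  \<comment> \<open>The cubes get 0 and the identity block gets \<open>u\<close>.\<close>
  proof (rule exI[of _ "case_sum (\<lambda>_. 0) u"], intro allI impI)
    fix l assume l: "l < n"
    have "(\<Sum>k\<in>J. C l k * case_sum (\<lambda>_. 0) u k) = (\<Sum>i<n. (if i = l then 1 else 0) * u i)"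
      unfolding J_def cube_indices_def C_def
      by (subst sum.Plus) (auto simp: finite_index_lists cube_coeff_def)
    also have "\<dots> = (\<Sum>i<n. if i = l then u i else 0)" by (intro sum.cong refl) simp
    also have "\<dots> = u l" using l by simp
    finally show "(\<Sum>k\<in>J. C l k * case_sum (\<lambda>_. 0) u k) = u l" .
  qed
  from pairing_noninjective[OF ni' sec] obtain w X where wX: "(\<exists>j\<in>J. lin n B j w \<noteq> 0) \<and>
    (\<forall>j\<in>J. lin n B j w + (\<Sum>k\<in>J. prodmat n B C j k *
      (lin n B k w ^ 3 + 3 * lin n B k w * (\<Sum>l\<in>J. prodmat n B C k l * X l) ^ 2)) = 0)"
    by (elim exE) (rule that)
  define k where "k = card {j\<in>J. lin n B j w \<noteq> 0}"
  have finJ: "finite J" unfolding J_def by (rule finite_cube_indices)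
  have "3 \<le> k"
  proof -
    from wX obtain j where j: "j \<in> J" "lin n B j w \<noteq> 0" by auto
    then obtain e m \<sigma> \<tau> where jj: "j = Inl (e, m, \<sigma>, \<tau>)" "m \<in> index_lists n 3" "\<sigma> \<in> {1, -1}" "\<tau> \<in> {1, -1}"
      by (auto simp: J_def cube_indices_def B_def lin_cube_form_Inr)
    \<comment> \<open>The three copies of a cube share its linear form, so one nonzero value yields
      three indices.\<close>
    have "card ((\<lambda>e. Inl (e, m, \<sigma>, \<tau>) :: cube_index) ` {..<3}) \<le> k"
      unfolding k_def
    proof (rule card_mono)
      show "finite {j\<in>J. lin n B j w \<noteq> 0}" using finJ by simp
      show "(\<lambda>e. Inl (e, m, \<sigma>, \<tau>)) ` {..<3} \<subseteq> {j\<in>J. lin n B j w \<noteq> 0}"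
        using jj j(2) by (auto simp: J_def cube_indices_def B_def lin_cube_form)
    qed
    then show ?thesis by (simp add: card_image inj_on_def)
  qed
  moreover have "k \<le> card J" unfolding k_def by (rule card_mono[OF finJ]) auto
  moreover have "\<exists>M y. druzkowski (card J) M \<and> y \<in> carrier_vec (card J) \<and>
    Z_vec (card J) k + M *\<^sub>v (Z_vec (card J) k ^\<^sub>v 3 + Z_vec (card J) k \<circledast> (M *\<^sub>v y) ^\<^sub>v 2) = 0\<^sub>v (card J)"
  proof (rule normalised_druzkowski[OF finJ _ _ k_def refl])
    show "v j = 0" if "\<And>j. j \<in> J \<Longrightarrow> v j + 3 * (\<Sum>k\<in>J. prodmat n B C j k * X k) ^ 2 *
        (\<Sum>k\<in>J. prodmat n B C j k * v k) = 0" "j \<in> J" for X v j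
      by (rule pairing_kernel[OF kel' that])
    show "lin n B j w + (\<Sum>k\<in>J. prodmat n B C j k *
      (lin n B k w ^ 3 + 3 * lin n B k w * (\<Sum>l\<in>J. prodmat n B C k l * X l) ^ 2)) = 0" if "j \<in> J" for j
      using wX that by simp
  qed
  ultimately show ?thesis by (intro exI[of _ "card J"] bexI[of _ k]) auto
qed

section \<open>The equivalence\<close>

lemma polynomial_fun_pd:
  assumes "polynomial_fun n f"
  shows "\<exists>d g. pd n d g \<and> (\<forall>x\<in>carrier_vec n. f x = g (\<lambda>i. x $ i))"
proof -
  obtain S c where S: "finite S" "\<forall>x\<in>carrier_vec n. f x = (\<Sum>m\<in>S. c m * (\<Prod>i<n. (x $ i) ^ m i))"
    using assms unfolding polynomial_fun_def by auto
  define D where "D = (\<Sum>m\<in>S. \<Sum>i<n. m i)"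
  have "pd n (card {..<n} * D) (\<lambda>x. \<Prod>i<n. x i ^ m i)" if m: "m \<in> S" for m
  proof (intro pd_prod)
    fix i assume i: "i \<in> {..<n}"
    have "m i \<le> (\<Sum>i<n. m i)" using i by (intro member_le_sum) auto
    also have "\<dots> \<le> D" unfolding D_def using m S(1) by (intro member_le_sum[of m S "\<lambda>m. \<Sum>i<n. m i"]) auto
    finally have le: "m i * 1 \<le> D" by simp
    have "pd n 1 (\<lambda>x. x i)" using pd_var[of i n 0] i by simp
    from pd_mono[OF pd_power[OF this, of "m i"] le] show "pd n D (\<lambda>x. x i ^ m i)" .
  qed simp
  then have "pd n (card {..<n} * D) (\<lambda>x. \<Sum>m\<in>S. c m * (\<Prod>i<n. x i ^ m i))"
    by (intro pd_sum pd_cmult)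
  then show ?thesis using S(2)
    by (intro exI[of _ "card {..<n} * D"] exI[of _ "\<lambda>x. \<Sum>m\<in>S. c m * (\<Prod>i<n. x i ^ m i)"]) simp
qed

lemma pd_polynomial_fun:
  assumes "pd n d g" "\<And>x. x \<in> carrier_vec n \<Longrightarrow> f x = g (\<lambda>i. x $ i)"
  shows "polynomial_fun n f"
proof -
  obtain h where h: "(\<forall>e. form n e (h e)) \<and> (\<forall>x. g x = (\<Sum>e\<le>d. h e x))"
    using pd_forms[OF assms(1)] by (rule exE)
  then have "\<forall>e. \<exists>c. \<forall>x. h e x = (\<Sum>m\<in>index_lists n e. c m * list_monom m x)" by (simp add: form_def)
  then obtain c where c: "\<forall>e. \<forall>x. h e x = (\<Sum>m\<in>index_lists n e. c e m * list_monom m x)"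
    by (rule choice[THEN exE])
  define L where "L = (SIGMA e:{..d}. index_lists n e)"
  have L: "finite L" unfolding L_def by (intro finite_SigmaI) (auto simp: finite_index_lists)
  \<comment> \<open>Words with the same exponents are collected, since \<open>polynomial_fun\<close>
    takes one coefficient per exponent function.\<close>
  define E where "E z = count_list (snd z)" for z :: "nat \<times> nat list"
  have mono: "list_monom m x = (\<Prod>i<n. x i ^ count_list m i)" if "set m \<subseteq> {..<n}" for m x
    using that
  proof (induction m)
    case (Cons a m)
    have "(\<Prod>i<n. x i ^ count_list (a # m) i) = (\<Prod>i<n. (if i = a then x i else 1) * x i ^ count_list m i)"
      by (intro prod.cong) auto
    also have "\<dots> = x a * (\<Prod>i<n. x i ^ count_list m i)"
      using Cons.prems by (simp add: prod.distrib)
    finally show ?case using Cons by (simp add: list_monom_def)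
  qed (simp add: list_monom_def)
  have "f x = (\<Sum>\<epsilon>\<in>E ` L. (\<Sum>z\<in>{z\<in>L. E z = \<epsilon>}. c (fst z) (snd z)) * (\<Prod>i<n. (x $ i) ^ \<epsilon> i))"
    if "x \<in> carrier_vec n" for x
  proof -
    have "f x = (\<Sum>e\<le>d. \<Sum>m\<in>index_lists n e. c e m * list_monom m (\<lambda>i. x $ i))"
      using assms(2)[OF that] h c by simp
    also have "\<dots> = (\<Sum>z\<in>L. c (fst z) (snd z) * list_monom (snd z) (\<lambda>i. x $ i))"
      unfolding L_def by (subst sum.Sigma) (auto simp: finite_index_lists case_prod_unfold)
    also have "\<dots> = (\<Sum>z\<in>L. c (fst z) (snd z) * (\<Prod>i<n. (x $ i) ^ E z i))"
      by (intro sum.cong refl) (auto simp: L_def index_lists_def E_def mono)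
    also have "\<dots> = (\<Sum>\<epsilon>\<in>E ` L. \<Sum>z\<in>{z\<in>L. E z = \<epsilon>}. c (fst z) (snd z) * (\<Prod>i<n. (x $ i) ^ E z i))"
      by (rule sum.image_gen[OF L])
    also have "\<dots> = (\<Sum>\<epsilon>\<in>E ` L. (\<Sum>z\<in>{z\<in>L. E z = \<epsilon>}. c (fst z) (snd z)) * (\<Prod>i<n. (x $ i) ^ \<epsilon> i))"
      unfolding sum_distrib_right by (intro sum.cong refl) auto
    finally show ?thesis .
  qed
  then show ?thesis unfolding polynomial_fun_def
    by (intro exI[of _ "E ` L"] exI[of _ "\<lambda>\<epsilon>. \<Sum>z\<in>{z\<in>L. E z = \<epsilon>}. c (fst z) (snd z)"]) (simp add: L)
qed

lemma JC_if_no_counterexample: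
  assumes no: "\<And>d F. \<not> counterexample n d F"
  shows "JC n"
  unfolding JC_def
proof (intro allI impI, elim conjE)
  fix F assume pm: "polynomial_map n F" and inv: "\<forall>x\<in>carrier_vec n. invertible_mat (Defs.jacobian n F x)"
  have Fc: "F x \<in> carrier_vec n" if "x \<in> carrier_vec n" for x using pm that by (auto simp: polynomial_map_def)
  have "\<forall>i\<in>{..<n}. \<exists>dg. pd n (fst dg) (snd dg) \<and> (\<forall>x\<in>carrier_vec n. F x $ i = snd dg (\<lambda>i. x $ i))"
  proof
    fix i assume "i \<in> {..<n}"
    then have "polynomial_fun n (\<lambda>x. F x $ i)" using pm by (simp add: polynomial_map_def)
    from polynomial_fun_pd[OF this] obtain d g where
      "pd n d g \<and> (\<forall>x\<in>carrier_vec n. F x $ i = g (\<lambda>i. x $ i))" by (elim exE) (rule that)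
    then show "\<exists>dg. pd n (fst dg) (snd dg) \<and> (\<forall>x\<in>carrier_vec n. F x $ i = snd dg (\<lambda>i. x $ i))"
      by (intro exI[of _ "(d, g)"]) simp
  qed
  then obtain dg where dg: "\<forall>i\<in>{..<n}. pd n (fst (dg i)) (snd (dg i)) \<and> (\<forall>x\<in>carrier_vec n. F x $ i = snd (dg i) (\<lambda>i. x $ i))"
    by (rule bchoice[THEN exE])
  define f where "f i = snd (dg i)" for i
  define d where "d = (\<Sum>i<n. fst (dg i))"
  have pf: "pd n d (f i)" if "i < n" for i
    unfolding f_def by (rule pd_mono[of n "fst (dg i)"]) (use dg that in \<open>auto simp: d_def intro: member_le_sum\<close>)
  have Ff: "F x $ i = f i (\<lambda>i. x $ i)" if "i < n" "x \<in> carrier_vec n" for i x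
    using dg that by (simp add: f_def)
  have Fv: "f i x = F (Matrix.vec n x) $ i" if "i < n" for i x
    using Ff[OF that, of "Matrix.vec n x"] pd_cong[OF pf[OF that], of x "\<lambda>i. Matrix.vec n x $ i"] by simp
  have kel: "keller n f"
    unfolding keller_def
  proof (intro allI impI)
    fix x v i assume z: "\<forall>i<n. dd (f i) x v 0" and i: "i < n"
    define xv where "xv = Matrix.vec n x"
    define vv where "vv = Matrix.vec n v"
    have xv: "xv \<in> carrier_vec n" and vv: "vv \<in> carrier_vec n" by (simp_all add: xv_def vv_def)
    have "\<forall>i\<in>{..<n}. \<exists>g. \<forall>v. dd (f i) x v (\<Sum>j<n. g j * v j)" using pd_grad[OF pf] by simp
    then obtain g where g: "\<forall>i\<in>{..<n}. \<forall>v. dd (f i) x v (\<Sum>j<n. g i j * v j)" by (rule bchoice[THEN exE])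
    have Jc: "Defs.jacobian n F xv \<in> carrier_mat n n" by (simp add: Defs.jacobian_def)
    have J: "Defs.jacobian n F xv $$ (p, q) = g p q" if pq: "p < n" "q < n" for p q
    proof -
      \<comment> \<open>In the direction of this unit vector \<open>dd\<close> differentiates at
        parameter 0, whereas \<open>jacobian\<close> differentiates at the value of the variable; a
        shift by \<open>x q\<close> relates the two.\<close>
      define ev where "ev l = (if l = q then 1 else 0 :: complex)" for l
      have "(\<Sum>j<n. g p j * ev j) = (\<Sum>j<n. if j = q then g p q else 0)"
        by (intro sum.cong refl) (simp add: ev_def)
      then have "dd (f p) x ev (g p q)" using g pq spec[of "\<lambda>v. dd (f p) x v (\<Sum>j<n. g p j * v j)" ev] by simp
      then have "((\<lambda>t. f p (\<lambda>i. x i + t * ev i)) has_field_derivative g p q) (at 0)" by (simp only: dd_def)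
      moreover have "f p (\<lambda>i. x i + t * ev i) = F (Matrix.vec n (\<lambda>l. if l = q then t + x q else xv $ l)) $ p" for t
        unfolding Fv[OF pq(1)]
        by (rule arg_cong[where f = "\<lambda>y. F y $ p"]) (rule eq_vecI, auto simp: ev_def xv_def)
      ultimately have "((\<lambda>t. F (Matrix.vec n (\<lambda>l. if l = q then t + x q else xv $ l)) $ p) has_field_derivative g p q) (at 0)"
        by simp
      then have "((\<lambda>t. F (Matrix.vec n (\<lambda>l. if l = q then t else xv $ l)) $ p) has_field_derivative g p q) (at (x q))"
        using DERIV_shift[of "\<lambda>t. F (Matrix.vec n (\<lambda>l. if l = q then t else xv $ l)) $ p" "g p q" 0 "x q"] by simp
      moreover have "xv $ q = x q" using pq by (simp add: xv_def)
      ultimately show ?thesis using pq by (simp add: Defs.jacobian_def DERIV_imp_deriv)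
    qed
    have "Defs.jacobian n F xv *\<^sub>v vv = 0\<^sub>v n"
    proof (rule eq_vecI)
      fix p assume "p < dim_vec (0\<^sub>v n)"
      then have p: "p < n" by simp
      have "(Defs.jacobian n F xv *\<^sub>v vv) $ p = (\<Sum>q<n. g p q * v q)"
        unfolding mult_mat_vec_index[OF Jc vv p] by (intro sum.cong refl) (simp add: J p vv_def)
      also have "\<dots> = 0"
      proof (rule dd_unique)
        show "dd (f p) x v (\<Sum>q<n. g p q * v q)" using g p by simp
        show "dd (f p) x v 0" using z p by simp
      qed
      finally show "(Defs.jacobian n F xv *\<^sub>v vv) $ p = 0\<^sub>v n $ p" using p by simp
    qed (use Jc in simp)
    moreover obtain B where B: "B * Defs.jacobian n F xv = 1\<^sub>m n" "B \<in> carrier_mat n n"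
    proof -
      from inv xv have "invertible_mat (Defs.jacobian n F xv)" by simp
      then obtain B where B: "inverts_mat (Defs.jacobian n F xv) B" "inverts_mat B (Defs.jacobian n F xv)"
        unfolding invertible_mat_def by auto
      \<comment> \<open>\<open>invertible_mat\<close> does not fix the size of the inverse; it is
        read off from the two products.\<close>
      have B2: "B * Defs.jacobian n F xv = 1\<^sub>m (dim_row B)" "Defs.jacobian n F xv * B = 1\<^sub>m n"
        using B Jc by (simp_all add: inverts_mat_def)
      have "dim_row B = n" using arg_cong[OF B2(1), of dim_col] Jc by simp
      moreover have "dim_col B = n" using arg_cong[OF B2(2), of dim_col] by simp
      ultimately show ?thesis using that[of B] B2(1) by auto
    qed
    moreover have "B *\<^sub>v 0\<^sub>v n = 0\<^sub>v n" using B(2) by (intro eq_vecI) auto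
    ultimately have "vv = 0\<^sub>v n"
      using assoc_mult_mat_vec[OF B(2) Jc vv] vv B by simp
    then have "vv $ i = 0\<^sub>v n $ i" by simp
    then show "v i = 0" using i by (simp add: vv_def)
  qed
  then have nn: "\<not> noninj n f" using no[of d f] pf by (simp add: counterexample_def)
  have inj: "a i = b i" if "\<And>i. i < n \<Longrightarrow> f i a = f i b" "i < n" for a b i
  proof (rule ccontr)
    assume "a i \<noteq> b i"
    then have "noninj n f" unfolding noninj_def
      by (intro exI[of _ a] exI[of _ b]) (use that in auto)
    with nn show False by simp
  qed
  have loc: "inj_keller_map n d f"
  proof (intro inj_keller_map.intro keller_map.intro inj_keller_map_axioms.intro)
    show "pd n d (f i)" if "i < n" for i by (rule pf[OF that])
    show "keller n f" by (rule kel)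
    show "a i = b i" if "\<And>i. i < n \<Longrightarrow> f i a = f i b" "i < n" for a b i
      by (rule inj[OF that])
  qed
  from inj_keller_map.polynomial_inverse[OF loc] obtain d' G' where
    G': "(\<forall>i<n. pd n d' (G' i)) \<and> (\<forall>x. \<forall>i<n. G' i (\<lambda>j. f j x) = x i \<and> f i (\<lambda>j. G' j x) = x i)"
    by (elim exE) (rule that)
  define K where "K x = Matrix.vec n (\<lambda>i. G' i (\<lambda>i. x $ i))" for x :: "complex vec"
  have "polynomial_map n K"
    unfolding polynomial_map_def
  proof (intro conjI allI impI)
    show "K \<in> carrier_vec n \<rightarrow> carrier_vec n" by (auto simp: K_def)
    show "polynomial_fun n (\<lambda>x. K x $ i)" if "i < n" for i
      by (rule pd_polynomial_fun[of n d' "G' i"]) (use G' that in \<open>simp_all add: K_def\<close>)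
  qed
  moreover have "K (F x) = x \<and> F (K x) = x" if x: "x \<in> carrier_vec n" for x
  proof (rule conjI)
    show "K (F x) = x"
    proof (rule eq_vecI)
      fix i assume "i < dim_vec x"
      then have i: "i < n" using x by simp
      have "K (F x) $ i = G' i (\<lambda>i. F x $ i)" using i by (simp add: K_def)
      also have "\<dots> = G' i (\<lambda>j. f j (\<lambda>i. x $ i))"
        using G' i by (intro pd_cong[of n d' "G' i"]) (auto simp: Ff x)
      also have "\<dots> = x $ i" using G' i by simp
      finally show "K (F x) $ i = x $ i" .
    qed (use x in \<open>simp add: K_def\<close>)
    have Kx: "K x \<in> carrier_vec n" by (simp add: K_def)
    show "F (K x) = x"
    proof (rule eq_vecI)
      fix i assume "i < dim_vec x"
      then have i: "i < n" using x by simp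
      have "F (K x) $ i = f i (\<lambda>i. K x $ i)" by (rule Ff[OF i Kx])
      also have "\<dots> = f i (\<lambda>j. G' j (\<lambda>i. x $ i))"
        by (intro pd_cong[OF pf[OF i]]) (simp add: K_def)
      also have "\<dots> = x $ i" using G' i by simp
      finally show "F (K x) $ i = x $ i" .
    qed (use x Fc[OF Kx] in simp)
  qed
  ultimately show "\<exists>G. polynomial_map n G \<and> (\<forall>x\<in>carrier_vec n. G (F x) = x \<and> F (G x) = x)"
    by (intro exI[of _ K]) simp
qed

lemma polynomial_map_druzkowski:
  assumes A: "A \<in> carrier_mat n n"
  shows "polynomial_map n (druzkowski_map A)"
  unfolding polynomial_map_def
proof (intro conjI allI impI)
  show "druzkowski_map A \<in> carrier_vec n \<rightarrow> carrier_vec n"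
    using A by (auto simp: druzkowski_map_def cw_power_def)
  fix i assume i: "i < n"
  show "polynomial_fun n (\<lambda>x. druzkowski_map A x $ i)"
  proof (rule pd_polynomial_fun)
    have v: "pd n 1 (\<lambda>x. x j)" if "j < n" for j using pd_var[OF that, of 0] by simp
    have "pd n (3 * 1) (\<lambda>x. (\<Sum>q<n. A $$ (i, q) * x q) ^ 3)"
      by (intro pd_power pd_sum pd_cmult v) auto
    then show "pd n 3 (\<lambda>x. x i + (\<Sum>q<n. A $$ (i, q) * x q) ^ 3)"
      by (intro pd_add pd_mono[OF v[OF i]]) auto
  qed (simp add: druzkowski_map_index[OF A _ i])
qed

text \<open>With \<open>w = - (Z\<^sup>3 + Z * (A y)\<^sup>2)\<close> the equation says \<open>A w = Z\<close>, and for \<open>u = y / \<surd>3\<close> the identity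
  \<open>(s + d)\<^sup>3 - (s - d)\<^sup>3 = 6 s\<^sup>2 d + 2 d\<^sup>3\<close> shows that \<open>F\<^sub>A\<close> takes the same value at \<open>u + w\<close> and \<open>u - w\<close>.\<close>

lemma druzkowski_solution_noninjective:
  assumes dr: "druzkowski n A" and y: "y \<in> carrier_vec n" and k: "0 < k" "k \<le> n"
    and eq: "Z_vec n k + A *\<^sub>v (Z_vec n k ^\<^sub>v 3 + Z_vec n k \<circledast> (A *\<^sub>v y) ^\<^sub>v 2) = 0\<^sub>v n"
  shows "\<exists>a b. a \<in> carrier_vec n \<and> b \<in> carrier_vec n \<and> a \<noteq> b \<and> druzkowski_map A a = druzkowski_map A b"
proof -
  have A: "A \<in> carrier_mat n n" using dr by (simp add: druzkowski_def)
  define z where "z i = (if i < k then 1 else 0 :: complex)" for i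
  define s where "s i = (\<Sum>q<n. A $$ (i, q) * y $ q)" for i
  define W where "W = Z_vec n k ^\<^sub>v 3 + Z_vec n k \<circledast> (A *\<^sub>v y) ^\<^sub>v 2"
  have Wc: "W \<in> carrier_vec n" using A by (simp add: W_def Z_vec_def cw_power_def cw_mult_def)
  have W: "W $ i = z i ^ 3 + z i * s i ^ 2" if "i < n" for i
    using that A mult_mat_vec_index[OF A y that] by (simp add: W_def Z_vec_def cw_power_def cw_mult_def z_def s_def)
  have AW: "(\<Sum>q<n. A $$ (i, q) * W $ q) = - z i" if i: "i < n" for i
  proof -
    have "(Z_vec n k + A *\<^sub>v W) $ i = 0" using eq i by (simp add: W_def)
    then have "z i + (\<Sum>q<n. A $$ (i, q) * W $ q) = 0"
      using i A mult_mat_vec_index[OF A Wc i] by (simp add: Z_vec_def z_def)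
    then show ?thesis by (simp add: eq_neg_iff_add_eq_0 add.commute)
  qed
  define \<kappa> where "\<kappa> = csqrt 3"
  have \<kappa>: "\<kappa> ^ 2 = 3" "\<kappa> \<noteq> 0" unfolding \<kappa>_def by (rule power2_csqrt, simp)
  \<comment> \<open>These are u + w and u - w for w = - W; \<open>A\<close> maps them to s /
    \<kappa> plus and minus z, which differ in coordinate 0 because k > 0.\<close>
  define a where "a = Matrix.vec n (\<lambda>i. y $ i / \<kappa> - W $ i)"
  define b where "b = Matrix.vec n (\<lambda>i. y $ i / \<kappa> + W $ i)"
  have ac: "a \<in> carrier_vec n" and bc: "b \<in> carrier_vec n" by (simp_all add: a_def b_def)
  have Aa: "(\<Sum>q<n. A $$ (i, q) * a $ q) = s i / \<kappa> + z i" if "i < n" for i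
  proof -
    have "(\<Sum>q<n. A $$ (i, q) * a $ q) = (\<Sum>q<n. A $$ (i, q) * y $ q / \<kappa> - A $$ (i, q) * W $ q)"
      by (intro sum.cong refl) (simp add: a_def right_diff_distrib)
    then show ?thesis using AW[OF that] by (simp add: sum_subtractf s_def sum_divide_distrib)
  qed
  have Ab: "(\<Sum>q<n. A $$ (i, q) * b $ q) = s i / \<kappa> - z i" if "i < n" for i
  proof -
    have "(\<Sum>q<n. A $$ (i, q) * b $ q) = (\<Sum>q<n. A $$ (i, q) * y $ q / \<kappa> + A $$ (i, q) * W $ q)"
      by (intro sum.cong refl) (simp add: b_def distrib_left)
    then show ?thesis using AW[OF that] by (simp add: sum.distrib s_def sum_divide_distrib)
  qed
  have cube: "(\<alpha> + \<beta>) ^ 3 - (\<alpha> - \<beta>) ^ 3 = 6 * \<alpha> ^ 2 * \<beta> + 2 * \<beta> ^ 3" for \<alpha> \<beta> :: complex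
    by (simp add: power3_eq_cube power2_eq_square algebra_simps)
  have "druzkowski_map A a = druzkowski_map A b"
  proof (rule eq_vecI)
    show "dim_vec (druzkowski_map A a) = dim_vec (druzkowski_map A b)"
      using A by (simp add: druzkowski_map_def cw_power_def)
    fix i assume "i < dim_vec (druzkowski_map A b)"
    then have i: "i < n" using A by (simp add: druzkowski_map_def cw_power_def)
    have "(s i / \<kappa> + z i) ^ 3 - (s i / \<kappa> - z i) ^ 3 = 6 * (s i / \<kappa>) ^ 2 * z i + 2 * z i ^ 3"
      by (rule cube)
    also have "(s i / \<kappa>) ^ 2 = s i ^ 2 / 3" by (simp add: power_divide \<kappa>)
    finally have "(s i / \<kappa> + z i) ^ 3 = (s i / \<kappa> - z i) ^ 3 + 2 * W $ i"
      by (simp add: W[OF i] algebra_simps)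
    then show "druzkowski_map A a $ i = druzkowski_map A b $ i"
      unfolding druzkowski_map_index[OF A ac i] druzkowski_map_index[OF A bc i] Aa[OF i] Ab[OF i]
      using i by (simp add: a_def b_def)
  qed
  moreover have "a \<noteq> b"
  proof
    assume "a = b"
    then have "s 0 / \<kappa> + z 0 = s 0 / \<kappa> - z 0" using Aa[of 0] Ab[of 0] k by simp
    then show False using k by (simp add: z_def)
  qed
  ultimately show ?thesis using ac bc by (intro exI[of _ a] exI[of _ b]) simp
qed

theorem theorem1p10:
  shows "JC_infinity \<longleftrightarrow>
    (\<forall>n. \<forall>k \<in> {3..n}.
       \<not> (\<exists>A y. druzkowski n A \<and> y \<in> carrier_vec n \<and>
            Z_vec n k + A *\<^sub>v (Z_vec n k ^\<^sub>v 3 + Z_vec n k \<circledast> (A *\<^sub>v y) ^\<^sub>v 2) = 0\<^sub>v n))"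
proof
  assume JC: JC_infinity
  show "\<forall>n. \<forall>k \<in> {3..n}.
       \<not> (\<exists>A y. druzkowski n A \<and> y \<in> carrier_vec n \<and>
            Z_vec n k + A *\<^sub>v (Z_vec n k ^\<^sub>v 3 + Z_vec n k \<circledast> (A *\<^sub>v y) ^\<^sub>v 2) = 0\<^sub>v n)"
  proof (intro allI ballI notI, elim exE conjE)
    fix n k A y assume k: "k \<in> {3..n}" and dr: "druzkowski n A" and y: "y \<in> carrier_vec n"
      and eq: "Z_vec n k + A *\<^sub>v (Z_vec n k ^\<^sub>v 3 + Z_vec n k \<circledast> (A *\<^sub>v y) ^\<^sub>v 2) = 0\<^sub>v n"
    have A: "A \<in> carrier_mat n n" using dr by (simp add: druzkowski_def)
    have inv: "invertible_mat (Defs.jacobian n (druzkowski_map A) x)" if x: "x \<in> carrier_vec n" for x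
    proof -
      have c: "Defs.jacobian n (druzkowski_map A) x \<in> carrier_mat n n" by (simp add: Defs.jacobian_def)
      have "Determinant.det (Defs.jacobian n (druzkowski_map A) x) = 1" using dr x by (simp add: druzkowski_def)
      then obtain B where B: "B \<in> carrier_mat n n" "B * Defs.jacobian n (druzkowski_map A) x = 1\<^sub>m n"
        "Defs.jacobian n (druzkowski_map A) x * B = 1\<^sub>m n"
        using det_non_zero_imp_unit[OF c] unfolding Units_def ring_mat_def by auto
      then show ?thesis using c unfolding invertible_mat_def inverts_mat_def
        by (intro conjI exI[of _ B]) auto
    qed
    have "JC n" using JC by (simp add: JC_infinity_def)
    from this[unfolded JC_def, rule_format, of "druzkowski_map A"] obtain G where
      G: "polynomial_map n G \<and> (\<forall>x\<in>carrier_vec n. G (druzkowski_map A x) = x \<and> druzkowski_map A (G x) = x)"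
      using polynomial_map_druzkowski[OF A] inv by auto
    have "0 < k" "k \<le> n" using k by auto
    from druzkowski_solution_noninjective[OF dr y this eq] obtain a b where
      ab: "a \<in> carrier_vec n \<and> b \<in> carrier_vec n \<and> a \<noteq> b \<and> druzkowski_map A a = druzkowski_map A b"
      by (elim exE) (rule that)
    have inv: "G (druzkowski_map A x) = x" if "x \<in> carrier_vec n" for x using G that by simp
    have "a = G (druzkowski_map A b)" using inv[of a] ab by simp
    also have "\<dots> = b" using inv[of b] ab by simp
    finally show False using ab by simp
  qed
next
  assume no: "\<forall>n. \<forall>k \<in> {3..n}.
       \<not> (\<exists>A y. druzkowski n A \<and> y \<in> carrier_vec n \<and>
            Z_vec n k + A *\<^sub>v (Z_vec n k ^\<^sub>v 3 + Z_vec n k \<circledast> (A *\<^sub>v y) ^\<^sub>v 2) = 0\<^sub>v n)"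
  show JC_infinity
    unfolding JC_infinity_def
  proof (intro allI JC_if_no_counterexample notI)
    fix n d F assume "counterexample n d F"
    from cubic_homogeneous_counterexample[OF this] obtain m H where
      H: "(\<forall>i<m. form m 3 (H i)) \<and> keller m (\<lambda>i x. x i + H i x) \<and> noninj m (\<lambda>i x. x i + H i x)"
      by (elim exE) (rule that)
    then have "\<exists>N. \<exists>k\<in>{3..N}. \<exists>M y. druzkowski N M \<and> y \<in> carrier_vec N \<and>
      Z_vec N k + M *\<^sub>v (Z_vec N k ^\<^sub>v 3 + Z_vec N k \<circledast> (M *\<^sub>v y) ^\<^sub>v 2) = 0\<^sub>v N"
      by (intro druzkowski_counterexample[of m H]) auto
    then obtain N where "\<exists>k\<in>{3..N}. \<exists>M y. druzkowski N M \<and> y \<in> carrier_vec N \<and>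
      Z_vec N k + M *\<^sub>v (Z_vec N k ^\<^sub>v 3 + Z_vec N k \<circledast> (M *\<^sub>v y) ^\<^sub>v 2) = 0\<^sub>v N"
      by (rule exE)
    then obtain k where "k \<in> {3..N}" "\<exists>M y. druzkowski N M \<and> y \<in> carrier_vec N \<and>
      Z_vec N k + M *\<^sub>v (Z_vec N k ^\<^sub>v 3 + Z_vec N k \<circledast> (M *\<^sub>v y) ^\<^sub>v 2) = 0\<^sub>v N"
      by (rule bexE)
    from notE[OF bspec[OF spec[OF no, of N] this(1)] this(2)] show False .
  qed
qed

end
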